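(* Let $P_0,r_0>0$ and let $\varepsilon_0,I_0,S_0$ be the constants (depending only on $P_0,r_0$) fixed in the context. Let $X$ be a complete, geodesically complete $\mathrm{CAT}(0)$-space that is $P_0$-packed at scale $r_0$. Let $\Gamma$ be a discrete, almost-cocompact group of isometries of $X$ and let $0<\lambda\le\varepsilon_0$. Assume that $$\mathrm{dias}(\Gamma,X)<\eta(P_0,r_0,\lambda):=\frac{\lambda}{(2I_0-1)(3\cdot2^{S_0-1}-2)}.$$ Then $X=\mathrm{Min}_\lambda(\Gamma,X)$, where $$\mathrm{Min}_\lambda(\Gamma,X)=\bigcup_{g\in\Gamma\setminus\{\mathrm{id}\},\ \ell(g)\le\lambda}\mathrm{Min}(g).$$
   Context: A $\mathrm{CAT}(0)$-space is geodesically complete if every geodesic segment extends to a geodesic line. A metric space $X$ is $P_0$-packed at scale $r_0$ if for every $x\in X$ every subset of the closed ball $\overline B(x,3r_0)$ whose distinct points are at distance $>2r_0$ from each other has cardinality at most $P_0$. A group $\Gamma$ of isometries of $X$ means a subgroup of $\mathrm{Isom}(X)$; it is discrete if for all $x\in X$ and $\eta\ge 0$ the set $\{g\in\Gamma : d(x,gx)<\eta\}$ is finite. Write $\Gamma^*=\Gamma\setminus\{\mathrm{id}\}$, $\mathrm{sys}(\Gamma,x)=\inf_{g\in\Gamma^*}d(x,gx)$ and $\mathrm{dias}(\Gamma,X)=\sup_{x\in X}\mathrm{sys}(\Gamma,x)$. For $\delta>0$ let $\mathrm{Thick}_\delta(\Gamma,X)=\{x\in X:\mathrm{sys}(\Gamma,x)\ge\delta\}$;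 $\Gamma$ is almost-cocompact if its action on $\mathrm{Thick}_\delta(\Gamma,X)$ is cocompact for every $\delta>0$. For $g\in\mathrm{Isom}(X)$, $\ell(g)=\inf_{x\in X}d(x,gx)$ and $\mathrm{Min}(g)=\{x\in X:d(x,gx)=\ell(g)\}$ (possibly empty). Constants. Let $\overline\Gamma_\eta(x)$ be the subgroup generated by $\{g\in\Gamma:d(x,gx)\le\eta\}$. By a theorem of Breuillard–Green–Tao there are constants $\varepsilon_0>0$ and integers $I_0,S_0\ge1$, depending only on $P_0,r_0$ and fixed once and for all, such that for every complete, geodesically complete $\mathrm{CAT}(0)$-space $X$ that is $P_0$-packed at scale $r_0$, every discrete group $\Gamma$ of isometries of $X$, every $x\in X$ and every $0<\eta\le\varepsilon_0$ there are normal subgroups $\Delta_x,\Lambda_x$ of $\overline\Gamma_\eta(x)$ with $[\overline\Gamma_\eta(x):\Delta_x]\le I_0$, $\Lambda_x$ a finite subgroup of $\Delta_x$, and $\Delta_x/\Lambda_x$ nilpotent of step $\le S_0$. *)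

theory Defs
  imports
    "HOL-Analysis.Analysis"
    "HOL-Algebra.Bij"
    "HOL-Algebra.Generated_Groups"
begin

text \<open>
  A space is given by a carrier \<open>M\<close> and a distance \<open>d\<close> with \<^term>\<open>Metric_space M d\<close>, rather than by
  a type class, because the constants below have to serve for all spaces at once.
\<close>

subsection \<open>CAT(0) spaces\<close>

definition geodesic_on :: "'a set \<Rightarrow> ('a \<Rightarrow> 'a \<Rightarrow> real) \<Rightarrow> real set \<Rightarrow> (real \<Rightarrow> 'a) \<Rightarrow> bool" where
  "geodesic_on M d I c \<longleftrightarrow> c ` I \<subseteq> M \<and> (\<forall>s\<in>I. \<forall>t\<in>I. d (c s) (c t) = \<bar>s - t\<bar>)"

definition geodesic_segment :: "'a set \<Rightarrow> ('a \<Rightarrow> 'a \<Rightarrow> real) \<Rightarrow> 'a \<Rightarrow> 'a \<Rightarrow> 'a set \<Rightarrow> bool" where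
  "geodesic_segment M d p q S \<longleftrightarrow>
    (\<exists>c. geodesic_on M d {0..d p q} c \<and> c 0 = p \<and> c (d p q) = q \<and> S = c ` {0..d p q})"

definition geodesic_space :: "'a set \<Rightarrow> ('a \<Rightarrow> 'a \<Rightarrow> real) \<Rightarrow> bool" where
  "geodesic_space M d \<longleftrightarrow> Metric_space M d \<and> (\<forall>p\<in>M. \<forall>q\<in>M. \<exists>S. geodesic_segment M d p q S)"

text \<open>
  \<open>x'\<close>, on the side from \<open>p'\<close> to \<open>q'\<close> of a comparison triangle, is the comparison point of \<open>x\<close>, on
  the side \<open>S\<close> from \<open>p\<close> to \<open>q\<close> of a geodesic triangle.
\<close>

definition comparison_point ::
    "('a \<Rightarrow> 'a \<Rightarrow> real) \<Rightarrow> 'a \<Rightarrow> 'a set \<Rightarrow> real^2 \<Rightarrow> real^2 \<Rightarrow> 'a \<Rightarrow> real^2 \<Rightarrow> bool" where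
  "comparison_point d p S p' q' x x' \<longleftrightarrow>
    x \<in> S \<and> x' \<in> closed_segment p' q' \<and> dist p' x' = d p x"

definition CAT0_space :: "'a set \<Rightarrow> ('a \<Rightarrow> 'a \<Rightarrow> real) \<Rightarrow> bool" where
  "CAT0_space M d \<longleftrightarrow> geodesic_space M d \<and>
    (\<forall>p\<in>M. \<forall>q\<in>M. \<forall>r\<in>M. \<forall>S\<^sub>1 S\<^sub>2 S\<^sub>3. \<forall>p' q' r' :: real^2.
      geodesic_segment M d p q S\<^sub>1 \<and> geodesic_segment M d q r S\<^sub>2 \<and> geodesic_segment M d r p S\<^sub>3 \<and>
      dist p' q' = d p q \<and> dist q' r' = d q r \<and> dist r' p' = d r p \<longrightarrow>
      (let comparison = (\<lambda>x x'. comparison_point d p S\<^sub>1 p' q' x x' \<or>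
                                comparison_point d q S\<^sub>2 q' r' x x' \<or>
                                comparison_point d r S\<^sub>3 r' p' x x')
       in \<forall>x y x' y'. comparison x x' \<and> comparison y y' \<longrightarrow> d x y \<le> dist x' y'))"

text \<open>Geodesic segments to be extended are non-degenerate (\<open>a < b\<close>).\<close>

definition geodesically_complete :: "'a set \<Rightarrow> ('a \<Rightarrow> 'a \<Rightarrow> real) \<Rightarrow> bool" where
  "geodesically_complete M d \<longleftrightarrow>
    (\<forall>a b c. a < b \<and> geodesic_on M d {a..b} c \<longrightarrow>
      (\<exists>\<gamma>. geodesic_on M d UNIV \<gamma> \<and> (\<forall>t\<in>{a..b}. \<gamma> t = c t)))"

definition packed :: "'a set \<Rightarrow> ('a \<Rightarrow> 'a \<Rightarrow> real) \<Rightarrow> real \<Rightarrow> real \<Rightarrow> bool" where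
  "packed M d P\<^sub>0 r\<^sub>0 \<longleftrightarrow>
    (\<forall>x\<in>M. \<forall>S \<subseteq> Metric_space.mcball M d x (3 * r\<^sub>0).
      (\<forall>y\<in>S. \<forall>z\<in>S. y \<noteq> z \<longrightarrow> d y z > 2 * r\<^sub>0) \<longrightarrow> finite S \<and> real (card S) \<le> P\<^sub>0)"

subsection \<open>Groups of isometries\<close>

text \<open>
  As in \<^const>\<open>BijGroup\<close>, isometries are extensional functions (equal to \<^const>\<open>undefined\<close> outside
  \<open>M\<close>), so that each isometry of \<open>M\<close> is represented exactly once.
\<close>

definition isom_group :: "'a set \<Rightarrow> ('a \<Rightarrow> 'a \<Rightarrow> real) \<Rightarrow> ('a \<Rightarrow> 'a) monoid" where
  "isom_group M d =
    (BijGroup M)\<lparr>carrier := {g \<in> Bij M. \<forall>x\<in>M. \<forall>y\<in>M. d (g x) (g y) = d x y}\<rparr>"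

definition discrete_group :: "'a set \<Rightarrow> ('a \<Rightarrow> 'a \<Rightarrow> real) \<Rightarrow> ('a \<Rightarrow> 'a) set \<Rightarrow> bool" where
  "discrete_group M d \<Gamma> \<longleftrightarrow> (\<forall>x\<in>M. \<forall>\<eta>\<ge>0. finite {g \<in> \<Gamma>. d x (g x) < \<eta>})"

definition nontrivial :: "'a set \<Rightarrow> ('a \<Rightarrow> 'a \<Rightarrow> real) \<Rightarrow> ('a \<Rightarrow> 'a) set \<Rightarrow> ('a \<Rightarrow> 'a) set" where
  "nontrivial M d \<Gamma> = \<Gamma> - {\<one>\<^bsub>isom_group M d\<^esub>}"

text \<open>Values in \<^typ>\<open>ereal\<close>: the systole of the trivial group is \<open>\<infinity>\<close>, and the diastole may be \<open>\<infinity>\<close>.\<close>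

definition sys :: "'a set \<Rightarrow> ('a \<Rightarrow> 'a \<Rightarrow> real) \<Rightarrow> ('a \<Rightarrow> 'a) set \<Rightarrow> 'a \<Rightarrow> ereal" where
  "sys M d \<Gamma> x = (INF g\<in>nontrivial M d \<Gamma>. ereal (d x (g x)))"

definition dias :: "'a set \<Rightarrow> ('a \<Rightarrow> 'a \<Rightarrow> real) \<Rightarrow> ('a \<Rightarrow> 'a) set \<Rightarrow> ereal" where
  "dias M d \<Gamma> = (SUP x\<in>M. sys M d \<Gamma> x)"

definition Thick :: "'a set \<Rightarrow> ('a \<Rightarrow> 'a \<Rightarrow> real) \<Rightarrow> ('a \<Rightarrow> 'a) set \<Rightarrow> real \<Rightarrow> 'a set" where
  "Thick M d \<Gamma> \<delta> = {x \<in> M. sys M d \<Gamma> x \<ge> ereal \<delta>}"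

definition cocompact_on :: "'a set \<Rightarrow> ('a \<Rightarrow> 'a \<Rightarrow> real) \<Rightarrow> ('a \<Rightarrow> 'a) set \<Rightarrow> 'a set \<Rightarrow> bool" where
  "cocompact_on M d \<Gamma> A \<longleftrightarrow>
    (\<exists>K \<subseteq> A. compactin (Metric_space.mtopology M d) K \<and> A = (\<Union>g\<in>\<Gamma>. g ` K))"

definition almost_cocompact :: "'a set \<Rightarrow> ('a \<Rightarrow> 'a \<Rightarrow> real) \<Rightarrow> ('a \<Rightarrow> 'a) set \<Rightarrow> bool" where
  "almost_cocompact M d \<Gamma> \<longleftrightarrow> (\<forall>\<delta>>0. cocompact_on M d \<Gamma> (Thick M d \<Gamma> \<delta>))"

definition transl_length :: "'a set \<Rightarrow> ('a \<Rightarrow> 'a \<Rightarrow> real) \<Rightarrow> ('a \<Rightarrow> 'a) \<Rightarrow> real" where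
  "transl_length M d g = (INF x\<in>M. d x (g x))"

definition Min_set :: "'a set \<Rightarrow> ('a \<Rightarrow> 'a \<Rightarrow> real) \<Rightarrow> ('a \<Rightarrow> 'a) \<Rightarrow> 'a set" where
  "Min_set M d g = {x \<in> M. d x (g x) = transl_length M d g}"

definition Min_le :: "'a set \<Rightarrow> ('a \<Rightarrow> 'a \<Rightarrow> real) \<Rightarrow> ('a \<Rightarrow> 'a) set \<Rightarrow> real \<Rightarrow> 'a set" where
  "Min_le M d \<Gamma> l = (\<Union>g\<in>{g \<in> nontrivial M d \<Gamma>. transl_length M d g \<le> l}. Min_set M d g)"

subsection \<open>The constants of Breuillard--Green--Tao\<close>

text \<open>The lower central series, with \<open>G\<close> itself at index \<open>0\<close>.\<close>

primrec lower_central :: "('g, 'm) monoid_scheme \<Rightarrow> nat \<Rightarrow> 'g set" where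
  "lower_central G 0 = carrier G"
| "lower_central G (Suc n) = generate G
    (\<Union>a\<in>lower_central G n. \<Union>b\<in>carrier G. {a \<otimes>\<^bsub>G\<^esub> b \<otimes>\<^bsub>G\<^esub> inv\<^bsub>G\<^esub> a \<otimes>\<^bsub>G\<^esub> inv\<^bsub>G\<^esub> b})"

definition nilpotent_of_step_le :: "('g, 'm) monoid_scheme \<Rightarrow> nat \<Rightarrow> bool" where
  "nilpotent_of_step_le G s \<longleftrightarrow> group G \<and> lower_central G s = {\<one>\<^bsub>G\<^esub>}"

definition small_displacement_group ::
    "'a set \<Rightarrow> ('a \<Rightarrow> 'a \<Rightarrow> real) \<Rightarrow> ('a \<Rightarrow> 'a) set \<Rightarrow> real \<Rightarrow> 'a \<Rightarrow> ('a \<Rightarrow> 'a) monoid" where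
  "small_displacement_group M d \<Gamma> \<eta> x =
    (isom_group M d)\<lparr>carrier := generate (isom_group M d) {g \<in> \<Gamma>. d x (g x) \<le> \<eta>}\<rparr>"

definition almost_nilpotent :: "('g, 'm) monoid_scheme \<Rightarrow> nat \<Rightarrow> nat \<Rightarrow> bool" where
  "almost_nilpotent G I S \<longleftrightarrow>
    (\<exists>\<Delta> \<Lambda>. \<Delta> \<lhd> G \<and> \<Lambda> \<lhd> G \<and>
      finite (rcosets\<^bsub>G\<^esub> \<Delta>) \<and> card (rcosets\<^bsub>G\<^esub> \<Delta>) \<le> I \<and>
      \<Lambda> \<subseteq> \<Delta> \<and> finite \<Lambda> \<and>
      nilpotent_of_step_le (G\<lparr>carrier := \<Delta>\<rparr> Mod \<Lambda>) S)"

text \<open>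
  The theorem of Breuillard--Green--Tao provides constants with this property. Being a formula of
  higher-order logic, it can range only over the spaces carried by subsets of one type \<^typ>\<open>'a\<close>.
\<close>

definition BGT_constants :: "'a itself \<Rightarrow> real \<Rightarrow> real \<Rightarrow> real \<Rightarrow> nat \<Rightarrow> nat \<Rightarrow> bool" where
  "BGT_constants (_ :: 'a itself) P\<^sub>0 r\<^sub>0 \<epsilon>\<^sub>0 I\<^sub>0 S\<^sub>0 \<longleftrightarrow>
    \<epsilon>\<^sub>0 > 0 \<and> I\<^sub>0 \<ge> 1 \<and> S\<^sub>0 \<ge> 1 \<and>
    (\<forall>(M :: 'a set) d \<Gamma> x \<eta>.
      CAT0_space M d \<and> Metric_space.mcomplete M d \<and> geodesically_complete M d \<and> packed M d P\<^sub>0 r\<^sub>0 \<and>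
      subgroup \<Gamma> (isom_group M d) \<and> discrete_group M d \<Gamma> \<and> x \<in> M \<and> 0 < \<eta> \<and> \<eta> \<le> \<epsilon>\<^sub>0 \<longrightarrow>
      almost_nilpotent (small_displacement_group M d \<Gamma> \<eta> x) I\<^sub>0 S\<^sub>0)"

end

theory Submission
  imports Defs
begin

text \<open>
  Suppose that some point lies in no \<open>Min(g)\<close> with \<open>g \<noteq> 1\<close> of translation length at most \<open>l\<close>, and let \<open>U\<close>
  be the set of points lying in no \<open>Min(g)\<close> with \<open>g \<noteq> 1\<close> of translation length at most \<open>\<mu>\<close>, for some \<open>\<mu> < l\<close>
  close to \<open>l\<close>. Almost-cocompactness yields, in a thick part of the closure of \<open>U\<close>, a point \<open>y\<close> that
  minimizes lexicographically a sequence of invariant potentials, each of which decreases when small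
  displacements increase. Let \<open>G\<close> be generated by the elements displacing \<open>y\<close> by less than \<open>\<tau>\<close>, where
  \<open>\<mu> < \<tau> < l\<close>. Pushing points of \<open>U\<close> away from a \<open>G\<close>-invariant closed convex set \<open>C\<close>, along geodesics
  that exist by geodesic completeness, decreases no displacement \<open>d(x, gx)\<close> with \<open>g \<in> G\<close> and keeps them in
  \<open>U\<close>. Extremality of \<open>y\<close> and convexity of displacements then force \<open>d(py, gpy) = d(y, gy)\<close> for the
  projection \<open>p\<close> to \<open>C\<close> and all \<open>g \<in> G\<close>.

  Suitable sets \<open>C\<close> show that \<open>G\<close> has no nontrivial finite normal subgroup, that its nilpotent subgroup
  \<open>\<Delta>\<close> of index at most \<open>I\<^sub>0\<close> is abelian with \<open>y \<in> Min(g)\<close> for all \<open>g \<in> \<Delta>\<close>, that the orbit \<open>Gy\<close> lies in the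
  flat through \<open>y\<close> spanned by the axes of \<open>\<Delta>\<close>, and that \<open>\<Delta>\<close> contains no nontrivial element displacing \<open>y\<close>
  by at most \<open>\<mu>\<close>. As \<open>\<mu>\<close> is \<open>2 I\<^sub>0 - 1\<close> times a bound on the diastole, the elements below this bound at \<open>y\<close>
  generate a finite group, which fixes a point of the flat. Moving \<open>y\<close> radially away from that point, and
  generically perturbing it so as to end in \<open>U\<close>, increases all these displacements, which contradicts
  the minimality of the first potential.
\<close>

subsection \<open>Convexity in complete CAT(0) spaces\<close>

text \<open>Neither translation lengths nor extremal displacements need be attained, and U is not
  closed. Hence a push starts at points of U near y, and only its limit is compared with y. A single
  potential sees finitely many words, whereas equality of displacements is wanted for all g in G. So
  the n-th potential admits words of length n + 1 in letters below a level that increases to \<tau>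
  without reaching it; the gap keeps a push of positive length from bringing in letters outside G.
  The weights record the displacement of the product besides those of the letters, so that equal
  potentials force equal displacements for every product. The factor 2 I_0 - 1 is a word length.
  Letters reach all the cosets of \<Delta> that they reach at all by words of length less than I_0;
  if a product of one more letter and the inverse of such a word is trivial whenever it lies in
  \<Delta>, the letters generate a finite group. At y such a product has displacement at most (2 I_0
  - 1) s \<le> \<mu>. The strict inequalities between the diastole, s_1, s and the bound of the
  theorem leave room for moving y.\<close>

lemma comparison_triangle_exists:
  fixes a b c :: real
  assumes "a \<ge> 0" "b \<ge> 0" "c \<ge> 0" "a \<le> b + c" "b \<le> a + c" "c \<le> a + b"
  obtains p q r :: "real^2" where "dist p q = a" "dist q r = b" "dist r p = c"
proof (cases "a = 0")
  case True
  then have "b = c" using assms by simp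
  define p r :: "real^2" where "p = 0" and "r = axis 1 b"
  have "dist p p = a" "dist p r = b" "dist r p = c"
    using True \<open>b = c\<close> assms by (auto simp: p_def r_def dist_norm norm_vec_def L2_set_def axis_def sum_2)
  then show thesis by (rule that)
next
  case False
  then have a: "a > 0" using assms by simp
  \<comment> \<open>Law of cosines with \<open>p\<close> at the origin and \<open>q\<close> on the
    first axis. The triangle inequalities say exactly that \<bar>x\<bar> is at most
    \<open>c\<close>, so that the height \<open>y\<close> is real.\<close>
  define x where "x = (a\<^sup>2 + c\<^sup>2 - b\<^sup>2) / (2 * a)"
  have "\<bar>a\<^sup>2 + c\<^sup>2 - b\<^sup>2\<bar> \<le> 2 * a * c"
  proof -
    have "b\<^sup>2 \<le> (a + c)\<^sup>2" using assms by (intro power_mono) auto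
    moreover have "(a - c)\<^sup>2 \<le> b\<^sup>2"
      using assms by (intro abs_le_square_iff[THEN iffD1]) auto
    ultimately show ?thesis by (auto simp: power2_eq_square algebra_simps abs_le_iff)
  qed
  then have "\<bar>x\<bar> \<le> c"
    using a by (auto simp: x_def abs_le_iff field_simps)
  then have xc: "x\<^sup>2 \<le> c\<^sup>2"
    using abs_le_square_iff[of x c] assms by simp
  define y where "y = sqrt (c\<^sup>2 - x\<^sup>2)"
  have y2: "y\<^sup>2 = c\<^sup>2 - x\<^sup>2" using xc by (simp add: y_def)
  define p q r :: "real^2" where "p = 0" and "q = vector [a, 0]" and "r = vector [x, y]"
  have "dist p q = a"
    using a by (simp add: p_def q_def dist_norm norm_vec_def L2_set_def sum_2)
  moreover have "dist r p = c"
    using y2 assms by (simp add: p_def r_def dist_norm norm_vec_def L2_set_def sum_2)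
  moreover have "(a - x)\<^sup>2 + y\<^sup>2 = b\<^sup>2"
    using a y2 by (simp add: x_def field_simps power2_eq_square)
  then have "dist q r = b"
    using assms by (simp add: q_def r_def dist_norm norm_vec_def L2_set_def sum_2)
  ultimately show thesis using that by blast
qed

text \<open>Stewart's theorem. Combined with one CAT(0) comparison it becomes the CN inequality of
  Bruhat and Tits, the form in which nonpositive curvature enters the later estimates.\<close>

lemma euclidean_CN:
  fixes p q r :: "'b::real_inner"
  assumes "m = (1 - s) *\<^sub>R q + s *\<^sub>R r"
  shows "(dist p m)\<^sup>2 = (1 - s) * (dist p q)\<^sup>2 + s * (dist p r)\<^sup>2 - s * (1 - s) * (dist q r)\<^sup>2"
proof -
  define u v where "u = p - q" and "v = p - r"
  have 1: "p - m = (1 - s) *\<^sub>R u + s *\<^sub>R v"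
    by (simp add: assms u_def v_def algebra_simps)
  have 2: "q - r = v - u" by (simp add: u_def v_def)
  show ?thesis
    unfolding dist_norm 1 2 u_def[symmetric] v_def[symmetric] power2_norm_eq_inner
    by (simp add: inner_commute algebra_simps)
qed

locale complete_CAT0 =
  fixes M :: "'a set" and d :: "'a \<Rightarrow> 'a \<Rightarrow> real"
  assumes CAT0: "CAT0_space M d" and mcomplete: "Metric_space.mcomplete M d"

sublocale complete_CAT0 \<subseteq> Metric_space M d
  using CAT0 by (auto simp: CAT0_space_def geodesic_space_def)

context complete_CAT0
begin

lemma geodesic_segment_exists:
  assumes "p \<in> M" "q \<in> M"
  obtains S where "geodesic_segment M d p q S"
  using CAT0 assms unfolding CAT0_space_def geodesic_space_def by blast

definition at_frac :: "real \<Rightarrow> 'a \<Rightarrow> 'a \<Rightarrow> 'a \<Rightarrow> bool" where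
  "at_frac s p q m \<longleftrightarrow> m \<in> M \<and> d p m = s * d p q \<and> d m q = (1 - s) * d p q"

text \<open>Only the comparison of a vertex \<open>z\<close> with a point of the opposite side
  enters; Stewart's theorem evaluates the comparison distance. Existence and inequality are stated
  for the same point, because uniqueness is not yet available.\<close>

lemma at_frac_exists_CN:
  assumes "p \<in> M" "q \<in> M" "0 \<le> s" "s \<le> 1"
  obtains m where "at_frac s p q m"
    "\<And>z. z \<in> M \<Longrightarrow> (d z m)\<^sup>2 \<le> (1 - s) * (d z p)\<^sup>2 + s * (d z q)\<^sup>2 - s * (1 - s) * (d p q)\<^sup>2"
proof -
  obtain S where S: "geodesic_segment M d p q S"
    using geodesic_segment_exists assms by blast
  then obtain c where c: "geodesic_on M d {0..d p q} c" "c 0 = p" "c (d p q) = q" "S = c ` {0..d p q}"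
    by (auto simp: geodesic_segment_def)
  define m where "m = c (s * d p q)"
  have sd: "s * d p q \<in> {0..d p q}" using assms by (auto simp: mult_left_le_one_le)
  have mM: "m \<in> M" using c sd by (auto simp: geodesic_on_def m_def)
  have "d (c 0) (c (s * d p q)) = \<bar>0 - s * d p q\<bar>" "d (c (s * d p q)) (c (d p q)) = \<bar>s * d p q - d p q\<bar>"
    using c(1) sd nonneg[of p q] unfolding geodesic_on_def by (meson atLeastAtMost_iff order_refl)+
  moreover have "s * d p q - d p q = - ((1 - s) * d p q)" by (simp add: algebra_simps)
  moreover have "0 \<le> (1 - s) * d p q" using assms by simp
  ultimately have pm: "d p m = s * d p q" and mq: "d m q = (1 - s) * d p q"
    using c(2,3) sd by (simp_all add: m_def)
  show thesis
  proof (rule that[of m])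
    show "at_frac s p q m" using mM pm mq by (simp add: at_frac_def)
    fix z assume z: "z \<in> M"
    obtain S1 where S1: "geodesic_segment M d z p S1" using geodesic_segment_exists assms z by blast
    obtain S3 where S3: "geodesic_segment M d q z S3" using geodesic_segment_exists assms z by blast
    have tri: "d z p \<le> d p q + d q z" "d p q \<le> d z p + d q z" "d q z \<le> d z p + d p q"
      using triangle[of z q p] triangle[of p z q] triangle[of q p z] z assms commute by auto
    obtain z' p' q' :: "real^2" where *: "dist z' p' = d z p" "dist p' q' = d p q" "dist q' z' = d q z"
      using comparison_triangle_exists[of "d z p" "d p q" "d q z"] tri by auto
    define m' where "m' = (1 - s) *\<^sub>R p' + s *\<^sub>R q'"
    have "p' - m' = s *\<^sub>R (p' - q')" by (simp add: m'_def algebra_simps)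
    then have "dist p' m' = s * d p q"
      using assms * by (simp add: dist_norm)
    moreover have "m' \<in> closed_segment p' q'"
      using assms by (auto simp: m'_def in_segment)
    moreover have "m \<in> S" using c sd by (auto simp: m_def)
    ultimately have cm: "comparison_point d p S p' q' m m'"
      using pm by (simp add: comparison_point_def)
    have "z \<in> S1" using S1 z assms by (force simp: geodesic_segment_def)
    then have cz: "comparison_point d z S1 z' p' z z'"
      using z by (simp add: comparison_point_def)
    have "d z m \<le> dist z' m'"
      using CAT0[unfolded CAT0_space_def, THEN conjunct2, rule_format,
          of z p q S1 S S3 z' p' q'] z assms S S1 S3 * cm cz
      by (auto simp: Let_def)
    then have "(d z m)\<^sup>2 \<le> (dist z' m')\<^sup>2" by (intro power_mono) auto
    also have "\<dots> = (1 - s) * (dist z' p')\<^sup>2 + s * (dist z' q')\<^sup>2 - s * (1 - s) * (dist p' q')\<^sup>2"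
      by (rule euclidean_CN) (rule m'_def)
    finally show "(d z m)\<^sup>2 \<le> (1 - s) * (d z p)\<^sup>2 + s * (d z q)\<^sup>2 - s * (1 - s) * (d p q)\<^sup>2"
      using * by (simp add: dist_commute commute)
  qed
qed

text \<open>Let \<open>z\<close> in the CN inequality of one candidate be the other candidate: the
  right-hand side is s (1 - s) (s + (1 - s) - 1) times the square of \<open>d p q\<close>, hence
  0.\<close>

lemma at_frac_unique:
  assumes "p \<in> M" "q \<in> M" "0 \<le> s" "s \<le> 1" "at_frac s p q m" "at_frac s p q m'"
  shows "m = m'"
proof -
  have "x = y" if y: "at_frac s p q y"
    and CN: "\<And>z. z \<in> M \<Longrightarrow> (d z x)\<^sup>2 \<le> (1 - s) * (d z p)\<^sup>2 + s * (d z q)\<^sup>2 - s * (1 - s) * (d p q)\<^sup>2"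
    and x: "at_frac s p q x" for x y
  proof -
    have "(d y x)\<^sup>2 \<le> (1 - s) * (d y p)\<^sup>2 + s * (d y q)\<^sup>2 - s * (1 - s) * (d p q)\<^sup>2"
      by (rule CN) (use y in \<open>simp add: at_frac_def\<close>)
    also have "\<dots> = 0"
      using y by (simp add: at_frac_def commute power_mult_distrib) (simp add: power2_eq_square algebra_simps)
    finally have "d y x = 0" by simp
    then show ?thesis using x y by (simp add: at_frac_def zero)
  qed
  then show ?thesis
    using at_frac_exists_CN[OF assms(1-4)] assms(5,6) by metis
qed

text \<open>Characterized by two distances instead of by a chosen geodesic, so that a point is
  identified as \<open>pt s p q\<close> by computing distances, as in \<open>pt_eqI\<close>.\<close>

definition pt :: "real \<Rightarrow> 'a \<Rightarrow> 'a \<Rightarrow> 'a" where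
  "pt s p q = (SOME m. at_frac s p q m)"

lemma at_frac_pt:
  assumes "p \<in> M" "q \<in> M" "0 \<le> s" "s \<le> 1"
  shows "at_frac s p q (pt s p q)"
  unfolding pt_def using at_frac_exists_CN[OF assms] by (metis someI)

lemma pt_in [simp]: "p \<in> M \<Longrightarrow> q \<in> M \<Longrightarrow> 0 \<le> s \<Longrightarrow> s \<le> 1 \<Longrightarrow> pt s p q \<in> M"
  using at_frac_pt by (simp add: at_frac_def)

lemma pt_eqI:
  assumes "p \<in> M" "q \<in> M" "0 \<le> s" "s \<le> 1" "m \<in> M" "d p m = s * d p q" "d m q = (1 - s) * d p q"
  shows "pt s p q = m"
  using at_frac_unique[OF assms(1-4) at_frac_pt[OF assms(1-4)]] assms by (simp add: at_frac_def)

lemma d_pt: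
  assumes "p \<in> M" "q \<in> M" "0 \<le> s" "s \<le> 1"
  shows "d p (pt s p q) = s * d p q" "d (pt s p q) q = (1 - s) * d p q"
  using at_frac_pt[OF assms] by (auto simp: at_frac_def)

lemma CN:
  assumes "p \<in> M" "q \<in> M" "0 \<le> s" "s \<le> 1" "z \<in> M"
  shows "(d z (pt s p q))\<^sup>2 \<le> (1 - s) * (d z p)\<^sup>2 + s * (d z q)\<^sup>2 - s * (1 - s) * (d p q)\<^sup>2"
proof -
  obtain m where "at_frac s p q m"
    "\<And>z. z \<in> M \<Longrightarrow> (d z m)\<^sup>2 \<le> (1 - s) * (d z p)\<^sup>2 + s * (d z q)\<^sup>2 - s * (1 - s) * (d p q)\<^sup>2"
    using at_frac_exists_CN[OF assms(1-4)] by metis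
  then show ?thesis
    using at_frac_unique[OF assms(1-4) at_frac_pt[OF assms(1-4)]] assms(5) by metis
qed

lemma CN_midpoint:
  assumes "p \<in> M" "q \<in> M" "z \<in> M"
  shows "(d z (pt (1/2) p q))\<^sup>2 \<le> (d z p)\<^sup>2 / 2 + (d z q)\<^sup>2 / 2 - (d p q)\<^sup>2 / 4"
  using CN[OF assms(1,2), of "1/2" z] assms by simp

text \<open>CN is used twice, with \<open>r\<close> and with \<open>pt s p q\<close> as the vertex;
  the resulting expression is the one of a Euclidean triangle and equals the square of
  \<open>s * d q r\<close>.\<close>

lemma pt_same_start:
  assumes "p \<in> M" "q \<in> M" "r \<in> M" "0 \<le> s" "s \<le> 1"
  shows "d (pt s p q) (pt s p r) \<le> s * d q r"
proof -
  have 1: "(d (pt s p q) (pt s p r))\<^sup>2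
    \<le> (1 - s) * (d (pt s p q) p)\<^sup>2 + s * (d (pt s p q) r)\<^sup>2 - s * (1 - s) * (d p r)\<^sup>2"
    using CN[of p r s "pt s p q"] assms by simp
  have 2: "(d r (pt s p q))\<^sup>2 \<le> (1 - s) * (d r p)\<^sup>2 + s * (d r q)\<^sup>2 - s * (1 - s) * (d p q)\<^sup>2"
    using CN[of p q s r] assms by simp
  have "(d (pt s p q) (pt s p r))\<^sup>2 \<le> (1 - s) * (s * d p q)\<^sup>2
    + s * ((1 - s) * (d r p)\<^sup>2 + s * (d r q)\<^sup>2 - s * (1 - s) * (d p q)\<^sup>2) - s * (1 - s) * (d p r)\<^sup>2"
    using 1 mult_left_mono[OF 2 assms(4)] d_pt(1)[OF assms(1,2,4,5)] by (simp add: commute)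
  also have "\<dots> = (s * d q r)\<^sup>2"
    by (simp add: commute[of r] power2_eq_square algebra_simps)
  finally show ?thesis
    using abs_le_square_iff[of "d (pt s p q) (pt s p r)" "s * d q r"] assms by simp
qed

lemma pt_swap:
  assumes "p \<in> M" "q \<in> M" "0 \<le> s" "s \<le> 1"
  shows "pt (1 - s) q p = pt s p q"
  using assms d_pt[OF assms] by (intro pt_eqI) (auto simp: commute)

text \<open>Cut the quadrilateral along the diagonal from \<open>p\<close> to \<open>q'\<close> and
  apply the triangle estimate from \<open>p\<close> and from \<open>q'\<close>.\<close>

lemma pt_convex:
  assumes "p \<in> M" "q \<in> M" "p' \<in> M" "q' \<in> M" "0 \<le> s" "s \<le> 1"
  shows "d (pt s p q) (pt s p' q') \<le> (1 - s) * d p p' + s * d q q'"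
proof -
  have "d (pt s p q) (pt s p' q') \<le> d (pt s p q) (pt s p q') + d (pt s p q') (pt s p' q')"
    using assms by (intro triangle) auto
  moreover have "d (pt s p q) (pt s p q') \<le> s * d q q'"
    using pt_same_start assms by simp
  moreover have "d (pt (1 - s) q' p) (pt (1 - s) q' p') \<le> (1 - s) * d p p'"
    using pt_same_start[of q' p p' "1 - s"] assms by simp
  ultimately show ?thesis using pt_swap assms by simp
qed

text \<open>CN at the midpoint \<open>m\<close> of the diagonal from \<open>p\<close> to
  \<open>r\<close>, seen from \<open>q\<close> and from \<open>s\<close>, with (a + b)^2 \<le> 2 a^2
  + 2 b^2 for the other diagonal. This inequality takes the place of angles: projections and flows
  along axes are compared through it.\<close>

lemma quadrilateral:
  assumes "p \<in> M" "q \<in> M" "r \<in> M" "s \<in> M"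
  shows "(d p r)\<^sup>2 + (d q s)\<^sup>2 \<le> (d p q)\<^sup>2 + (d q r)\<^sup>2 + (d r s)\<^sup>2 + (d s p)\<^sup>2"
proof -
  define m where "m = pt (1/2) p r"
  have m: "m \<in> M" using assms by (simp add: m_def)
  have "d q s \<le> d q m + d m s" using assms m by (intro triangle)
  then have "(d q s)\<^sup>2 \<le> (d q m + d m s)\<^sup>2" by (intro power_mono) auto
  also have "\<dots> \<le> 2 * (d q m)\<^sup>2 + 2 * (d s m)\<^sup>2"
    using sum_squares_bound[of "d q m" "d m s"] by (simp add: power2_eq_square algebra_simps commute)
  finally show ?thesis
    using CN_midpoint[OF assms(1,3,2)] CN_midpoint[OF assms(1,3,4)]
    by (simp add: m_def[symmetric] commute)
qed

lemma d_pt_pt: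
  assumes "p \<in> M" "q \<in> M" "0 \<le> s" "s \<le> 1" "0 \<le> t" "t \<le> 1"
  shows "d (pt s p q) (pt t p q) = \<bar>s - t\<bar> * d p q"
proof -
  have main: "d (pt s p q) (pt t p q) = (t - s) * d p q" if "s \<le> t" "0 \<le> s" "t \<le> 1" for s t
  proof (cases "t = 0")
    case True
    then show ?thesis using that assms by simp
  next
    case False
    then have t: "t > 0" using that by simp
    define u where "u = s / t"
    have u: "0 \<le> u" "u \<le> 1" using that t by (auto simp: u_def)
    define y where "y = pt t p q"
    have y: "y \<in> M" "d p y = t * d p q" "d y q = (1 - t) * d p q"
      using that t assms d_pt[of p q t] by (auto simp: y_def)
    define x where "x = pt u p y"
    have x: "x \<in> M" "d p x = s * d p q" "d x y = (t - s) * d p q"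
      using u y(1) assms apply (simp add: x_def)
      using d_pt(1)[of p y u] u y assms t apply (simp add: x_def u_def)
      using d_pt(2)[of p y u] u y assms t by (simp add: x_def u_def left_diff_distrib)
    have "d x q \<le> d x y + d y q" "d p q \<le> d p x + d x q"
      using triangle[of x y q] triangle[of p x q] x(1) y(1) assms by blast+
    then have "d x q = (1 - s) * d p q" using x y by (simp add: algebra_simps)
    then have "pt s p q = x" using x assms that by (intro pt_eqI) auto
    then show ?thesis using x by (simp add: y_def)
  qed
  show ?thesis
  proof (cases "s \<le> t")
    case True then show ?thesis using main assms by simp
  next
    case False then show ?thesis using main[of t s] assms by (simp add: commute)
  qed
qed

section \<open>Limits of sequences, closed sets and convex sets\<close>

definition conv :: "(nat \<Rightarrow> 'a) \<Rightarrow> 'a \<Rightarrow> bool" where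
  "conv x y \<longleftrightarrow> (\<forall>n. x n \<in> M) \<and> y \<in> M \<and> (\<lambda>n. d (x n) y) \<longlonglongrightarrow> 0"

definition sclosed :: "'a set \<Rightarrow> bool" where
  "sclosed C \<longleftrightarrow> C \<subseteq> M \<and> (\<forall>x y. (\<forall>n. x n \<in> C) \<and> conv x y \<longrightarrow> y \<in> C)"

definition gconvex :: "'a set \<Rightarrow> bool" where
  "gconvex C \<longleftrightarrow> (\<forall>x\<in>C. \<forall>y\<in>C. \<forall>s\<in>{0..1}. pt s x y \<in> C)"

lemma conv_subseq: "conv x y \<Longrightarrow> strict_mono r \<Longrightarrow> conv (x \<circ> r) y"
  unfolding conv_def using LIMSEQ_subseq_LIMSEQ[of "\<lambda>n. d (x n) y" 0 r] by (auto simp: o_def)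

lemma conv_dist:
  assumes "conv x y" "conv x' y'"
  shows "(\<lambda>n. d (x n) (x' n)) \<longlonglongrightarrow> d y y'"
proof -
  have *: "\<bar>d (x n) (x' n) - d y y'\<bar> \<le> d (x n) y + d (x' n) y'" for n
  proof -
    have "d (x n) (x' n) \<le> d (x n) y + d y y' + d y' (x' n)"
      using triangle[of "x n" y "x' n"] triangle[of y y' "x' n"] assms by (auto simp: conv_def)
    moreover have "d y y' \<le> d y (x n) + d (x n) (x' n) + d (x' n) y'"
      using triangle[of y "x n" y'] triangle[of "x n" "x' n" y'] assms by (auto simp: conv_def)
    ultimately show ?thesis by (auto simp: commute abs_le_iff)
  qed
  have "(\<lambda>n. d (x n) y + d (x' n) y') \<longlonglongrightarrow> 0"
    using tendsto_add[of "\<lambda>n. d (x n) y" 0 sequentially "\<lambda>n. d (x' n) y'" 0] assms by (simp add: conv_def)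
  then have "(\<lambda>n. d (x n) (x' n) - d y y') \<longlonglongrightarrow> 0"
    by (rule tendsto_rabs_zero_cancel[OF tendsto_sandwich[OF _ _ tendsto_const], rotated 2]) (use * in auto)
  then show ?thesis by (simp add: LIM_zero_iff)
qed

lemma conv_const [simp]: "conv (\<lambda>_. y) y \<longleftrightarrow> y \<in> M"
  by (auto simp: conv_def)

lemma Cauchy_conv:
  assumes "\<And>n. x n \<in> M" "\<And>e. e > 0 \<Longrightarrow> \<exists>N. \<forall>m\<ge>N. \<forall>n\<ge>N. d (x m) (x n) < e"
  obtains y where "conv x y"
proof -
  have "MCauchy x" using assms unfolding MCauchy_def by blast
  then obtain y where "limitin mtopology x y sequentially"
    using mcomplete unfolding mcomplete_def by blast
  then have "conv x y" using assms by (auto simp: limitin_metric_dist_null conv_def)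
  then show thesis by (rule that)
qed

lemma conv_from_close:
  assumes "y \<in> M" "\<And>e. e > 0 \<Longrightarrow> \<exists>x\<in>A. d x y < e" "A \<subseteq> M"
  obtains x where "\<And>n. x n \<in> A" "conv x y"
proof -
  have "\<exists>x\<in>A. d x y < 1 / Suc n" for n using assms(2)[of "1 / Suc n"] by auto
  then obtain x where x: "\<And>n. x n \<in> A" "\<And>n. d (x n) y < 1 / Suc n" by metis
  have "(\<lambda>n. d (x n) y) \<longlonglongrightarrow> 0"
    by (rule tendsto_sandwich[OF _ _ tendsto_const lim_inverse_n'[THEN LIMSEQ_Suc]])
       (use x in \<open>auto simp: less_imp_le intro!: always_eventually\<close>)
  then have "conv x y" using x assms by (auto simp: conv_def)
  then show thesis using x that by blast
qed

end

context complete_CAT0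
begin

lemma sclosedD: "sclosed C \<Longrightarrow> (\<And>n. x n \<in> C) \<Longrightarrow> conv x y \<Longrightarrow> y \<in> C"
  unfolding sclosed_def by blast

lemma gconvexD: "gconvex C \<Longrightarrow> x \<in> C \<Longrightarrow> y \<in> C \<Longrightarrow> 0 \<le> s \<Longrightarrow> s \<le> 1 \<Longrightarrow> pt s x y \<in> C"
  by (simp add: gconvex_def)

lemma gconvex_Inter: "(\<And>C. C \<in> \<C> \<Longrightarrow> gconvex C) \<Longrightarrow> gconvex (M \<inter> \<Inter>\<C>)"
  unfolding gconvex_def by (auto intro: pt_in)

lemma sclosed_Inter: "(\<And>C. C \<in> \<C> \<Longrightarrow> sclosed C) \<Longrightarrow> sclosed (M \<inter> \<Inter>\<C>)"
  unfolding sclosed_def conv_def by blast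

text \<open>The midpoint of two almost minimizers would undercut the infimum unless they are close
  to each other, so minimizing sequences are Cauchy. The lemma serves for projections and for fixed
  points of finite groups.\<close>

lemma strongly_convex_min:
  assumes C: "C \<noteq> {}" "sclosed C" "gconvex C"
    and nonneg: "\<And>x. x \<in> C \<Longrightarrow> 0 \<le> \<Phi> x"
    and cont: "\<And>x y. (\<And>n. x n \<in> C) \<Longrightarrow> conv x y \<Longrightarrow> (\<lambda>n. \<Phi> (x n)) \<longlonglongrightarrow> \<Phi> y"
    and k: "k > 0"
    and strong: "\<And>x y. x \<in> C \<Longrightarrow> y \<in> C \<Longrightarrow> \<Phi> (pt (1/2) x y) \<le> \<Phi> x / 2 + \<Phi> y / 2 - k * (d x y)\<^sup>2"
  obtains p where "p \<in> C" "\<And>c. c \<in> C \<Longrightarrow> \<Phi> p \<le> (\<Phi> c :: real)"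
    "\<And>c. c \<in> C \<Longrightarrow> \<Phi> c \<le> \<Phi> p \<Longrightarrow> c = p"
proof -
  define I where "I = Inf (\<Phi> ` C)"
  have bdd: "bdd_below (\<Phi> ` C)" using nonneg by (auto intro!: bdd_belowI2)
  have I: "I \<le> \<Phi> x" if "x \<in> C" for x unfolding I_def using that bdd by (auto intro: cInf_lower)
  have "\<exists>x\<in>C. \<Phi> x < I + 1 / Suc n" for n
    using cInf_lessD[of "\<Phi> ` C" "I + 1 / Suc n"] C by (auto simp: I_def)
  then obtain x where x: "\<And>n. x n \<in> C" "\<And>n. \<Phi> (x n) < I + 1 / Suc n" by metis
  have CM: "C \<subseteq> M" using C by (simp add: sclosed_def)
  have key: "k * (d x y)\<^sup>2 \<le> \<Phi> x / 2 + \<Phi> y / 2 - I" if "x \<in> C" "y \<in> C" for x y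
    using strong[OF that] I[of "pt (1/2) x y"] gconvexD[OF C(3) that, of "1/2"] by simp
  have "\<exists>N. \<forall>m\<ge>N. \<forall>n\<ge>N. d (x m) (x n) < e" if e: "e > 0" for e
  proof -
    obtain N :: nat where N: "1 / Suc N < k * e\<^sup>2"
      using reals_Archimedean[of "k * e\<^sup>2"] k e by (auto simp: inverse_eq_divide)
    have "d (x m) (x n) < e" if "m \<ge> N" "n \<ge> N" for m n
    proof -
      have "k * (d (x m) (x n))\<^sup>2 \<le> \<Phi> (x m) / 2 + \<Phi> (x n) / 2 - I" using key x by simp
      also have "\<dots> \<le> (1 / Suc m) / 2 + (1 / Suc n) / 2"
      proof -
        have "a / 2 + b / 2 - I \<le> a' / 2 + b' / 2" if "a < I + a'" "b < I + b'" for a b a' b'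
          using that by simp
        then show ?thesis using x(2) by blast
      qed
      also have "\<dots> \<le> (1 / Suc N) / 2 + (1 / Suc N) / 2"
        using that by (intro add_mono divide_right_mono frac_le) auto
      also have "\<dots> < k * e\<^sup>2" using N unfolding field_sum_of_halves .
      finally have "(d (x m) (x n))\<^sup>2 < e\<^sup>2" using k by simp
      then show ?thesis using e by (simp add: power2_less_imp_less)
    qed
    then show ?thesis by blast
  qed
  then obtain p where p: "conv x p"
    using Cauchy_conv[of x] x CM by blast
  have pC: "p \<in> C" using sclosedD[OF C(2) x(1) p] .
  have "(\<lambda>n. I + 1 / Suc n) \<longlonglongrightarrow> I + 0"
    by (intro tendsto_add tendsto_const lim_inverse_n'[THEN LIMSEQ_Suc])
  then have "\<Phi> p \<le> I"
    using LIMSEQ_le[OF cont[OF x(1) p], of "\<lambda>n. I + 1 / Suc n" I] x(2) by (auto intro: less_imp_le)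
  then have pI: "\<Phi> p = I" using I[OF pC] by simp
  show thesis
  proof (rule that[OF pC])
    show "\<Phi> p \<le> \<Phi> c" if "c \<in> C" for c using I[OF that] pI by simp
    show "c = p" if "c \<in> C" "\<Phi> c \<le> \<Phi> p" for c
    proof -
      have "k * (d c p)\<^sup>2 \<le> 0" using key[OF that(1) pC] that pI by simp
      then have "d c p = 0" using k by (simp add: mult_le_0_iff)
      then show ?thesis using that(1) pC CM zero[of c p] by blast
    qed
  qed
qed

subsection \<open>Projections\<close>

definition ccset :: "'a set \<Rightarrow> bool" where
  "ccset C \<longleftrightarrow> C \<noteq> {} \<and> sclosed C \<and> gconvex C"

lemma ccset_subset: "ccset C \<Longrightarrow> C \<subseteq> M"
  by (simp add: ccset_def sclosed_def)

definition proj :: "'a set \<Rightarrow> 'a \<Rightarrow> 'a" where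
  "proj C x = (SOME p. p \<in> C \<and> (\<forall>c\<in>C. d x p \<le> d x c))"

lemma proj_props:
  assumes C: "ccset C" and x: "x \<in> M"
  shows proj_in: "proj C x \<in> C" and proj_le: "c \<in> C \<Longrightarrow> d x (proj C x) \<le> d x c"
    and proj_unique: "c \<in> C \<Longrightarrow> d x c \<le> d x (proj C x) \<Longrightarrow> c = proj C x"
proof -
  have C': "C \<noteq> {}" "sclosed C" "gconvex C" "C \<subseteq> M" using C by (auto simp: ccset_def sclosed_def)
  obtain p where p: "p \<in> C" "\<And>c. c \<in> C \<Longrightarrow> (d x p)\<^sup>2 \<le> (d x c)\<^sup>2"
    "\<And>c. c \<in> C \<Longrightarrow> (d x c)\<^sup>2 \<le> (d x p)\<^sup>2 \<Longrightarrow> c = p"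
  proof (rule strongly_convex_min[OF C'(1-3), of "\<lambda>c. (d x c)\<^sup>2" "1/4"])
    show "(\<lambda>n. (d x (xa n))\<^sup>2) \<longlonglongrightarrow> (d x y)\<^sup>2" if "conv xa y" for xa y
      using conv_dist[of "\<lambda>_. x" x xa y] x that by (intro tendsto_power) auto
    show "(d x (pt (1 / 2) xa y))\<^sup>2 \<le> (d x xa)\<^sup>2 / 2 + (d x y)\<^sup>2 / 2 - 1/4 * (d xa y)\<^sup>2"
      if "xa \<in> C" "y \<in> C" for xa y
      using CN_midpoint[of xa y x] that x C' by auto
  qed (use that in auto)
  have "p \<in> C \<and> (\<forall>c\<in>C. d x p \<le> d x c)"
    using p by (auto intro: power2_le_imp_le)
  then have P: "proj C x \<in> C \<and> (\<forall>c\<in>C. d x (proj C x) \<le> d x c)"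
    unfolding proj_def by (rule someI)
  then show "proj C x \<in> C" "c \<in> C \<Longrightarrow> d x (proj C x) \<le> d x c" by auto
  have "proj C x = p" using p P by (auto intro!: p(3) power_mono)
  then show "c \<in> C \<Longrightarrow> d x c \<le> d x (proj C x) \<Longrightarrow> c = proj C x"
    using p(3)[of c] by (auto intro: power_mono)
qed

text \<open>The projection beats every point of the segment from it to \<open>c\<close>. Dividing
  the CN estimate by \<open>s\<close> and letting \<open>s\<close> tend to 0 gives the obtuse angle
  at the projection in Pythagorean form.\<close>

lemma proj_pythagoras:
  assumes C: "ccset C" and x: "x \<in> M" and c: "c \<in> C"
  shows "(d x (proj C x))\<^sup>2 + (d (proj C x) c)\<^sup>2 \<le> (d x c)\<^sup>2"
proof -
  define p where "p = proj C x"
  have p: "p \<in> C" "p \<in> M" "c \<in> M" using proj_in[OF C x] ccset_subset[OF C] c by (auto simp: p_def)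
  have ineq: "(d x p)\<^sup>2 \<le> (d x c)\<^sup>2 - (1 - s) * (d p c)\<^sup>2" if s: "0 < s" "s \<le> 1" for s
  proof -
    have "pt s p c \<in> C" using C p c s by (auto simp: ccset_def intro: gconvexD)
    then have "(d x p)\<^sup>2 \<le> (d x (pt s p c))\<^sup>2" using proj_le[OF C x] by (auto simp: p_def intro: power_mono)
    also have "\<dots> \<le> (1 - s) * (d x p)\<^sup>2 + s * (d x c)\<^sup>2 - s * (1 - s) * (d p c)\<^sup>2"
      using CN[of p c s x] p s x by simp
    finally have "s * (d x p)\<^sup>2 \<le> s * ((d x c)\<^sup>2 - (1 - s) * (d p c)\<^sup>2)" by (simp add: algebra_simps)
    then show ?thesis using s by simp
  qed
  have "(\<lambda>n. (d x c)\<^sup>2 - (1 - 1 / Suc n) * (d p c)\<^sup>2) \<longlonglongrightarrow> (d x c)\<^sup>2 - (1 - 0) * (d p c)\<^sup>2"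
    by (intro tendsto_diff tendsto_mult tendsto_const lim_inverse_n'[THEN LIMSEQ_Suc])
  then have "(d x p)\<^sup>2 \<le> (d x c)\<^sup>2 - (1 - 0) * (d p c)\<^sup>2"
    by (rule LIMSEQ_le_const) (use ineq in auto)
  then show ?thesis by (simp add: p_def)
qed

text \<open>In the quadrilateral of the two points and their projections, two uses of
  \<open>proj_pythagoras\<close> cancel all terms but the two wanted squares.\<close>

lemma proj_lipschitz:
  assumes C: "ccset C" and x: "x \<in> M" "y \<in> M"
  shows "d (proj C x) (proj C y) \<le> d x y"
proof -
  have p: "proj C x \<in> C" "proj C y \<in> C" "proj C x \<in> M" "proj C y \<in> M"
    using proj_in[OF C] ccset_subset[OF C] x by auto
  have "(d x (proj C y))\<^sup>2 + (d y (proj C x))\<^sup>2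
    \<le> (d x y)\<^sup>2 + (d y (proj C y))\<^sup>2 + (d (proj C y) (proj C x))\<^sup>2 + (d (proj C x) x)\<^sup>2"
    using quadrilateral[OF x p(4) p(3)] by simp
  then have "(d (proj C x) (proj C y))\<^sup>2 \<le> (d x y)\<^sup>2"
    using proj_pythagoras[OF C x(1) p(2)] proj_pythagoras[OF C x(2) p(1)]
    unfolding commute[of "proj C y" "proj C x"] commute[of "proj C x" x] by linarith
  then show ?thesis by (rule power2_le_imp_le) simp
qed

lemma proj_id: "ccset C \<Longrightarrow> x \<in> C \<Longrightarrow> proj C x = x"
  using proj_unique[of C x x] ccset_subset[of C] by auto

definition dset :: "'a set \<Rightarrow> 'a \<Rightarrow> real" where
  "dset C x = d x (proj C x)"

lemma dset_nonneg [simp]: "0 \<le> dset C x"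
  by (simp add: dset_def)

lemma dset_le: "ccset C \<Longrightarrow> x \<in> M \<Longrightarrow> c \<in> C \<Longrightarrow> dset C x \<le> d x c"
  by (simp add: dset_def proj_le)

lemma dset_convex:
  assumes C: "ccset C" and x: "x \<in> M" "y \<in> M" "0 \<le> s" "s \<le> 1"
  shows "dset C (pt s x y) \<le> (1 - s) * dset C x + s * dset C y"
proof -
  have p: "proj C x \<in> C" "proj C y \<in> C" "proj C x \<in> M" "proj C y \<in> M"
    using proj_in[OF C] ccset_subset[OF C] x by auto
  have "dset C (pt s x y) \<le> d (pt s x y) (pt s (proj C x) (proj C y))"
    using p C x by (intro dset_le) (auto simp: ccset_def intro: gconvexD)
  also have "\<dots> \<le> (1 - s) * dset C x + s * dset C y"
    unfolding dset_def using p x by (intro pt_convex) auto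
  finally show ?thesis .
qed

lemma dset_lipschitz:
  assumes C: "ccset C" and x: "x \<in> M" "y \<in> M"
  shows "dset C x \<le> dset C y + d x y"
  using dset_le[OF C x(1) proj_in[OF C x(2)]] triangle[of x y "proj C y"] x
    proj_in[OF C x(2)] ccset_subset[OF C] by (auto simp: dset_def)

lemma dset_zero: "ccset C \<Longrightarrow> x \<in> M \<Longrightarrow> dset C x = 0 \<longleftrightarrow> x \<in> C"
  using proj_in[of C x] ccset_subset[of C] proj_id[of C x] by (auto simp: dset_def zero subset_iff)

subsection \<open>Displacement functions of isometries\<close>

abbreviation IG :: "('a \<Rightarrow> 'a) monoid" where "IG \<equiv> isom_group M d"

abbreviation iso :: "('a \<Rightarrow> 'a) \<Rightarrow> bool" where "iso g \<equiv> g \<in> carrier IG"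

lemma iso_iff: "iso g \<longleftrightarrow> g \<in> Bij M \<and> (\<forall>x\<in>M. \<forall>y\<in>M. d (g x) (g y) = d x y)"
  by (simp add: isom_group_def)

lemma iso_in [simp]: "iso g \<Longrightarrow> x \<in> M \<Longrightarrow> g x \<in> M"
  by (auto simp: iso_iff Bij_def bij_betw_def)

lemma iso_dist [simp]: "iso g \<Longrightarrow> x \<in> M \<Longrightarrow> y \<in> M \<Longrightarrow> d (g x) (g y) = d x y"
  by (simp add: iso_iff)

lemma subgroup_isom: "subgroup (carrier IG) (BijGroup M)"
proof (rule group.subgroupI[OF group_BijGroup])
  show "carrier IG \<subseteq> carrier (BijGroup M)" by (auto simp: iso_iff BijGroup_def)
  have "(\<lambda>x\<in>M. x) \<in> carrier IG" by (simp add: iso_iff id_Bij)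
  then show "carrier IG \<noteq> {}" by blast
  show "inv\<^bsub>BijGroup M\<^esub> g \<in> carrier IG" if g: "g \<in> carrier IG" for g
  proof -
    have b: "g \<in> Bij M" "bij_betw g M M" using g by (auto simp: iso_iff Bij_def)
    have 1: "inv_into M g x \<in> M" "g (inv_into M g x) = x" if "x \<in> M" for x
      using that b by (auto simp: bij_betw_def inv_into_into f_inv_into_f)
    have "d (inv_into M g x) (inv_into M g y) = d x y" if "x \<in> M" "y \<in> M" for x y
      using iso_dist[OF g 1(1) 1(1), of x y] 1 that by simp
    then show ?thesis using b by (simp add: inv_BijGroup iso_iff restrict_inv_into_Bij)
  qed
  show "g \<otimes>\<^bsub>BijGroup M\<^esub> h \<in> carrier IG" if gh: "g \<in> carrier IG" "h \<in> carrier IG" for g h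
  proof -
    have b: "g \<in> Bij M" "h \<in> Bij M" using gh by (simp_all add: iso_iff)
    then have "g \<otimes>\<^bsub>BijGroup M\<^esub> h = compose M g h" by (simp add: BijGroup_def)
    then show ?thesis
      using compose_Bij[OF b] iso_dist[OF gh(1) iso_in[OF gh(2)] iso_in[OF gh(2)]] iso_dist[OF gh(2)]
      by (simp add: iso_iff compose_eq)
  qed
qed

lemma IG_eq: "IG = (BijGroup M)\<lparr>carrier := carrier IG\<rparr>"
  by (simp add: isom_group_def)

end

sublocale complete_CAT0 \<subseteq> I: group IG
  using subgroup.subgroup_is_group[OF subgroup_isom group_BijGroup] by (simp flip: IG_eq)

context complete_CAT0
begin

lemma mult_iso: "iso g \<Longrightarrow> iso h \<Longrightarrow> g \<otimes>\<^bsub>IG\<^esub> h = compose M g h"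
proof -
  assume "iso g" "iso h"
  then have "g \<in> Bij M" "h \<in> Bij M" by (simp_all only: iso_iff)
  moreover have "mult IG = mult (BijGroup M)" by (simp add: isom_group_def)
  ultimately show ?thesis by (simp only: BijGroup_def monoid.simps restrict_apply if_True)
qed

lemma mult_apply [simp]: "iso g \<Longrightarrow> iso h \<Longrightarrow> x \<in> M \<Longrightarrow> (g \<otimes>\<^bsub>IG\<^esub> h) x = g (h x)"
  by (simp add: mult_iso compose_eq)

lemma one_apply [simp]: "x \<in> M \<Longrightarrow> \<one>\<^bsub>IG\<^esub> x = x"
proof -
  assume "x \<in> M"
  moreover have "one IG = one (BijGroup M)" by (simp add: isom_group_def)
  ultimately show ?thesis by (simp only: BijGroup_def monoid.simps restrict_apply if_True)
qed

lemma inv_apply [simp]: "iso g \<Longrightarrow> x \<in> M \<Longrightarrow> g ((inv\<^bsub>IG\<^esub> g) x) = x"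
  "iso g \<Longrightarrow> x \<in> M \<Longrightarrow> (inv\<^bsub>IG\<^esub> g) (g x) = x"
  using mult_apply[of g "inv\<^bsub>IG\<^esub> g" x] mult_apply[of "inv\<^bsub>IG\<^esub> g" g x] by (simp_all del: mult_apply)

lemma iso_eqI: "iso g \<Longrightarrow> iso h \<Longrightarrow> (\<And>x. x \<in> M \<Longrightarrow> g x = h x) \<Longrightarrow> g = h"
  by (auto simp: iso_iff Bij_def intro: extensionalityI)

lemma iso_pt:
  assumes "iso g" "p \<in> M" "q \<in> M" "0 \<le> s" "s \<le> 1"
  shows "g (pt s p q) = pt s (g p) (g q)"
  using assms d_pt[of p q s] by (intro pt_eqI[symmetric]) auto

lemma iso_conv: "iso g \<Longrightarrow> conv x y \<Longrightarrow> conv (\<lambda>n. g (x n)) (g y)"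
  by (simp add: conv_def)

definition disp :: "('a \<Rightarrow> 'a) \<Rightarrow> 'a \<Rightarrow> real" where "disp g x = d x (g x)"

abbreviation tl :: "('a \<Rightarrow> 'a) \<Rightarrow> real" where "tl \<equiv> transl_length M d"

lemma disp_nonneg [simp]: "0 \<le> disp g x" by (simp add: disp_def)

lemma disp_one [simp]: "x \<in> M \<Longrightarrow> disp \<one>\<^bsub>IG\<^esub> x = 0" by (simp add: disp_def)

lemma disp_lipschitz:
  assumes "iso g" "x \<in> M" "y \<in> M" shows "disp g x \<le> disp g y + 2 * d x y"
  using triangle[of x y "g x"] triangle[of y "g y" "g x"] assms by (simp add: disp_def commute)

lemma disp_conv: "iso g \<Longrightarrow> conv x y \<Longrightarrow> (\<lambda>n. disp g (x n)) \<longlonglongrightarrow> disp g y"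
  unfolding disp_def by (rule conv_dist[OF _ iso_conv[of g]])

lemma disp_convex:
  assumes "iso g" "x \<in> M" "y \<in> M" "0 \<le> s" "s \<le> 1"
  shows "disp g (pt s x y) \<le> (1 - s) * disp g x + s * disp g y"
  using pt_convex[of x y "g x" "g y" s] iso_pt[of g x y s] assms by (simp add: disp_def)

lemma disp_mult: "iso g \<Longrightarrow> iso h \<Longrightarrow> x \<in> M \<Longrightarrow> disp (g \<otimes>\<^bsub>IG\<^esub> h) x \<le> disp g x + disp h x"
  using triangle[of x "g x" "g (h x)"] by (simp add: disp_def)

lemma disp_inv: "iso g \<Longrightarrow> x \<in> M \<Longrightarrow> disp (inv\<^bsub>IG\<^esub> g) x = disp g x"
  using iso_dist[of g "(inv\<^bsub>IG\<^esub> g) x" x] by (simp add: disp_def commute)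

lemma disp_conj: "iso g \<Longrightarrow> iso h \<Longrightarrow> x \<in> M \<Longrightarrow> disp (g \<otimes>\<^bsub>IG\<^esub> h \<otimes>\<^bsub>IG\<^esub> inv\<^bsub>IG\<^esub> g) x = disp h ((inv\<^bsub>IG\<^esub> g) x)"
  using iso_dist[of g "(inv\<^bsub>IG\<^esub> g) x" "h ((inv\<^bsub>IG\<^esub> g) x)"] by (simp add: disp_def)

lemma tl_le: "x \<in> M \<Longrightarrow> tl g \<le> disp g x"
  unfolding transl_length_def disp_def by (intro cINF_lower bdd_belowI2[of _ 0]) auto

lemma tl_greatest: "M \<noteq> {} \<Longrightarrow> (\<And>x. x \<in> M \<Longrightarrow> a \<le> disp g x) \<Longrightarrow> a \<le> tl g"
  unfolding transl_length_def disp_def by (rule cINF_greatest)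

lemma tl_nonneg: "M \<noteq> {} \<Longrightarrow> 0 \<le> tl g"
  by (rule tl_greatest) auto

lemma tl_approx:
  assumes "M \<noteq> {}" "e > 0" obtains x where "x \<in> M" "disp g x < tl g + e"
proof -
  have "\<not> (tl g + e \<le> tl g)" using assms by simp
  then show thesis using tl_greatest[of "tl g + e" g] assms(1) that by (meson not_le)
qed

lemma tl_conj:
  assumes "iso g" "iso h" shows "tl (g \<otimes>\<^bsub>IG\<^esub> h \<otimes>\<^bsub>IG\<^esub> inv\<^bsub>IG\<^esub> g) = tl h"
proof (cases "M = {}")
  case False
  have *: "tl k \<le> tl (g \<otimes>\<^bsub>IG\<^esub> k \<otimes>\<^bsub>IG\<^esub> inv\<^bsub>IG\<^esub> g)" if "iso g" "iso k" for g k
    using that False by (intro tl_greatest) (auto simp: disp_conj intro!: tl_le)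
  have "h = inv\<^bsub>IG\<^esub> g \<otimes>\<^bsub>IG\<^esub> (g \<otimes>\<^bsub>IG\<^esub> h \<otimes>\<^bsub>IG\<^esub> inv\<^bsub>IG\<^esub> g) \<otimes>\<^bsub>IG\<^esub> inv\<^bsub>IG\<^esub> (inv\<^bsub>IG\<^esub> g)"
    by (rule iso_eqI) (use assms in auto)
  then show ?thesis using *[OF assms] *[of "inv\<^bsub>IG\<^esub> g" "g \<otimes>\<^bsub>IG\<^esub> h \<otimes>\<^bsub>IG\<^esub> inv\<^bsub>IG\<^esub> g"] assms by simp
qed (simp add: transl_length_def)

definition sublevel :: "('a \<Rightarrow> 'a) \<Rightarrow> real \<Rightarrow> 'a set" where
  "sublevel g c = {x \<in> M. disp g x \<le> c}"

lemma sublevel_closed: "iso g \<Longrightarrow> sclosed (sublevel g c)"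
  unfolding sclosed_def sublevel_def
  by (auto simp: conv_def intro: LIMSEQ_le_const2[OF disp_conv])

lemma sublevel_convex:
  assumes g: "iso g" shows "gconvex (sublevel g c)"
  unfolding gconvex_def
proof (intro ballI)
  fix x y s assume *: "x \<in> sublevel g c" "y \<in> sublevel g c" "s \<in> {0..1::real}"
  have "disp g (pt s x y) \<le> (1 - s) * disp g x + s * disp g y"
    using * g by (intro disp_convex) (auto simp: sublevel_def)
  also have "\<dots> \<le> (1 - s) * c + s * c"
    using * by (intro add_mono mult_left_mono) (auto simp: sublevel_def)
  finally show "pt s x y \<in> sublevel g c" using * by (simp add: sublevel_def algebra_simps)
qed

definition stable :: "('a \<Rightarrow> 'a) \<Rightarrow> 'a set \<Rightarrow> bool" where
  "stable g C \<longleftrightarrow> (\<forall>x\<in>C. g x \<in> C) \<and> (\<forall>x\<in>C. (inv\<^bsub>IG\<^esub> g) x \<in> C)"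

lemma proj_equivariant:
  assumes C: "ccset C" and g: "iso g" "stable g C" and x: "x \<in> M"
  shows "proj C (g x) = g (proj C x)"
proof (rule proj_unique[OF C, symmetric])
  have p: "proj C (g x) \<in> C" "proj C x \<in> C" "proj C (g x) \<in> M" "proj C x \<in> M"
    using proj_in[OF C] ccset_subset[OF C] x g by auto
  then show "g (proj C x) \<in> C" using g by (simp add: stable_def)
  have "d x (proj C x) \<le> d x ((inv\<^bsub>IG\<^esub> g) (proj C (g x)))"
    using g p x C by (intro proj_le) (auto simp: stable_def)
  also have "\<dots> = d (g x) (proj C (g x))"
    using iso_dist[of g x "(inv\<^bsub>IG\<^esub> g) (proj C (g x))"] g p x by simp
  finally show "d (g x) (g (proj C x)) \<le> d (g x) (proj C (g x))" using g p x by simp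
qed (use g x in auto)

lemma disp_proj:
  assumes C: "ccset C" and g: "iso g" "stable g C" and x: "x \<in> M"
  shows "disp g (proj C x) \<le> disp g x"
  using proj_lipschitz[OF C x, of "g x"] proj_equivariant[OF assms] g x by (simp add: disp_def)

text \<open>\<open>g\<close> maps the midpoint of \<open>x\<close> and \<open>g x\<close> to the
  midpoint of \<open>g x\<close> and \<open>g (g x)\<close>. These are midpoints of two sides of a
  triangle, hence at most half of the third side apart. So each displacement of the square is at
  least twice some displacement of \<open>g\<close>.\<close>

lemma tl_square:
  assumes g: "iso g" and M: "M \<noteq> {}"
  shows "2 * tl g \<le> tl (g \<otimes>\<^bsub>IG\<^esub> g)"
proof (rule tl_greatest[OF M])
  fix x assume x: "x \<in> M"
  have gx: "g x \<in> M" "g (g x) \<in> M" using g x by auto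
  have "tl g \<le> disp g (pt (1/2) x (g x))" using x g by (intro tl_le) auto
  also have "\<dots> = d (pt (1/2) x (g x)) (pt (1/2) (g x) (g (g x)))"
    using iso_pt[of g x "g x" "1/2"] g x by (simp add: disp_def)
  also have "\<dots> = d (pt (1/2) (g x) x) (pt (1/2) (g x) (g (g x)))"
    using pt_swap[of x "g x" "1/2"] gx x by simp
  also have "\<dots> \<le> 1/2 * d x (g (g x))" using gx x by (intro pt_same_start) auto
  finally show "2 * tl g \<le> disp (g \<otimes>\<^bsub>IG\<^esub> g) x" using g x by (simp add: disp_def)
qed

lemma tl_pow2:
  assumes g: "iso g" and M: "M \<noteq> {}"
  shows "2 ^ k * tl g \<le> tl (g [^]\<^bsub>IG\<^esub> ((2::nat) ^ k))"
proof (induction k)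
  case (Suc k)
  have "2 ^ Suc k * tl g \<le> 2 * tl (g [^]\<^bsub>IG\<^esub> ((2::nat) ^ k))" using Suc by simp
  also have "\<dots> \<le> tl (g [^]\<^bsub>IG\<^esub> ((2::nat) ^ k) \<otimes>\<^bsub>IG\<^esub> g [^]\<^bsub>IG\<^esub> ((2::nat) ^ k))"
    using g M by (intro tl_square) auto
  also have "\<dots> = tl (g [^]\<^bsub>IG\<^esub> ((2::nat) ^ Suc k))"
    using g by (simp add: I.nat_pow_mult mult_2)
  finally show ?case .
qed (use g in simp)

lemma disp_pow_le:
  assumes g: "iso g" and x: "x \<in> M"
  shows "disp (g [^]\<^bsub>IG\<^esub> (n::nat)) x \<le> n * disp g x"
proof (induction n)
  case (Suc n)
  have "disp (g [^]\<^bsub>IG\<^esub> Suc n) x \<le> disp (g [^]\<^bsub>IG\<^esub> n) x + disp g x"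
    using disp_mult[of "g [^]\<^bsub>IG\<^esub> n" g x] g x by simp
  then show ?case using Suc by (simp add: algebra_simps)
qed (use x in simp)

text \<open>With m = 2^n - n the exponents n and m add up to a power of two, for which
  \<open>tl_pow2\<close> gives a lower bound. The upper bounds for the two factors then leave no
  slack.\<close>

lemma disp_pow_Min:
  assumes g: "iso g" and x: "x \<in> M" "disp g x = tl g"
  shows "disp (g [^]\<^bsub>IG\<^esub> (n::nat)) x = n * tl g"
proof (rule antisym)
  show "disp (g [^]\<^bsub>IG\<^esub> n) x \<le> n * tl g" using disp_pow_le[OF g x(1)] x by simp
  have M: "M \<noteq> {}" using x by auto
  define m :: nat where "m = 2 ^ n - n"
  have m: "2 ^ n = n + m" using less_imp_le[OF less_exp[of n]] by (simp add: m_def)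
  have "real (n + m) * tl g \<le> tl (g [^]\<^bsub>IG\<^esub> ((2::nat) ^ n))"
    using tl_pow2[OF g M, of n] m[symmetric] by (metis of_nat_numeral of_nat_power)
  also have "\<dots> \<le> disp (g [^]\<^bsub>IG\<^esub> n \<otimes>\<^bsub>IG\<^esub> g [^]\<^bsub>IG\<^esub> m) x"
    using tl_le[OF x(1)] g by (simp add: I.nat_pow_mult m)
  also have "\<dots> \<le> disp (g [^]\<^bsub>IG\<^esub> n) x + disp (g [^]\<^bsub>IG\<^esub> m) x"
    using g x by (intro disp_mult) auto
  also have "disp (g [^]\<^bsub>IG\<^esub> m) x \<le> m * tl g" using disp_pow_le[OF g x(1)] x by simp
  finally show "n * tl g \<le> disp (g [^]\<^bsub>IG\<^esub> n) x" by (simp add: algebra_simps)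
qed

text \<open>The sum of the squared distances to the orbit of \<open>z\<close> is strongly convex and
  \<open>F\<close>-invariant, so \<open>F\<close> fixes its unique minimizer. The minimum is taken
  over \<open>C\<close>, which puts the fixed point there.\<close>

lemma finite_group_fixed_point:
  assumes F: "subgroup F IG" "finite F" and C: "ccset C" "\<And>g. g \<in> F \<Longrightarrow> stable g C"
  obtains q where "q \<in> C" "\<And>g. g \<in> F \<Longrightarrow> g q = q"
proof -
  have C': "C \<noteq> {}" "sclosed C" "gconvex C" "C \<subseteq> M" using C by (auto simp: ccset_def sclosed_def)
  obtain z where z: "z \<in> C" "z \<in> M" using C' by blast
  have FI: "iso g" if "g \<in> F" for g using subgroup.subset[OF F(1)] that by blast
  define \<Phi> where "\<Phi> x = (\<Sum>g\<in>F. (d (g z) x)\<^sup>2)" for x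
  have F1: "card F > 0" using F subgroup.one_closed[OF F(1)] by (auto simp: card_gt_0_iff)
  obtain q where q: "q \<in> C" "\<And>c. c \<in> C \<Longrightarrow> \<Phi> q \<le> \<Phi> c" "\<And>c. c \<in> C \<Longrightarrow> \<Phi> c \<le> \<Phi> q \<Longrightarrow> c = q"
  proof (rule strongly_convex_min[OF C'(1-3), of \<Phi> "card F / 4"])
    show "(\<lambda>n. \<Phi> (x n)) \<longlonglongrightarrow> \<Phi> y" if "conv x y" for x y
      unfolding \<Phi>_def
    proof (intro tendsto_sum tendsto_power)
      show "(\<lambda>n. d (g z) (x n)) \<longlonglongrightarrow> d (g z) y" if "g \<in> F" for g
        using conv_dist[of "\<lambda>_. g z" "g z" x y] FI[OF that] z \<open>conv x y\<close> by simp
    qed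
    show "\<Phi> (pt (1/2) x y) \<le> \<Phi> x / 2 + \<Phi> y / 2 - card F / 4 * (d x y)\<^sup>2" if "x \<in> C" "y \<in> C" for x y
    proof -
      have "\<Phi> (pt (1/2) x y) \<le> (\<Sum>g\<in>F. (d (g z) x)\<^sup>2 / 2 + (d (g z) y)\<^sup>2 / 2 - (d x y)\<^sup>2 / 4)"
        unfolding \<Phi>_def using that C' z FI by (intro sum_mono CN_midpoint) auto
      also have "\<dots> = \<Phi> x / 2 + \<Phi> y / 2 - card F / 4 * (d x y)\<^sup>2"
        by (simp add: \<Phi>_def sum.distrib sum_subtractf sum_divide_distrib)
      finally show ?thesis .
    qed
  qed (use F1 that in \<open>auto simp: \<Phi>_def intro: sum_nonneg\<close>)
  have "h q = q" if h: "h \<in> F" for h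
  proof (rule q(3))
    have qM: "q \<in> M" using q C' by auto
    show "h q \<in> C" using C(2)[OF h] q by (simp add: stable_def)
    have "\<Phi> (h q) = (\<Sum>g\<in>F. (d ((inv\<^bsub>IG\<^esub> h \<otimes>\<^bsub>IG\<^esub> g) z) q)\<^sup>2)"
      unfolding \<Phi>_def
    proof (intro sum.cong refl arg_cong[where f = "\<lambda>x. x\<^sup>2"])
      fix g assume "g \<in> F"
      then show "d (g z) (h q) = d ((inv\<^bsub>IG\<^esub> h \<otimes>\<^bsub>IG\<^esub> g) z) q"
        using iso_dist[of h "(inv\<^bsub>IG\<^esub> h) (g z)" q] FI h z qM by simp
    qed
    also have "\<dots> = \<Phi> q"
      unfolding \<Phi>_def
    proof (rule sum.reindex_bij_witness[of _ "\<lambda>g. h \<otimes>\<^bsub>IG\<^esub> g" "\<lambda>g. inv\<^bsub>IG\<^esub> h \<otimes>\<^bsub>IG\<^esub> g"])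
      show "h \<otimes>\<^bsub>IG\<^esub> (inv\<^bsub>IG\<^esub> h \<otimes>\<^bsub>IG\<^esub> a) = a" "inv\<^bsub>IG\<^esub> h \<otimes>\<^bsub>IG\<^esub> (h \<otimes>\<^bsub>IG\<^esub> a) = a" if "a \<in> F" for a
        using FI[OF that] FI[OF h] by (simp_all add: I.m_assoc[symmetric])
    qed (use h subgroup.m_closed[OF F(1)] subgroup.m_inv_closed[OF F(1)] in auto)
    finally show "\<Phi> (h q) \<le> \<Phi> q" by simp
  qed
  then show thesis using q(1) that by blast
qed

text \<open>Induction on \<open>A\<close>: the points almost minimal for the elements already
  treated form a closed convex set \<open>C\<close>, which \<open>h\<close> preserves because it
  commutes with them. Projecting an almost minimal point of \<open>h\<close> to \<open>C\<close>
  does not increase its displacement under \<open>h\<close>.\<close>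

lemma near_minimal_commuting:
  assumes "finite A" "A \<subseteq> carrier IG" "M \<noteq> {}" "e > 0"
    and comm: "\<And>g h. g \<in> A \<Longrightarrow> h \<in> A \<Longrightarrow> g \<otimes>\<^bsub>IG\<^esub> h = h \<otimes>\<^bsub>IG\<^esub> g"
  shows "\<exists>u\<in>M. \<forall>g\<in>A. disp g u \<le> tl g + e"
  using assms(1,2) comm
proof (induction A rule: finite_induct)
  case empty
  then show ?case using \<open>M \<noteq> {}\<close> by blast
next
  case (insert h A)
  define C where "C = M \<inter> \<Inter>((\<lambda>g. sublevel g (tl g + e)) ` A)"
  have AI: "iso g" if "g \<in> A" for g using insert that by auto
  have hI: "iso h" using insert by auto
  have "\<exists>u\<in>M. \<forall>g\<in>A. disp g u \<le> tl g + e"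
    using insert.prems(1) by (intro insert.IH insert.prems(2)) auto
  then obtain u where u: "u \<in> M" "\<forall>g\<in>A. disp g u \<le> tl g + e" by blast
  have C: "ccset C"
    unfolding ccset_def C_def using u AI
    by (auto intro!: sclosed_Inter gconvex_Inter sublevel_closed sublevel_convex) (auto simp: sublevel_def)
  obtain v where v: "v \<in> M" "disp h v < tl h + e" using tl_approx \<open>M \<noteq> {}\<close> \<open>e > 0\<close> by blast
  have dc: "disp g (k x) = disp g x" if "iso g" "iso k" and c: "g \<otimes>\<^bsub>IG\<^esub> k = k \<otimes>\<^bsub>IG\<^esub> g" and "x \<in> M" for g k x
  proof -
    have "g (k x) = k (g x)" using arg_cong[OF c, of "\<lambda>f. f x"] that(1,2,4) by simp
    then show ?thesis using that(1,2,4) by (simp add: disp_def)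
  qed
  have dh: "disp g (h x) = disp g x" if "g \<in> A" "x \<in> M" for g x
    using dc[OF AI hI _ that(2)] insert.prems(2)[of g h] that(1) by blast
  have di: "disp g ((inv\<^bsub>IG\<^esub> h) x) = disp g x" if "g \<in> A" "x \<in> M" for g x
    using dh[OF that(1), of "(inv\<^bsub>IG\<^esub> h) x"] hI that(2) by simp
  have "stable h C"
    unfolding stable_def C_def using hI by (auto simp: sublevel_def dh di)
  then have "disp h (proj C v) \<le> tl h + e" using disp_proj[OF C hI _ v(1)] v by simp
  moreover have "proj C v \<in> C" using proj_in[OF C v(1)] .
  ultimately show ?case unfolding C_def sublevel_def by (intro bexI[of _ "proj C v"]) (auto simp: C_def sublevel_def)
qed

end

subsection \<open>Translation flows\<close>

lemma nonpos_if_multiples_bounded: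
  fixes x B :: real
  assumes "\<And>n::nat. n > 0 \<Longrightarrow> n * x \<le> B"
  shows "x \<le> 0"
proof (rule ccontr)
  assume "\<not> x \<le> 0"
  then have x: "x > 0" by simp
  obtain n :: nat where n: "B / x < n" using reals_Archimedean2 by blast
  have "B < Suc n * x" using n x by (simp add: pos_divide_less_eq algebra_simps)
  then show False using assms[of "Suc n"] by simp
qed

context complete_CAT0
begin

definition minp :: "('a \<Rightarrow> 'a) \<Rightarrow> 'a \<Rightarrow> bool" where
  "minp g x \<longleftrightarrow> x \<in> M \<and> disp g x = tl g"

abbreviation ipow :: "('a \<Rightarrow> 'a) \<Rightarrow> int \<Rightarrow> 'a \<Rightarrow> 'a" where
  "ipow g k x \<equiv> (g [^]\<^bsub>IG\<^esub> k) x"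

lemma ipow_in [simp]: "iso g \<Longrightarrow> x \<in> M \<Longrightarrow> ipow g k x \<in> M"
  by (rule iso_in[OF I.int_pow_closed])

lemma ipow_add: "iso g \<Longrightarrow> x \<in> M \<Longrightarrow> ipow g (i + j) x = ipow g i (ipow g j x)"
  by (simp add: I.int_pow_mult I.int_pow_closed)

lemma ipow_0 [simp]: "x \<in> M \<Longrightarrow> ipow g 0 x = x"
  by simp

lemma ipow_1 [simp]: "iso g \<Longrightarrow> ipow g 1 x = g x"
  by (simp add: I.int_pow_1)

lemma tl_nonneg' [simp]: "minp g x \<Longrightarrow> 0 \<le> tl g"
  using disp_nonneg[of g x] by (simp add: minp_def)

lemma d_ipow:
  assumes g: "iso g" and x: "minp g x"
  shows "d (ipow g i x) (ipow g j x) = \<bar>real_of_int (i - j)\<bar> * tl g"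
proof -
  have xM: "x \<in> M" using x by (simp add: minp_def)
  have main: "d (ipow g i x) (ipow g j x) = real_of_int (j - i) * tl g" if "i \<le> j" for i j
  proof -
    obtain n where n: "j = i + int n" using \<open>i \<le> j\<close> zle_iff_zadd by blast
    have "d (ipow g i x) (ipow g j x) = d x (ipow g (int n) x)"
      using g xM unfolding n ipow_add[OF g xM] by (intro iso_dist) (auto simp: I.int_pow_closed)
    also have "\<dots> = n * tl g"
      using disp_pow_Min[OF g xM, of n] x by (simp add: disp_def minp_def int_pow_int)
    finally show ?thesis by (simp add: n)
  qed
  show ?thesis
  proof (cases "i \<le> j")
    case True then show ?thesis using main[of i j] by simp
  next
    case False then show ?thesis using main[of j i] commute by simp
  qed
qed

text \<open>The axis of \<open>g\<close> through \<open>x\<close> is not built as a limit: the point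
  at parameter \<open>t\<close>, in units of the translation length, is read off on the segment
  between two opposite powers. At points of Min(g) the result does not depend on \<open>n\<close>,
  by \<open>flown_indep\<close>.\<close>

definition flown :: "nat \<Rightarrow> ('a \<Rightarrow> 'a) \<Rightarrow> real \<Rightarrow> 'a \<Rightarrow> 'a" where
  "flown n g t x = pt ((t + n) / (2 * n)) (ipow g (- int n) x) (ipow g (int n) x)"

definition flow :: "('a \<Rightarrow> 'a) \<Rightarrow> real \<Rightarrow> 'a \<Rightarrow> 'a" where
  "flow g t x = flown (nat \<lceil>\<bar>t\<bar>\<rceil> + 1) g t x"

lemma frac_bounds: "n \<ge> 1 \<Longrightarrow> \<bar>t\<bar> \<le> real n \<Longrightarrow> 0 \<le> (t + n) / (2 * n) \<and> (t + n) / (2 * n) \<le> 1"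
  by (auto simp: field_simps abs_le_iff)

lemma flown_in: "iso g \<Longrightarrow> x \<in> M \<Longrightarrow> n \<ge> 1 \<Longrightarrow> \<bar>t\<bar> \<le> real n \<Longrightarrow> flown n g t x \<in> M"
  unfolding flown_def using frac_bounds[of n t] by (intro pt_in) auto

lemma flown_eqI:
  assumes g: "iso g" and x: "minp g x" and n: "n \<ge> 1" "\<bar>t\<bar> \<le> real n" and y: "y \<in> M"
    "d y (ipow g (- int n) x) = (t + n) * tl g" "d y (ipow g (int n) x) = (n - t) * tl g"
  shows "y = flown n g t x"
  unfolding flown_def
proof (rule pt_eqI[symmetric])
  have xM: "x \<in> M" using x by (simp add: minp_def)
  show "ipow g (- int n) x \<in> M" "ipow g (int n) x \<in> M" using g xM by auto
  show "0 \<le> (t + n) / (2 * n)" "(t + n) / (2 * n) \<le> 1" using frac_bounds n by auto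
  have dd: "d (ipow g (- int n) x) (ipow g (int n) x) = 2 * n * tl g" using d_ipow[OF g x] by simp
  have e: "(t + n) / (2 * n) * (2 * n * T) = (t + n) * T" "(1 - (t + n) / (2 * n)) * (2 * n * T) = (n - t) * T" for T :: real
    using n(1) by (simp_all add: field_simps)
  show "d (ipow g (- int n) x) y = (t + n) / (2 * n) * d (ipow g (- int n) x) (ipow g (int n) x)"
    using y(2) e(1)[of "tl g"] dd by (simp add: commute)
  show "d y (ipow g (int n) x) = (1 - (t + n) / (2 * n)) * d (ipow g (- int n) x) (ipow g (int n) x)"
    unfolding y(3) dd using e(2)[of "tl g", symmetric] by simp
qed (rule y)

lemma d_flown_ipow:
  assumes g: "iso g" and x: "minp g x" and n: "n \<ge> 1" "\<bar>t\<bar> \<le> real n" "\<bar>j\<bar> \<le> int n"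
  shows "d (flown n g t x) (ipow g j x) = \<bar>t - j\<bar> * tl g"
proof -
  have xM: "x \<in> M" using x by (simp add: minp_def)
  have j: "\<bar>real_of_int j\<bar> \<le> real n" using n(3) by linarith
  have "ipow g j x = flown n g j x"
    using g xM n j by (intro flown_eqI[OF g x n(1)]) (auto simp: d_ipow[OF g x] abs_le_iff)
  then have "d (flown n g t x) (ipow g j x) = \<bar>(t + n) / (2 * n) - (j + n) / (2 * n)\<bar>
      * d (ipow g (- int n) x) (ipow g (int n) x)"
    using d_pt_pt[of "ipow g (- int n) x" "ipow g (int n) x" "(t + n) / (2 * n)" "(j + n) / (2 * n)"]
      frac_bounds[of n t] frac_bounds[of n j] g xM n j by (simp add: flown_def)
  also have "(t + n) / (2 * n) - (j + n) / (2 * n) = (t - j) / (2 * n)"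
    by (simp add: diff_divide_distrib[symmetric])
  also have "d (ipow g (- int n) x) (ipow g (int n) x) = 2 * n * tl g" using d_ipow[OF g x] by simp
  finally show ?thesis using n by (simp add: abs_divide)
qed

lemma flown_indep:
  assumes g: "iso g" and x: "minp g x" and n: "n \<ge> 1" "\<bar>t\<bar> \<le> real n" and m: "m \<ge> 1" "\<bar>t\<bar> \<le> real m"
  shows "flown m g t x = flown n g t x"
proof -
  have xM: "x \<in> M" using x by (simp add: minp_def)
  have *: "flown m g t x = flown n g t x" if "n \<le> m" "n \<ge> 1" "\<bar>t\<bar> \<le> real n" for m n
    using that g xM by (intro flown_eqI[OF g x that(2,3)]) (auto simp: d_flown_ipow[OF g x] abs_le_iff intro!: flown_in)
  show ?thesis using *[of n m] *[of m n] n m by (cases "n \<le> m") auto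
qed

lemma flow_eq_flown:
  assumes g: "iso g" and x: "minp g x" and n: "n \<ge> 1" "\<bar>t\<bar> \<le> real n"
  shows "flow g t x = flown n g t x"
  unfolding flow_def by (rule flown_indep[OF g x n]) linarith+

lemma flow_in: "iso g \<Longrightarrow> minp g x \<Longrightarrow> flow g t x \<in> M"
  unfolding flow_def by (rule flown_in) (auto simp: minp_def, linarith)

lemma ex_bound: "\<exists>n::nat\<ge>1. a \<le> real n \<and> b \<le> real n"
  using real_arch_simple[of "max 1 (max a b)"] by auto

text \<open>A point of an axis is determined by its distances to the orbit of \<open>x\<close>. The
  behaviour of flows at integer times, under conjugation and under addition of times is proved by
  checking these distances.\<close>

lemma flow_eqI:
  assumes g: "iso g" and x: "minp g x" and y: "y \<in> M"
    "\<And>j. d y (ipow g j x) = \<bar>t - real_of_int j\<bar> * tl g"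
  shows "y = flow g t x"
proof -
  obtain n :: nat where n: "n \<ge> 1" "\<bar>t\<bar> \<le> real n" using ex_bound by blast
  have "y = flown n g t x" using y n by (intro flown_eqI[OF g x n]) (auto simp: abs_le_iff)
  then show ?thesis using flow_eq_flown[OF g x n] by simp
qed

lemma d_flow_ipow:
  assumes g: "iso g" and x: "minp g x"
  shows "d (flow g t x) (ipow g j x) = \<bar>t - j\<bar> * tl g"
proof -
  obtain n :: nat where n: "n \<ge> 1" "\<bar>t\<bar> \<le> real n" "\<bar>real_of_int j\<bar> \<le> real n" using ex_bound by blast
  then have "\<bar>j\<bar> \<le> int n" by linarith
  then show ?thesis using d_flown_ipow[OF g x n(1,2)] flow_eq_flown[OF g x n(1,2)] by simp
qed

lemma d_flow_flow:
  assumes g: "iso g" and x: "minp g x"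
  shows "d (flow g s x) (flow g t x) = \<bar>s - t\<bar> * tl g"
proof -
  have xM: "x \<in> M" using x by (simp add: minp_def)
  obtain n :: nat where n: "n \<ge> 1" "\<bar>s\<bar> \<le> real n" "\<bar>t\<bar> \<le> real n" using ex_bound by blast
  have "d (flow g s x) (flow g t x) = \<bar>(s + n) / (2 * n) - (t + n) / (2 * n)\<bar>
      * d (ipow g (- int n) x) (ipow g (int n) x)"
    using d_pt_pt[of "ipow g (- int n) x" "ipow g (int n) x" "(s + n) / (2 * n)" "(t + n) / (2 * n)"]
      frac_bounds[of n s] frac_bounds[of n t] g xM n flow_eq_flown[OF g x, of n]
    by (simp add: flown_def)
  also have "(s + n) / (2 * n) - (t + n) / (2 * n) = (s - t) / (2 * n)"
    by (simp add: diff_divide_distrib[symmetric])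
  also have "d (ipow g (- int n) x) (ipow g (int n) x) = 2 * n * tl g" using d_ipow[OF g x] by simp
  finally show ?thesis using n by (simp add: abs_divide)
qed

lemma flow_int:
  assumes g: "iso g" and x: "minp g x"
  shows "flow g (real_of_int k) x = ipow g k x"
  by (rule flow_eqI[OF g x, symmetric]) (use g x in \<open>auto simp: d_ipow[OF g x] minp_def\<close>)

lemma flow_0: "iso g \<Longrightarrow> minp g x \<Longrightarrow> flow g 0 x = x"
  using flow_int[of g x 0] by (simp add: minp_def)

lemma flow_1: "iso g \<Longrightarrow> minp g x \<Longrightarrow> flow g 1 x = g x"
  using flow_int[of g x 1] by simp

lemma conj_npow:
  assumes "iso g" "iso h" "x \<in> M"
  shows "(h \<otimes>\<^bsub>IG\<^esub> g \<otimes>\<^bsub>IG\<^esub> inv\<^bsub>IG\<^esub> h) [^]\<^bsub>IG\<^esub> (n::nat) = h \<otimes>\<^bsub>IG\<^esub> g [^]\<^bsub>IG\<^esub> n \<otimes>\<^bsub>IG\<^esub> inv\<^bsub>IG\<^esub> h"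
proof (induction n)
  case (Suc n)
  show ?case unfolding I.nat_pow_Suc Suc by (rule iso_eqI) (use assms in auto)
qed (use assms in simp)

lemma conj_ipow:
  assumes "iso g" "iso h" "x \<in> M"
  shows "ipow (h \<otimes>\<^bsub>IG\<^esub> g \<otimes>\<^bsub>IG\<^esub> inv\<^bsub>IG\<^esub> h) k (h x) = h (ipow g k x)"
proof (cases k)
  case (nonneg n)
  then show ?thesis using conj_npow[OF assms] assms by (simp add: int_pow_int)
next
  case (neg n)
  have "inv\<^bsub>IG\<^esub> (h \<otimes>\<^bsub>IG\<^esub> a \<otimes>\<^bsub>IG\<^esub> inv\<^bsub>IG\<^esub> h) = h \<otimes>\<^bsub>IG\<^esub> inv\<^bsub>IG\<^esub> a \<otimes>\<^bsub>IG\<^esub> inv\<^bsub>IG\<^esub> h" if "iso a" for a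
    using assms that by (simp add: I.inv_mult_group I.m_assoc)
  from this[OF I.nat_pow_closed[OF assms(1), of "Suc n"]]
  have "ipow (h \<otimes>\<^bsub>IG\<^esub> g \<otimes>\<^bsub>IG\<^esub> inv\<^bsub>IG\<^esub> h) k = h \<otimes>\<^bsub>IG\<^esub> ipow g k \<otimes>\<^bsub>IG\<^esub> inv\<^bsub>IG\<^esub> h"
    unfolding neg I.int_pow_neg_int[OF assms(1)] I.int_pow_neg_int[OF I.m_closed[OF I.m_closed[OF assms(2,1)] I.inv_closed[OF assms(2)]]] conj_npow[OF assms] .
  then show ?thesis using assms by (simp add: I.int_pow_closed)
qed

lemma minp_conj:
  assumes "iso g" "iso h" "minp g x"
  shows "minp (h \<otimes>\<^bsub>IG\<^esub> g \<otimes>\<^bsub>IG\<^esub> inv\<^bsub>IG\<^esub> h) (h x)"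
  using assms by (simp add: minp_def disp_conj tl_conj)

lemma flow_conj:
  assumes g: "iso g" and h: "iso h" and x: "minp g x"
  shows "h (flow g t x) = flow (h \<otimes>\<^bsub>IG\<^esub> g \<otimes>\<^bsub>IG\<^esub> inv\<^bsub>IG\<^esub> h) t (h x)"
proof (rule flow_eqI)
  have xM: "x \<in> M" using x by (simp add: minp_def)
  show "d (h (flow g t x)) (ipow (h \<otimes>\<^bsub>IG\<^esub> g \<otimes>\<^bsub>IG\<^esub> inv\<^bsub>IG\<^esub> h) j (h x))
      = \<bar>t - real_of_int j\<bar> * tl (h \<otimes>\<^bsub>IG\<^esub> g \<otimes>\<^bsub>IG\<^esub> inv\<^bsub>IG\<^esub> h)" for j
    using conj_ipow[OF g h xM, of j] flow_in[OF g x] d_flow_ipow[OF g x] g h xM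
    by (simp add: tl_conj)
  show "minp (h \<otimes>\<^bsub>IG\<^esub> g \<otimes>\<^bsub>IG\<^esub> inv\<^bsub>IG\<^esub> h) (h x)" by (rule minp_conj) fact+
qed (use g h x flow_in[OF g x] in auto)

lemma conj_commute:
  assumes "iso g" "iso h" "g \<otimes>\<^bsub>IG\<^esub> h = h \<otimes>\<^bsub>IG\<^esub> g"
  shows "h \<otimes>\<^bsub>IG\<^esub> g \<otimes>\<^bsub>IG\<^esub> inv\<^bsub>IG\<^esub> h = g"
proof -
  have "h \<otimes>\<^bsub>IG\<^esub> g \<otimes>\<^bsub>IG\<^esub> inv\<^bsub>IG\<^esub> h = g \<otimes>\<^bsub>IG\<^esub> h \<otimes>\<^bsub>IG\<^esub> inv\<^bsub>IG\<^esub> h" by (simp only: assms(3))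
  then show ?thesis using assms(1,2) by (simp add: I.m_assoc)
qed

lemma minp_commute:
  assumes "iso g" "iso h" "g \<otimes>\<^bsub>IG\<^esub> h = h \<otimes>\<^bsub>IG\<^esub> g" "minp g x"
  shows "minp g (h x)"
  using minp_conj[OF assms(1,2,4)] conj_commute[OF assms(1-3)] by simp

lemma flow_commute_iso:
  assumes "iso g" "iso h" "g \<otimes>\<^bsub>IG\<^esub> h = h \<otimes>\<^bsub>IG\<^esub> g" "minp g x"
  shows "h (flow g t x) = flow g t (h x)"
  using flow_conj[OF assms(1,2,4)] conj_commute[OF assms(1-3)] by simp

lemma flow_ipow:
  assumes g: "iso g" and x: "minp g x"
  shows "flow g t (ipow g k x) = flow g (t + k) x"
proof (rule flow_eqI[OF g x])
  have xM: "x \<in> M" using x by (simp add: minp_def)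
  have c: "g \<otimes>\<^bsub>IG\<^esub> g [^]\<^bsub>IG\<^esub> k = g [^]\<^bsub>IG\<^esub> k \<otimes>\<^bsub>IG\<^esub> g"
    using I.int_pow_mult[OF g, of 1 k] I.int_pow_mult[OF g, of k 1] g by (simp add: add.commute)
  have m: "minp g (ipow g k x)" by (rule minp_commute[OF g I.int_pow_closed[OF g] c x])
  show "flow g t (ipow g k x) \<in> M" using flow_in[OF g m] .
  show "d (flow g t (ipow g k x)) (ipow g j x) = \<bar>t + real_of_int k - real_of_int j\<bar> * tl g" for j
    using d_flow_ipow[OF g m, of t "j - k"] ipow_add[OF g xM, of "j - k" k] by (simp add: algebra_simps)
qed

lemma minp_flow:
  assumes g: "iso g" and x: "minp g x"
  shows "minp g (flow g t x)"
proof -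
  have "g (flow g t x) = flow g (t + 1) x"
    using flow_commute_iso[OF g g refl x] flow_ipow[OF g x, of t 1] g by simp
  then show ?thesis using flow_in[OF g x] d_flow_flow[OF g x, of t "t + 1"] by (simp add: minp_def disp_def)
qed

lemma flow_add:
  assumes g: "iso g" and x: "minp g x"
  shows "flow g t (flow g s x) = flow g (t + s) x"
proof (rule flow_eqI[OF g minp_flow[OF g x], symmetric])
  show "flow g (t + s) x \<in> M" using flow_in[OF g x] .
  fix j :: int
  have c: "g \<otimes>\<^bsub>IG\<^esub> g [^]\<^bsub>IG\<^esub> j = g [^]\<^bsub>IG\<^esub> j \<otimes>\<^bsub>IG\<^esub> g"
    using I.int_pow_mult[OF g, of 1 j] I.int_pow_mult[OF g, of j 1] g by (simp add: add.commute)
  have "ipow g j (flow g s x) = flow g (s + j) x"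
    using flow_commute_iso[OF g _ c x] flow_ipow[OF g x] g by (simp add: I.int_pow_closed)
  then show "d (flow g (t + s) x) (ipow g j (flow g s x)) = \<bar>t - real_of_int j\<bar> * tl g"
    using d_flow_flow[OF g x, of "t + s" "s + j"] by simp
qed

text \<open>For n \<ge> \<bar>t\<bar>, convexity of the metric bounds the distance by an average of
  the distances between the images under the powers -n and n, both equal to \<open>d x y\<close>.
  The flow by -t gives the reverse inequality.\<close>

lemma flow_isometry:
  assumes g: "iso g" and x: "minp g x" and y: "minp g y"
  shows "d (flow g t x) (flow g t y) = d x y"
proof -
  have le: "d (flow g t x) (flow g t y) \<le> d x y" if x: "minp g x" and y: "minp g y" for x y t
  proof -
    have M: "x \<in> M" "y \<in> M" using x y by (auto simp: minp_def)
    obtain n :: nat where n: "n \<ge> 1" "\<bar>t\<bar> \<le> real n" using ex_bound by blast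
    define s where "s = (t + n) / (2 * n)"
    have "d (flow g t x) (flow g t y) \<le> (1 - s) * d (ipow g (- int n) x) (ipow g (- int n) y)
        + s * d (ipow g (int n) x) (ipow g (int n) y)"
      unfolding flow_eq_flown[OF g x n] flow_eq_flown[OF g y n] flown_def s_def[symmetric]
      using frac_bounds[OF n] g M by (intro pt_convex) (auto simp: s_def)
    also have "\<dots> = d x y"
      using g M iso_dist[OF I.int_pow_closed[OF g]] by (simp add: algebra_simps)
    finally show ?thesis .
  qed
  show ?thesis
    using le[OF x y, of t] le[OF minp_flow[OF g x] minp_flow[OF g y], of "- t" t t] flow_add[OF g x, of "-t" t]
      flow_add[OF g y, of "-t" t] flow_0[OF g x] flow_0[OF g y] by simp
qed

end

section \<open>Flows along the axes of an abelian group of isometries\<close>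

locale translation_lattice = complete_CAT0 +
  fixes \<Delta> :: "('a \<Rightarrow> 'a) set"
  assumes subgroup_\<Delta>: "subgroup \<Delta> (isom_group M d)"
    and comm_\<Delta>: "\<And>g h. g \<in> \<Delta> \<Longrightarrow> h \<in> \<Delta> \<Longrightarrow> g \<otimes>\<^bsub>isom_group M d\<^esub> h = h \<otimes>\<^bsub>isom_group M d\<^esub> g"
begin

definition Y :: "'a set" where "Y = {x \<in> M. \<forall>g\<in>\<Delta>. disp g x = tl g}"

text \<open>Formal real combinations of elements of \<open>\<Delta>\<close>. With lists no vector
  space has to be constructed as a quotient: two vectors are compared through the maps
  \<open>act\<close> on \<open>Y\<close>.\<close>

definition vecs :: "(('a \<Rightarrow> 'a) \<times> real) list set" where "vecs = {xs. fst ` set xs \<subseteq> \<Delta>}"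

text \<open>A list of pairs \<open>(g, r)\<close> stands for the composition of the flows by \<open>r\<close> along the axes of \<open>g\<close>.\<close>

definition act :: "(('a \<Rightarrow> 'a) \<times> real) list \<Rightarrow> 'a \<Rightarrow> 'a" where
  "act xs u = foldr (\<lambda>(g, r). flow g r) xs u"

definition sc :: "real \<Rightarrow> (('a \<Rightarrow> 'a) \<times> real) list \<Rightarrow> (('a \<Rightarrow> 'a) \<times> real) list" where
  "sc c xs = map (\<lambda>(g, r). (g, c * r)) xs"

lemma \<Delta>_iso [simp]: "g \<in> \<Delta> \<Longrightarrow> iso g"
  using subgroup.subset[OF subgroup_\<Delta>] by blast

lemma Y_minp: "u \<in> Y \<Longrightarrow> g \<in> \<Delta> \<Longrightarrow> minp g u" by (simp add: Y_def minp_def)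

lemma YI: "u \<in> M \<Longrightarrow> (\<And>g. g \<in> \<Delta> \<Longrightarrow> minp g u) \<Longrightarrow> u \<in> Y" by (simp add: Y_def minp_def)

lemma Y_eq: "Y = M \<inter> \<Inter>((\<lambda>g. sublevel g (tl g)) ` \<Delta>)"
proof -
  have "disp g x = tl g \<longleftrightarrow> disp g x \<le> tl g" if "x \<in> M" for g x using tl_le[OF that, of g] by linarith
  then show ?thesis unfolding Y_def sublevel_def by blast
qed

lemma Y_M [simp]: "u \<in> Y \<Longrightarrow> u \<in> M" by (simp add: Y_def)

lemma Y_closed: "sclosed Y" unfolding Y_eq using sublevel_closed[OF \<Delta>_iso] by (intro sclosed_Inter) blast

lemma Y_convex: "gconvex Y" unfolding Y_eq using sublevel_convex[OF \<Delta>_iso] by (intro gconvex_Inter) blast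

lemma Y_pt: "u \<in> Y \<Longrightarrow> v \<in> Y \<Longrightarrow> 0 \<le> s \<Longrightarrow> s \<le> 1 \<Longrightarrow> pt s u v \<in> Y"
  using gconvexD[OF Y_convex] .

lemma flow_Y [simp]:
  assumes g: "g \<in> \<Delta>" and u: "u \<in> Y" shows "flow g t u \<in> Y"
proof (rule YI)
  show "flow g t u \<in> M" by (rule flow_in[OF \<Delta>_iso[OF g] Y_minp[OF u g]])
  fix h assume h: "h \<in> \<Delta>"
  have "h (flow g t u) = flow g t (h u)" by (rule flow_commute_iso[OF \<Delta>_iso[OF g] \<Delta>_iso[OF h] comm_\<Delta>[OF g h] Y_minp[OF u g]])
  moreover have "minp g (h u)" by (rule minp_commute[OF \<Delta>_iso[OF g] \<Delta>_iso[OF h] comm_\<Delta>[OF g h] Y_minp[OF u g]])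
  ultimately have "disp h (flow g t u) = d u (h u)"
    using flow_isometry[of g u "h u" t] g u Y_minp by (simp add: disp_def)
  then show "minp h (flow g t u)" using Y_minp[OF u h] \<open>flow g t u \<in> M\<close> by (simp add: minp_def disp_def)
qed

lemma \<Delta>_Y [simp]: "g \<in> \<Delta> \<Longrightarrow> u \<in> Y \<Longrightarrow> g u \<in> Y"
  using flow_Y[of g u 1] flow_1[of g u] Y_minp by simp

lemma flow_dist [simp]: "g \<in> \<Delta> \<Longrightarrow> u \<in> Y \<Longrightarrow> v \<in> Y \<Longrightarrow> d (flow g t u) (flow g t v) = d u v"
  by (simp add: flow_isometry Y_minp)

lemma ipow_Y: "g \<in> \<Delta> \<Longrightarrow> u \<in> Y \<Longrightarrow> ipow g k u \<in> Y"
  using flow_Y[of g u k] flow_int[of g u k] Y_minp by simp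

text \<open>\<open>flow g t\<close> is an isometry of \<open>Y\<close> commuting with the powers of
  \<open>h\<close>, so it carries the segment on which \<open>flow h s\<close> is read off to the
  corresponding segment at the image.\<close>

lemma flow_commute:
  assumes g: "g \<in> \<Delta>" and h: "h \<in> \<Delta>" and u: "u \<in> Y"
  shows "flow g t (flow h s u) = flow h s (flow g t u)"
proof -
  obtain n :: nat where n: "n \<ge> 1" "\<bar>s\<bar> \<le> real n" using ex_bound by blast
  define q where "q = (s + n) / (2 * n)"
  have q: "0 \<le> q" "q \<le> 1" using frac_bounds[OF n] by (auto simp: q_def)
  have i: "ipow h k (flow g t u) = flow g t (ipow h k u)" for k
  proof (rule flow_commute_iso)
    show "g \<otimes>\<^bsub>IG\<^esub> h [^]\<^bsub>IG\<^esub> k = h [^]\<^bsub>IG\<^esub> k \<otimes>\<^bsub>IG\<^esub> g"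
      by (rule comm_\<Delta>[OF g]) (rule I.subgroup_int_pow_closed[OF subgroup_\<Delta> h])
  qed (use g h u Y_minp in \<open>auto intro: I.int_pow_closed\<close>)
  have "flow g t (pt q (ipow h (- int n) u) (ipow h (int n) u))
      = pt q (flow g t (ipow h (- int n) u)) (flow g t (ipow h (int n) u))"
    using g h u q ipow_Y d_pt[of "ipow h (- int n) u" "ipow h (int n) u" q]
    by (intro pt_eqI[symmetric]) (auto simp: Y_pt)
  then show ?thesis
    using flow_eq_flown[OF \<Delta>_iso[OF h] Y_minp[OF u h] n] flow_eq_flown[OF \<Delta>_iso[OF h] Y_minp[OF flow_Y[OF g u] h] n]
    by (simp add: flown_def q_def i)
qed

lemma vecs_append [simp]: "xs @ ys \<in> vecs \<longleftrightarrow> xs \<in> vecs \<and> ys \<in> vecs" by (auto simp: vecs_def)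

lemma vecs_Cons [simp]: "(g, r) # xs \<in> vecs \<longleftrightarrow> g \<in> \<Delta> \<and> xs \<in> vecs" by (auto simp: vecs_def)

lemma vecs_Nil [simp]: "[] \<in> vecs" by (simp add: vecs_def)

lemma vecs_sc [simp]: "sc c xs \<in> vecs \<longleftrightarrow> xs \<in> vecs" by (force simp: vecs_def sc_def)

lemma sc_append [simp]: "sc c (xs @ ys) = sc c xs @ sc c ys" by (simp add: sc_def)

lemma sc_sc [simp]: "sc a (sc b xs) = sc (a * b) xs" by (auto simp: sc_def)

lemma sc_Cons [simp]: "sc c ((g, r) # xs) = (g, c * r) # sc c xs" by (simp add: sc_def)

lemma sc_Nil [simp]: "sc c [] = []" by (simp add: sc_def)

lemma sc_1 [simp]: "sc 1 xs = xs" by (induction xs) (auto simp: sc_def)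

lemma act_append: "act (xs @ ys) u = act xs (act ys u)" by (simp add: act_def)

lemma act_Nil [simp]: "act [] u = u" by (simp add: act_def)

lemma act_Cons: "act ((g, r) # xs) u = flow g r (act xs u)" by (simp add: act_def)

lemma act_Y [simp]: "xs \<in> vecs \<Longrightarrow> u \<in> Y \<Longrightarrow> act xs u \<in> Y"
  by (induction xs) (auto simp: act_Cons)

lemma act_dist [simp]: "xs \<in> vecs \<Longrightarrow> u \<in> Y \<Longrightarrow> v \<in> Y \<Longrightarrow> d (act xs u) (act xs v) = d u v"
  by (induction xs) (auto simp: act_Cons)

lemma flow_act_commute: "g \<in> \<Delta> \<Longrightarrow> xs \<in> vecs \<Longrightarrow> u \<in> Y \<Longrightarrow> flow g t (act xs u) = act xs (flow g t u)"
  by (induction xs) (auto simp: act_Cons flow_commute)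

lemma act_commute: "xs \<in> vecs \<Longrightarrow> ys \<in> vecs \<Longrightarrow> u \<in> Y \<Longrightarrow> act xs (act ys u) = act ys (act xs u)"
  by (induction xs) (auto simp: act_Cons flow_act_commute)

lemma act_sc_add:
  "xs \<in> vecs \<Longrightarrow> u \<in> Y \<Longrightarrow> act (sc a xs) (act (sc b xs) u) = act (sc (a + b) xs) u"
proof (induction xs)
  case (Cons x xs)
  obtain g r where x: "x = (g, r)" by (cases x)
  have g: "g \<in> \<Delta>" and xs: "xs \<in> vecs" using Cons.prems by (auto simp: x)
  have "act (sc a (x # xs)) (act (sc b (x # xs)) u)
      = flow g (a * r) (act (sc a xs) (flow g (b * r) (act (sc b xs) u)))"
    by (simp add: x sc_def act_Cons)
  also have "\<dots> = flow g (a * r) (flow g (b * r) (act (sc a xs) (act (sc b xs) u)))"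
    using g xs Cons.prems by (simp add: flow_act_commute)
  also have "\<dots> = flow g ((a + b) * r) (act (sc (a + b) xs) u)"
    using g xs Cons by (simp add: flow_add Y_minp algebra_simps)
  finally show ?case by (simp add: x sc_def act_Cons)
qed (simp add: sc_def)

lemma act_sc_0 [simp]: "xs \<in> vecs \<Longrightarrow> u \<in> Y \<Longrightarrow> act (sc 0 xs) u = u"
  by (induction xs) (auto simp: sc_def act_Cons flow_0 Y_minp)

lemma act_neg: "xs \<in> vecs \<Longrightarrow> u \<in> Y \<Longrightarrow> act (sc (-1) xs) (act xs u) = u"
  "xs \<in> vecs \<Longrightarrow> u \<in> Y \<Longrightarrow> act xs (act (sc (-1) xs) u) = u"
  using act_sc_add[of xs u "-1" 1] act_sc_add[of xs u 1 "-1"] by auto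

text \<open>The length of the vector \<open>xs\<close>, measured at \<open>u\<close>. It turns out
  to be homogeneous (\<open>D_sc\<close>), to satisfy the parallelogram law
  (\<open>D_parallelogram\<close>) and to be independent of \<open>u\<close>
  (\<open>D_base\<close>).\<close>

definition D :: "'a \<Rightarrow> (('a \<Rightarrow> 'a) \<times> real) list \<Rightarrow> real" where "D u xs = d u (act xs u)"

lemma D_nonneg [simp]: "0 \<le> D u xs" by (simp add: D_def)

lemma D_append: "xs \<in> vecs \<Longrightarrow> ys \<in> vecs \<Longrightarrow> u \<in> Y \<Longrightarrow> D u (xs @ ys) \<le> D u xs + D u ys"
  using triangle[of u "act xs u" "act xs (act ys u)"] by (simp add: D_def act_append)

lemma D_neg: "xs \<in> vecs \<Longrightarrow> u \<in> Y \<Longrightarrow> D u (sc (-1) xs) = D u xs"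
  using act_dist[of xs u "act (sc (-1) xs) u"] by (simp add: D_def act_neg commute)

lemma D_diff: "xs \<in> vecs \<Longrightarrow> ys \<in> vecs \<Longrightarrow> u \<in> Y \<Longrightarrow> d (act xs u) (act ys u) = D u (xs @ sc (-1) ys)"
  using act_dist[of "sc (-1) ys" "act xs u" "act ys u"] act_commute[of "sc (-1) ys" xs u]
  by (simp add: D_def act_append act_neg commute)

lemma D_act: "xs \<in> vecs \<Longrightarrow> ys \<in> vecs \<Longrightarrow> u \<in> Y \<Longrightarrow> D (act ys u) xs = D u xs"
  using act_commute[of xs ys u] by (simp add: D_def)

text \<open>The quadrilateral inequality for \<open>u\<close> and its images under
  \<open>xs\<close>, under both vectors and under \<open>ys\<close>. Nonpositive curvature gives one
  direction; the reverse one comes from homogeneity in \<open>homogeneous_append\<close>.\<close>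

lemma D_parallelogram_le:
  assumes "xs \<in> vecs" "ys \<in> vecs" "u \<in> Y"
  shows "(D u (xs @ ys))\<^sup>2 + (D u (xs @ sc (-1) ys))\<^sup>2 \<le> 2 * (D u xs)\<^sup>2 + 2 * (D u ys)\<^sup>2"
proof -
  have "(d u (act (xs @ ys) u))\<^sup>2 + (d (act xs u) (act ys u))\<^sup>2
      \<le> (d u (act xs u))\<^sup>2 + (d (act xs u) (act (xs @ ys) u))\<^sup>2
      + (d (act (xs @ ys) u) (act ys u))\<^sup>2 + (d (act ys u) u)\<^sup>2"
    using assms by (intro quadrilateral) auto
  moreover have "d (act (xs @ ys) u) (act ys u) = D u xs"
    using D_act[OF assms] by (simp add: D_def act_append commute)
  moreover have "d (act xs u) (act (xs @ ys) u) = D u ys"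
    using assms by (simp add: D_def act_append)
  ultimately show ?thesis using D_diff[OF assms] by (simp add: D_def commute)
qed

lemma D_sc_bound: "xs \<in> vecs \<Longrightarrow> u \<in> Y \<Longrightarrow> \<exists>K\<ge>0. \<forall>c. D u (sc c xs) \<le> \<bar>c\<bar> * K"
proof (induction xs)
  case Nil
  then show ?case by (auto simp: D_def sc_def)
next
  case (Cons x xs)
  obtain g r where x: "x = (g, r)" by (cases x)
  have g: "g \<in> \<Delta>" and xs: "xs \<in> vecs" using Cons.prems by (auto simp: x)
  obtain K where K: "K \<ge> 0" "\<And>c. D u (sc c xs) \<le> \<bar>c\<bar> * K" using Cons xs by auto
  have "D u (sc c (x # xs)) \<le> \<bar>c\<bar> * (\<bar>r\<bar> * tl g + K)" for c
  proof -
    have "D u (sc c (x # xs)) \<le> D u [(g, c * r)] + D u (sc c xs)"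
      using D_append[of "[(g, c * r)]" "sc c xs" u] g xs Cons.prems by (simp add: x)
    also have "D u [(g, c * r)] = \<bar>c * r\<bar> * tl g"
      using d_flow_flow[of g u 0 "c * r"] flow_0[of g u] g Y_minp[OF Cons.prems(2) g]
      by (simp add: D_def act_Cons)
    finally show ?thesis using K(2)[of c] by (simp add: abs_mult algebra_simps)
  qed
  moreover have "\<bar>r\<bar> * tl g + K \<ge> 0" using tl_nonneg'[OF Y_minp[OF Cons.prems(2) g]] K by simp
  ultimately show ?case by blast
qed

lemma D_mult_le: "xs \<in> vecs \<Longrightarrow> u \<in> Y \<Longrightarrow> D u (sc (real n * c) xs) \<le> n * D u (sc c xs)"
proof (induction n)
  case 0 then show ?case by (simp add: D_def)
next
  case (Suc n)
  have "D u (sc (real (Suc n) * c) xs) = D u (sc (real n * c) xs @ sc c xs)"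
    using act_sc_add[of xs u "real n * c" c] Suc.prems by (simp add: D_def act_append algebra_simps)
  also have "\<dots> \<le> D u (sc (real n * c) xs) + D u (sc c xs)" using Suc.prems by (intro D_append) auto
  finally show ?case using Suc by (simp add: algebra_simps)
qed

text \<open>Replacing n c by its floor changes the length by at most \<open>K\<close>, so n times
  the error at \<open>c\<close> is bounded independently of n, and the error vanishes.\<close>

lemma homogeneous_from_integers:
  assumes xs: "xs \<in> vecs" and u: "u \<in> Y"
    and int: "\<And>n c. D u (sc (real n * c) xs) = n * D u (sc c xs)"
  shows "D u (sc c xs) = \<bar>c\<bar> * D u xs"
proof -
  obtain K where K: "K \<ge> 0" "\<And>c. D u (sc c xs) \<le> \<bar>c\<bar> * K" using D_sc_bound[OF xs u] by blast
  have neg: "D u (sc (- c) xs) = D u (sc c xs)" for c using D_neg[of "sc c xs" u] xs u by simp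
  have lip: "\<bar>D u (sc a xs) - D u (sc b xs)\<bar> \<le> \<bar>a - b\<bar> * K" for a b
  proof -
    have "D u (sc a xs) \<le> D u (sc b xs) + D u (sc (a - b) xs)" for a b
      using D_append[of "sc b xs" "sc (a - b) xs" u] act_sc_add[OF xs u, of b "a - b"] xs u
      by (simp add: D_def act_append)
    from this[of a b] this[of b a] show ?thesis
      using K(2)[of "a - b"] K(2)[of "b - a"] by (simp add: abs_minus_commute abs_le_iff)
  qed
  have ints: "D u (sc (real_of_int m) xs) = \<bar>m\<bar> * D u xs" for m
  proof (cases "m \<ge> 0")
    case True then show ?thesis using int[of "nat m" 1] by simp
  next
    case False then show ?thesis using int[of "nat (- m)" 1] neg[of "real_of_int m"] by simp
  qed
  have "n * \<bar>D u (sc c xs) - \<bar>c\<bar> * D u xs\<bar> \<le> K + D u xs" for n :: nat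
  proof -
    define m where "m = \<lfloor>n * c\<rfloor>"
    have m: "\<bar>n * c - m\<bar> \<le> 1" unfolding m_def by linarith
    have "\<bar>D u (sc (n * c) xs) - D u (sc (real_of_int m) xs)\<bar> \<le> 1 * K"
      using lip[of "n * c" m] mult_right_mono[OF m K(1)] by simp
    then have 1: "\<bar>n * D u (sc c xs) - \<bar>m\<bar> * D u xs\<bar> \<le> K" by (simp add: int ints)
    have "\<bar>\<bar>n * c\<bar> - \<bar>m\<bar>\<bar> \<le> 1" using m by (simp add: abs_le_iff) linarith
    then have "\<bar>(\<bar>n * c\<bar> - \<bar>m\<bar>) * D u xs\<bar> \<le> 1 * D u xs"
      unfolding abs_mult by (intro mult_mono) auto
    then have "\<bar>n * D u (sc c xs) - n * (\<bar>c\<bar> * D u xs)\<bar> \<le> K + D u xs"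
      using 1 by (simp add: abs_mult algebra_simps abs_le_iff)
    then show ?thesis by (simp add: right_diff_distrib[symmetric] abs_mult)
  qed
  then have "\<bar>D u (sc c xs) - \<bar>c\<bar> * D u xs\<bar> \<le> 0" by (intro nonpos_if_multiples_bounded) auto
  then show ?thesis by simp
qed

text \<open>The sum z1 and the difference z2 of the two vectors satisfy z1 + z2 = 2 xs and z1 - z2 =
  2 ys. By the homogeneity of \<open>xs\<close> and \<open>ys\<close>, the parallelogram inequality
  for z1 and z2 is the reverse of the one for \<open>xs\<close> and \<open>ys\<close>, so equality
  holds at every scale \<open>c\<close>.\<close>

lemma homogeneous_append:
  assumes xs: "xs \<in> vecs" and ys: "ys \<in> vecs" and u: "u \<in> Y"
    and hx: "\<And>c. D u (sc c xs) = \<bar>c\<bar> * D u xs" and hy: "\<And>c. D u (sc c ys) = \<bar>c\<bar> * D u ys"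
  shows "D u (sc c (xs @ ys)) = \<bar>c\<bar> * D u (xs @ ys)"
    and "(D u (xs @ ys))\<^sup>2 + (D u (xs @ sc (-1) ys))\<^sup>2 = 2 * (D u xs)\<^sup>2 + 2 * (D u ys)\<^sup>2"
proof -
  define z1 z2 where "z1 = xs @ ys" and "z2 = xs @ sc (-1) ys"
  have z: "z1 \<in> vecs" "z2 \<in> vecs" using xs ys by (auto simp: z1_def z2_def)
  have eq: "(D u (sc c z1))\<^sup>2 + (D u (sc c z2))\<^sup>2 = c\<^sup>2 * (2 * (D u xs)\<^sup>2 + 2 * (D u ys)\<^sup>2)" for c
  proof (rule antisym)
    show "(D u (sc c z1))\<^sup>2 + (D u (sc c z2))\<^sup>2 \<le> c\<^sup>2 * (2 * (D u xs)\<^sup>2 + 2 * (D u ys)\<^sup>2)"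
    proof -
      have "(D u (sc c xs @ sc c ys))\<^sup>2 + (D u (sc c xs @ sc (-1) (sc c ys)))\<^sup>2
          \<le> 2 * (D u (sc c xs))\<^sup>2 + 2 * (D u (sc c ys))\<^sup>2"
        using xs ys u by (intro D_parallelogram_le) auto
      also have "\<dots> = c\<^sup>2 * (2 * (D u xs)\<^sup>2 + 2 * (D u ys)\<^sup>2)"
        unfolding hx hy power_mult_distrib power2_abs by (simp add: algebra_simps)
      finally show ?thesis by (simp add: z1_def z2_def)
    qed
    have inv: "act (sc c zs) (act (sc (- c) zs) u) = u" if "zs \<in> vecs" for zs
      using act_sc_add[OF that u, of c "- c"] that u by simp
    have dbl: "act (sc c zs) (act (sc c zs) u) = act (sc (2 * c) zs) u" if "zs \<in> vecs" for zs
      using act_sc_add[OF that u, of c c] by simp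
    have "act (sc c z1 @ sc c z2) u
        = act (sc c xs) (act (sc c ys) (act (sc c xs) (act (sc (- c) ys) u)))"
      by (simp add: z1_def z2_def act_append)
    also have "\<dots> = act (sc c xs) (act (sc c xs) (act (sc c ys) (act (sc (- c) ys) u)))"
      by (subst act_commute[of "sc c ys" "sc c xs"]) (use xs ys u in auto)
    finally have 1: "act (sc c z1 @ sc c z2) u = act (sc (2 * c) xs) u"
      by (simp only: inv[OF ys] dbl[OF xs])
    have "act (sc c z1 @ sc (-1) (sc c z2)) u
        = act (sc c xs) (act (sc c ys) (act (sc (- c) xs) (act (sc c ys) u)))"
      by (simp add: z1_def z2_def act_append)
    also have "\<dots> = act (sc c ys) (act (sc c xs) (act (sc (- c) xs) (act (sc c ys) u)))"
      by (rule act_commute) (use xs ys u in auto)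
    also have "\<dots> = act (sc c ys) (act (sc c xs) (act (sc c ys) (act (sc (- c) xs) u)))"
      by (subst act_commute[of "sc (- c) xs" "sc c ys"]) (use xs ys u in auto)
    also have "\<dots> = act (sc c ys) (act (sc c ys) (act (sc c xs) (act (sc (- c) xs) u)))"
      by (subst act_commute[of "sc c xs" "sc c ys"]) (use xs ys u in auto)
    finally have 2: "act (sc c z1 @ sc (-1) (sc c z2)) u = act (sc (2 * c) ys) u"
      by (simp only: inv[OF xs] dbl[OF ys])
    have "(D u (sc c z1 @ sc c z2))\<^sup>2 + (D u (sc c z1 @ sc (-1) (sc c z2)))\<^sup>2
        = (D u (sc (2 * c) xs))\<^sup>2 + (D u (sc (2 * c) ys))\<^sup>2"
      unfolding D_def 1 2 ..
    also have "\<dots> = 4 * (c\<^sup>2 * ((D u xs)\<^sup>2 + (D u ys)\<^sup>2))"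
      unfolding hx hy power_mult_distrib power2_abs by (simp add: algebra_simps)
    finally have "4 * (c\<^sup>2 * ((D u xs)\<^sup>2 + (D u ys)\<^sup>2))
        \<le> 2 * (D u (sc c z1))\<^sup>2 + 2 * (D u (sc c z2))\<^sup>2"
      using D_parallelogram_le[of "sc c z1" "sc c z2" u] z u by simp
    then show "c\<^sup>2 * (2 * (D u xs)\<^sup>2 + 2 * (D u ys)\<^sup>2) \<le> (D u (sc c z1))\<^sup>2 + (D u (sc c z2))\<^sup>2"
      by (simp add: algebra_simps)
  qed
  \<comment> \<open>At scale n c the two squares have the sum prescribed by homogeneity, while
    subadditivity bounds each of them by its homogeneous value; hence each attains that
    value.\<close>
  have "D u (sc (real n * c) z1) = n * D u (sc c z1)" for n c
  proof -
    have le: "(D u (sc (real n * c) z))\<^sup>2 \<le> (n * D u (sc c z))\<^sup>2" if "z \<in> vecs" for z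
      using D_mult_le[OF that u, of n c] by (intro power_mono) auto
    have "(D u (sc (real n * c) z1))\<^sup>2 + (D u (sc (real n * c) z2))\<^sup>2
        = (n * D u (sc c z1))\<^sup>2 + (n * D u (sc c z2))\<^sup>2"
    proof -
      have "(n * D u (sc c z1))\<^sup>2 + (n * D u (sc c z2))\<^sup>2 = (real n)\<^sup>2 * ((D u (sc c z1))\<^sup>2 + (D u (sc c z2))\<^sup>2)"
        by (simp only: power_mult_distrib distrib_left)
      then show ?thesis by (simp only: eq power_mult_distrib mult.assoc)
    qed
    then have "(D u (sc (real n * c) z1))\<^sup>2 = (n * D u (sc c z1))\<^sup>2"
      using le[OF z(1)] le[OF z(2)] by linarith
    then show ?thesis by (rule power2_eq_imp_eq) auto
  qed
  then show "D u (sc c (xs @ ys)) = \<bar>c\<bar> * D u (xs @ ys)"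
    using homogeneous_from_integers[OF z(1) u] by (simp add: z1_def)
  show "(D u (xs @ ys))\<^sup>2 + (D u (xs @ sc (-1) ys))\<^sup>2 = 2 * (D u xs)\<^sup>2 + 2 * (D u ys)\<^sup>2"
    using eq[of 1] by (simp add: z1_def z2_def)
qed

lemma D_sc: "xs \<in> vecs \<Longrightarrow> u \<in> Y \<Longrightarrow> D u (sc c xs) = \<bar>c\<bar> * D u xs"
proof (induction xs arbitrary: c)
  case Nil then show ?case by (simp add: sc_def D_def)
next
  case (Cons x xs)
  obtain g r where x: "x = (g, r)" by (cases x)
  have g: "g \<in> \<Delta>" and xs: "xs \<in> vecs" using Cons.prems by (auto simp: x)
  have "D u (sc c [x]) = \<bar>c\<bar> * D u [x]" for c
    using d_flow_flow[of g u 0 "c * r"] d_flow_flow[of g u 0 r] flow_0[of g u] g Y_minp[OF Cons.prems(2) g]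
    by (simp add: D_def act_Cons x sc_def abs_mult)
  then show ?case
    using homogeneous_append(1)[of "[x]" xs u c] g xs Cons by (simp add: x)
qed

lemma D_parallelogram:
  assumes "xs \<in> vecs" "ys \<in> vecs" "u \<in> Y"
  shows "(D u (xs @ ys))\<^sup>2 + (D u (xs @ sc (-1) ys))\<^sup>2 = 2 * (D u xs)\<^sup>2 + 2 * (D u ys)\<^sup>2"
  using homogeneous_append(2)[OF assms] D_sc assms by simp

text \<open>The lengths at two base points differ by at most \<open>2 * d u v\<close>, whatever the
  vector; for large multiples homogeneity leaves no room for a difference.\<close>

lemma D_base:
  assumes xs: "xs \<in> vecs" and u: "u \<in> Y" and v: "v \<in> Y"
  shows "D u xs = D v xs"
proof -
  have "D u xs - D v xs \<le> 0" if u: "u \<in> Y" and v: "v \<in> Y" for u v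
  proof (rule nonpos_if_multiples_bounded)
    fix n :: nat
    have "D u (sc n xs) \<le> d u v + D v (sc n xs) + d u v"
      using triangle[of u v "act (sc n xs) u"] triangle[of v "act (sc n xs) v" "act (sc n xs) u"]
        xs u v by (simp add: D_def commute)
    then show "n * (D u xs - D v xs) \<le> 2 * d u v" using D_sc[OF xs u, of n] D_sc[OF xs v, of n] by (simp add: algebra_simps)
  qed
  from this[OF u v] this[OF v u] show ?thesis by simp
qed

end

context translation_lattice
begin

lemma act_M [simp]: "xs \<in> vecs \<Longrightarrow> u \<in> Y \<Longrightarrow> act xs u \<in> M"
  using act_Y Y_M by blast

lemma D_double: "r \<in> vecs \<Longrightarrow> u \<in> Y \<Longrightarrow> d (act r u) (act (sc (-1) r) u) = 2 * D u r"
proof -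
  assume r: "r \<in> vecs" and u: "u \<in> Y"
  have "d (act r u) (act (sc (-1) r) u) = D u (r @ sc (-1) (sc (-1) r))"
    by (rule D_diff) (use r u in auto)
  also have "\<dots> = D u (sc 2 r)"
    using act_sc_add[OF r u, of 1 1] by (simp add: D_def act_append)
  finally show ?thesis using D_sc[OF r u, of 2] by simp
qed

text \<open>One inequality is that of the quadrilateral of \<open>u\<close>, \<open>act s v\<close>
  and their translates by \<open>r\<close>; the other is CN at \<open>act s v\<close>, the midpoint
  of its translates by r and -r. So the squared distance from \<open>u\<close> is exactly quadratic
  along flows.\<close>

lemma dist_act_parallelogram:
  assumes u: "u \<in> Y" and v: "v \<in> Y" and s: "s \<in> vecs" and r: "r \<in> vecs"
  shows "(d u (act (s @ r) v))\<^sup>2 + (d u (act (s @ sc (-1) r) v))\<^sup>2 = 2 * (d u (act s v))\<^sup>2 + 2 * (D u r)\<^sup>2"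
proof (rule antisym)
  have 1: "d (act r u) (act s v) = d u (act (s @ sc (-1) r) v)"
  proof -
    have "d (act r u) (act s v) = d (act (sc (-1) r) (act r u)) (act (sc (-1) r) (act s v))"
      using u v s r by simp
    also have "\<dots> = d u (act s (act (sc (-1) r) v))"
      using act_neg(1)[OF r u] act_commute[of "sc (-1) r" s v] s r v by simp
    finally show ?thesis by (simp add: act_append)
  qed
  have 2: "d (act r u) (act (s @ r) v) = d u (act s v)"
    using act_commute[OF s r v] act_dist[OF r u, of "act s v"] s v by (simp add: act_append)
  have 3: "d (act (s @ r) v) (act s v) = D u r"
    using D_base[OF r u v] s r v by (simp add: act_append D_def commute)
  have "(d u (act (s @ r) v))\<^sup>2 + (d (act r u) (act s v))\<^sup>2
      \<le> (d u (act r u))\<^sup>2 + (d (act r u) (act (s @ r) v))\<^sup>2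
      + (d (act (s @ r) v) (act s v))\<^sup>2 + (d (act s v) u)\<^sup>2"
    using u v s r by (intro quadrilateral) auto
  then show "(d u (act (s @ r) v))\<^sup>2 + (d u (act (s @ sc (-1) r) v))\<^sup>2
      \<le> 2 * (d u (act s v))\<^sup>2 + 2 * (D u r)\<^sup>2"
    unfolding 1 2 3 commute[of "act s v" u] D_def[symmetric] by simp
  have 4: "d (act (s @ r) v) (act (s @ sc (-1) r) v) = 2 * D u r"
    using D_double[OF r v] D_base[OF r u v] s r v by (simp add: act_append)
  have 5: "d (act s v) (act (s @ sc (-1) r) v) = D u r"
    using D_neg[OF r v] D_base[OF r u v] s r v by (simp add: act_append D_def)
  have "pt (1/2) (act (s @ r) v) (act (s @ sc (-1) r) v) = act s v"
    using u v s r 3 4 5 by (intro pt_eqI) auto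
  then have "(d u (act s v))\<^sup>2 \<le> (d u (act (s @ r) v))\<^sup>2 / 2
      + (d u (act (s @ sc (-1) r) v))\<^sup>2 / 2 - (d (act (s @ r) v) (act (s @ sc (-1) r) v))\<^sup>2 / 4"
    using CN_midpoint[of "act (s @ r) v" "act (s @ sc (-1) r) v" u] u v s r by simp
  then show "2 * (d u (act s v))\<^sup>2 + 2 * (D u r)\<^sup>2
      \<le> (d u (act (s @ r) v))\<^sup>2 + (d u (act (s @ sc (-1) r) v))\<^sup>2"
    unfolding 4 power_mult_distrib by simp
qed

subsection \<open>Flats\<close>

text \<open>In a Euclidean space, \<open>L s u v\<close> is twice the inner product of \<open>s\<close> with \<open>v - u\<close>.\<close>

definition L :: "(('a \<Rightarrow> 'a) \<times> real) list \<Rightarrow> 'a \<Rightarrow> 'a \<Rightarrow> real" where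
  "L s u v = (d u (act s v))\<^sup>2 - (D u s)\<^sup>2 - (d u v)\<^sup>2"

lemma L_cong: "act s u = act s' u \<Longrightarrow> act s v = act s' v \<Longrightarrow> L s u v = L s' u v"
  by (simp add: L_def D_def)

lemma L_parallelogram:
  assumes "u \<in> Y" "v \<in> Y" "s \<in> vecs" "r \<in> vecs"
  shows "L (s @ r) u v + L (s @ sc (-1) r) u v = 2 * L s u v"
  using dist_act_parallelogram[OF assms] D_parallelogram[OF assms(3,4,1)] by (simp add: L_def)

text \<open>As in the Jordan--von Neumann argument, \<open>L_parallelogram\<close> is applied to the
  half sum and the half difference of \<open>s\<close> and \<open>r\<close>, whose sum is
  \<open>s\<close> and whose difference is \<open>r\<close>.\<close>

lemma L_append:
  assumes u: "u \<in> Y" and v: "v \<in> Y" and s: "s \<in> vecs" and r: "r \<in> vecs"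
  shows "L (s @ r) u v = L s u v + L r u v"
proof -
  have dbl: "L (sc 2 x) u v = 2 * L x u v" if x: "x \<in> vecs" for x
  proof -
    have "L (x @ x) u v = L (sc 2 x) u v"
      using act_sc_add[OF x u, of 1 1] act_sc_add[OF x v, of 1 1] by (intro L_cong) (simp_all add: act_append)
    moreover have "L (x @ sc (-1) x) u v = 0"
      using act_neg(2)[OF x u] act_neg(2)[OF x v] zero[of u u] u by (simp add: L_def D_def act_append)
    ultimately show ?thesis using L_parallelogram[OF u v x x] by simp
  qed
  define a b where "a = sc (1/2) (s @ r)" and "b = sc (1/2) (s @ sc (-1) r)"
  have ab: "a \<in> vecs" "b \<in> vecs" using s r by (auto simp: a_def b_def)
  have half: "act (sc (1/2) x) (act (sc (1/2) x) w) = act x w" if "x \<in> vecs" "w \<in> Y" for x w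
    using act_sc_add[OF that, of "1/2" "1/2"] by simp
  have cancel: "act (sc (1/2) x) (act (sc (-1/2) x) w) = w" if "x \<in> vecs" "w \<in> Y" for x w
    using act_sc_add[OF that, of "1/2" "-1/2"] that by simp
  have 1: "act (a @ b) w = act s w" if w: "w \<in> Y" for w
  proof -
    have "act (a @ b) w = act (sc (1/2) s) (act (sc (1/2) r) (act (sc (1/2) s) (act (sc (-1/2) r) w)))"
      by (simp add: a_def b_def act_append)
    also have "\<dots> = act (sc (1/2) s) (act (sc (1/2) s) (act (sc (1/2) r) (act (sc (-1/2) r) w)))"
      by (subst act_commute[of "sc (1/2) r" "sc (1/2) s"]) (use s r w in auto)
    finally show ?thesis by (simp only: cancel[OF r w] half[OF s w])
  qed
  have 2: "act (a @ sc (-1) b) w = act r w" if w: "w \<in> Y" for w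
  proof -
    have "act (a @ sc (-1) b) w = act (sc (1/2) s) (act (sc (1/2) r) (act (sc (-1/2) s) (act (sc (1/2) r) w)))"
      by (simp add: a_def b_def act_append)
    also have "\<dots> = act (sc (1/2) r) (act (sc (1/2) s) (act (sc (-1/2) s) (act (sc (1/2) r) w)))"
      by (rule act_commute) (use s r w in auto)
    also have "\<dots> = act (sc (1/2) r) (act (sc (1/2) r) w)"
      by (subst cancel[OF s]) (use r w in auto)
    finally show ?thesis by (simp only: half[OF r w])
  qed
  have "L s u v + L r u v = L (a @ b) u v + L (a @ sc (-1) b) u v"
    using L_cong[OF 1[OF u] 1[OF v]] L_cong[OF 2[OF u] 2[OF v]] by simp
  also have "\<dots> = 2 * L a u v" by (rule L_parallelogram[OF u v ab])
  also have "\<dots> = L (sc 2 a) u v" using dbl[OF ab(1)] by simp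
  also have "\<dots> = L (s @ r) u v" by (simp add: a_def)
  finally show ?thesis by simp
qed

lemma L_neg: "u \<in> Y \<Longrightarrow> v \<in> Y \<Longrightarrow> s \<in> vecs \<Longrightarrow> L (sc (-1) s) u v = - L s u v"
  using L_append[of u v s "sc (-1) s"] act_neg(2)[of s u] act_neg(2)[of s v] zero[of u u]
  by (simp add: L_def D_def act_append)

lemma L_bound:
  assumes u: "u \<in> Y" and v: "v \<in> Y" and s: "s \<in> vecs"
  shows "\<bar>L s u v\<bar> \<le> 2 * d u v * D u s"
proof -
  have le: "L s u v \<le> 2 * d u v * D u s" if s: "s \<in> vecs" for s
  proof -
    have "d u (act s v) \<le> d u v + D u s"
      using triangle[of u v "act s v"] D_base[OF s u v] u v s by (simp add: D_def)
    then have "(d u (act s v))\<^sup>2 \<le> (d u v + D u s)\<^sup>2" by (intro power_mono) auto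
    then show ?thesis by (simp add: L_def power2_sum)
  qed
  show ?thesis
    using le[OF s] le[of "sc (-1) s"] L_neg[OF u v s] D_neg[OF s u] s by (simp add: abs_le_iff)
qed

text \<open>Additivity gives the formula for integers, and \<open>L_bound\<close> controls the
  fractional part of n c, so n times the defect stays bounded.\<close>

lemma L_sc:
  assumes u: "u \<in> Y" and v: "v \<in> Y" and s: "s \<in> vecs"
  shows "L (sc c s) u v = c * L s u v"
proof -
  define f where "f c = L (sc c s) u v" for c
  have add: "f (a + b) = f a + f b" for a b
  proof -
    have "L (sc (a + b) s) u v = L (sc a s @ sc b s) u v"
      using act_sc_add[OF s u] act_sc_add[OF s v] by (intro L_cong) (simp_all add: act_append)
    then show ?thesis using L_append[OF u v] s by (simp add: f_def)
  qed
  define K where "K = 2 * d u v * D u s"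
  have bd: "\<bar>f c\<bar> \<le> \<bar>c\<bar> * K" for c
    using L_bound[OF u v, of "sc c s"] s D_sc[OF s u, of c] by (simp add: f_def K_def mult_ac)
  have f0: "f 0 = 0" using add[of 0 0] by simp
  have nat: "f (real n * c) = n * f c" for n c
    by (induction n) (auto simp: f0 add algebra_simps)
  have neg: "f (- c) = - f c" for c using add[of c "- c"] f0 by simp
  have int: "f (real_of_int m) = m * f 1" for m
    using nat[of "nat m" 1] nat[of "nat (- m)" 1] neg[of "real_of_int m"] by (cases "m \<ge> 0") auto
  have "n * \<bar>f c - c * f 1\<bar> \<le> K + \<bar>f 1\<bar>" for n :: nat
  proof -
    define m where "m = \<lfloor>n * c\<rfloor>"
    have m: "\<bar>n * c - m\<bar> \<le> 1" unfolding m_def by linarith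
    have "n * f c = f (n * c - m) + m * f 1" using add[of "n * c - m" m] nat[of n c] int by simp
    then have "n * (f c - c * f 1) = f (n * c - m) - (n * c - m) * f 1" by (simp add: algebra_simps)
    then have "\<bar>n * (f c - c * f 1)\<bar> \<le> \<bar>f (n * c - m)\<bar> + \<bar>(n * c - m) * f 1\<bar>"
      by (simp only: abs_triangle_ineq4)
    also have "\<dots> \<le> 1 * K + 1 * \<bar>f 1\<bar>"
      using bd[of "n * c - m"] mult_right_mono[OF m, of K] mult_right_mono[OF m, of "\<bar>f 1\<bar>"]
      by (auto simp: abs_mult K_def intro!: add_mono)
    finally show ?thesis by (simp add: abs_mult)
  qed
  then have "\<bar>f c - c * f 1\<bar> \<le> 0"
    by (intro nonpos_if_multiples_bounded[of "\<bar>f c - c * f 1\<bar>" "K + \<bar>f 1\<bar>"])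
  then show ?thesis by (simp add: f_def)
qed

lemma dist_act_sc:
  assumes u: "u \<in> Y" and v: "v \<in> Y" and s: "s \<in> vecs"
  shows "(d u (act (sc c s) v))\<^sup>2 = c\<^sup>2 * (D u s)\<^sup>2 + c * L s u v + (d u v)\<^sup>2"
  using L_sc[OF assms, of c] D_sc[OF s u, of c] by (simp add: L_def power_mult_distrib algebra_simps)

text \<open>First variation: the polynomial \<open>c\<^sup>2 * (D u s)\<^sup>2 + c * L s u v\<close>
  is nonnegative at c = 1/n and at c = -1/n, which bounds n times \<bar>L s u v\<bar> independently
  of n.\<close>

lemma L_zero_if_minimal:
  assumes u: "u \<in> Y" and v: "v \<in> Y" and s: "s \<in> vecs"
    and min: "\<And>c. d u v \<le> d u (act (sc c s) v)"
  shows "L s u v = 0"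
proof -
  have ge: "0 \<le> c\<^sup>2 * (D u s)\<^sup>2 + c * L s u v" for c
    using power_mono[OF min[of c], of 2] dist_act_sc[OF u v s, of c] by simp
  have nn: "- (n * x) \<le> (D u s)\<^sup>2" if "0 \<le> (1 / n)\<^sup>2 * (D u s)\<^sup>2 + (1 / n) * x" "n > 0" for n x :: real
  proof -
    have "0 \<le> n\<^sup>2 * ((1 / n)\<^sup>2 * (D u s)\<^sup>2 + (1 / n) * x)" using that(1) by simp
    also have "\<dots> = (D u s)\<^sup>2 + n * x" using that(2) by (simp add: power2_eq_square distrib_left)
    finally show ?thesis by simp
  qed
  have "L s u v \<le> 0"
  proof (rule nonpos_if_multiples_bounded[of "L s u v" "(D u s)\<^sup>2"])
    fix n :: nat
    show "real n * L s u v \<le> (D u s)\<^sup>2"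
      using ge[of "- (1 / n)"] nn[of "real n" "- L s u v"] by (cases "n = 0") simp_all
  qed
  moreover have "- L s u v \<le> 0"
  proof (rule nonpos_if_multiples_bounded)
    fix n :: nat
    show "real n * - L s u v \<le> (D u s)\<^sup>2"
      using ge[of "1 / n"] nn[of "real n" "L s u v"] by (cases "n = 0") simp_all
  qed
  ultimately show ?thesis by simp
qed

lemma L_antisym:
  assumes u: "u \<in> Y" and v: "v \<in> Y" and s: "s \<in> vecs"
  shows "L s v u = - L s u v"
proof -
  have "d v (act s u) = d (act (sc (-1) s) v) (act (sc (-1) s) (act s u))" using u v s by simp
  also have "\<dots> = d u (act (sc (-1) s) v)" by (simp only: act_neg(1)[OF s u] commute)
  finally have "L s v u = L (sc (-1) s) u v"
    using D_neg[OF s u] D_base[OF s u v] by (simp add: L_def commute)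
  then show ?thesis using L_neg[OF u v s] by simp
qed

text \<open>Go from \<open>u\<close> to the translate of \<open>w\<close> by 2 n s through the
  translate of \<open>v\<close> by n s, and square. The terms quadratic in n cancel, and the
  remaining linear expression is bounded, so its coefficient is at most 0. The vector -s gives the
  other inequality.\<close>

lemma L_cocycle:
  assumes u: "u \<in> Y" and v: "v \<in> Y" and w: "w \<in> Y" and s: "s \<in> vecs"
  shows "L s u w = L s u v + L s v w"
proof -
  have le: "L s u w - L s u v - L s v w \<le> 0" if s: "s \<in> vecs" for s
  proof (rule nonpos_if_multiples_bounded)
    fix n :: nat
    define x y z where "x = d u (act (sc (2 * n) s) w)" and "y = d u (act (sc n s) v)"
      and "z = d v (act (sc n s) w)"
    have "act (sc (2 * n) s) w = act (sc n s) (act (sc n s) w)"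
      using act_sc_add[OF s w, of n n] by simp
    then have "x \<le> y + z"
      using triangle[of u "act (sc n s) v" "act (sc n s) (act (sc n s) w)"] u v w s by (simp add: x_def y_def z_def)
    then have "x\<^sup>2 \<le> (y + z)\<^sup>2" by (intro power_mono) (auto simp: x_def)
    also have "\<dots> \<le> 2 * y\<^sup>2 + 2 * z\<^sup>2"
      using sum_squares_bound[of y z] by (simp add: power2_sum)
    finally have "x\<^sup>2 \<le> 2 * y\<^sup>2 + 2 * z\<^sup>2" .
    then have "4 * (n\<^sup>2 * (D u s)\<^sup>2) + 2 * n * L s u w + (d u w)\<^sup>2
        \<le> 2 * (n\<^sup>2 * (D u s)\<^sup>2 + n * L s u v + (d u v)\<^sup>2) + 2 * (n\<^sup>2 * (D u s)\<^sup>2 + n * L s v w + (d v w)\<^sup>2)"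
      using dist_act_sc[OF u w s, of "2 * n"] dist_act_sc[OF u v s, of n] dist_act_sc[OF v w s, of n]
        D_base[OF s u v] by (simp add: x_def y_def z_def power_mult_distrib)
    then have "2 * (n * (L s u w - L s u v - L s v w)) + (d u w)\<^sup>2 \<le> 2 * ((d u v)\<^sup>2 + (d v w)\<^sup>2)"
      by (simp add: algebra_simps)
    then show "n * (L s u w - L s u v - L s v w) \<le> (d u v)\<^sup>2 + (d v w)\<^sup>2"
    proof -
      have "x \<le> z" if "2 * x + y \<le> 2 * z" "0 \<le> y" for x y z :: real using that by simp
      then show ?thesis using zero_le_power2[of "d u w"] \<open>2 * _ + _ \<le> _\<close> by blast
    qed
  qed
  have "- L s u w + L s u v + L s v w \<le> 0"
    using le[of "sc (-1) s"] s L_neg[OF u w s] L_neg[OF u v s] L_neg[OF v w s] by simp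
  then show ?thesis using le[OF s] by simp
qed

text \<open>The closure of the orbit of \<open>v\<close> under the flows: no bound on the rank of
  \<open>\<Delta>\<close> is assumed that would make the orbit closed, and projections to it are
  wanted.\<close>

definition flat :: "'a \<Rightarrow> 'a set" where
  "flat v = {p \<in> M. \<forall>e>0. \<exists>t\<in>vecs. d p (act t v) < e}"

lemma flat_M: "p \<in> flat v \<Longrightarrow> p \<in> M" by (simp add: flat_def)

lemma flatE: assumes "p \<in> flat v" "e > 0" obtains t where "t \<in> vecs" "d p (act t v) < e"
  using assms by (auto simp: flat_def)

lemma act_in_flat: "v \<in> Y \<Longrightarrow> t \<in> vecs \<Longrightarrow> act t v \<in> flat v"
  by (auto simp: flat_def intro!: bexI[of _ t])

lemma self_in_flat: "v \<in> Y \<Longrightarrow> v \<in> flat v"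
  using act_in_flat[of v "[]"] by simp

lemma flat_Y: assumes v: "v \<in> Y" and p: "p \<in> flat v" shows "p \<in> Y"
proof -
  obtain x where x: "\<And>n. x n \<in> (\<lambda>t. act t v) ` vecs" "conv x p"
  proof (rule conv_from_close[of p "(\<lambda>t. act t v) ` vecs"])
    show "\<exists>x\<in>(\<lambda>t. act t v) ` vecs. d x p < e" if "e > 0" for e
      using flatE[OF p that] by (auto simp: commute)
  qed (use v p flat_M in auto)
  have "x n \<in> Y" for n using x(1)[of n] v by auto
  then show ?thesis using sclosedD[OF Y_closed _ x(2)] by blast
qed

lemma flat_ccset: assumes v: "v \<in> Y" shows "ccset (flat v)"
  unfolding ccset_def
proof (intro conjI)
  show "flat v \<noteq> {}" using self_in_flat[OF v] by blast
  show "sclosed (flat v)"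
    unfolding sclosed_def
  proof (intro conjI allI impI)
    show "flat v \<subseteq> M" using flat_M by blast
    fix x y assume "(\<forall>n. x n \<in> flat v) \<and> conv x y"
    then have x: "\<And>n. x n \<in> flat v" and y: "conv x y" by auto
    have yM: "y \<in> M" using y by (simp add: conv_def)
    show "y \<in> flat v"
      unfolding flat_def
    proof (intro CollectI conjI allI impI yM)
      fix e :: real assume e: "e > 0"
      have "\<forall>\<^sub>F n in sequentially. d (x n) y < e / 2"
        using order_tendstoD(2)[of "\<lambda>n. d (x n) y" 0 sequentially "e / 2"] y e by (simp add: conv_def)
      then obtain n where n: "d (x n) y < e / 2" using eventually_happens'[OF sequentially_bot] by blast
      obtain t where t: "t \<in> vecs" "d (x n) (act t v) < e / 2" using flatE[OF x, of "e / 2"] e by auto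
      have "d y (act t v) < e"
        using triangle[of y "x n" "act t v"] n t yM flat_M[OF x] v by (simp add: commute)
      then show "\<exists>t\<in>vecs. d y (act t v) < e" using t by blast
    qed
  qed
  show "gconvex (flat v)"
    unfolding gconvex_def
  proof (intro ballI)
    fix p q s assume p: "p \<in> flat v" and q: "q \<in> flat v" and s: "s \<in> {0..1::real}"
    show "pt s p q \<in> flat v"
      unfolding flat_def
    proof (intro CollectI conjI allI impI)
      show "pt s p q \<in> M" using p q s flat_M by auto
      fix e :: real assume e: "e > 0"
      obtain t where t: "t \<in> vecs" "d p (act t v) < e" using flatE[OF p e] .
      obtain r where r: "r \<in> vecs" "d q (act r v) < e" using flatE[OF q e] .
      \<comment> \<open>The affine combination of the vectors \<open>t\<close> and \<open>r\<close>;
        since flows translate, it leads to the point at fraction \<open>s\<close> between the two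
        approximating points.\<close>
      define z where "z = sc (1 - s) t @ sc s r"
      have z: "z \<in> vecs" using t r by (simp add: z_def)
      have Drt: "d (act t v) (act r v) = D v (t @ sc (-1) r)" using D_diff t r v by simp
      have "pt s (act t v) (act r v) = act z v"
      proof (rule pt_eqI)
        have "d (act t v) (act z v) = d (act (sc s t) v) (act (sc s r) v)"
        proof -
          have "act t v = act (sc (1 - s) t) (act (sc s t) v)" using act_sc_add[OF t(1) v, of "1 - s" s] by simp
          then show ?thesis using t r v by (simp add: z_def act_append)
        qed
        also have "\<dots> = D v (sc s (t @ sc (-1) r))" using D_diff[of "sc s t" "sc s r" v] t r v by simp
        finally show "d (act t v) (act z v) = s * d (act t v) (act r v)"
          using D_sc[of "t @ sc (-1) r" v s] t r v s by (simp only: Drt) simp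
        have "d (act z v) (act r v) = d (act (sc (1 - s) t) v) (act (sc (1 - s) r) v)"
        proof -
          have "act r v = act (sc s r) (act (sc (1 - s) r) v)" using act_sc_add[OF r(1) v, of s "1 - s"] by simp
          moreover have "act z v = act (sc s r) (act (sc (1 - s) t) v)"
            using act_commute[of "sc s r" "sc (1 - s) t" v] t r v by (simp add: z_def act_append)
          ultimately show ?thesis using t r v by simp
        qed
        also have "\<dots> = D v (sc (1 - s) (t @ sc (-1) r))"
          using D_diff[of "sc (1 - s) t" "sc (1 - s) r" v] t r v by simp
        finally show "d (act z v) (act r v) = (1 - s) * d (act t v) (act r v)"
          using D_sc[of "t @ sc (-1) r" v "1 - s"] t r v s by (simp only: Drt) simp
      qed (use t r z v s in auto)
      then have "d (pt s p q) (act z v) \<le> (1 - s) * d p (act t v) + s * d q (act r v)"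
        using pt_convex[of p q "act t v" "act r v" s] p q t r v s flat_M by auto
      also have "\<dots> < e"
      proof (cases "s = 0")
        case False
        then have "s * d q (act r v) < s * e" using s r by simp
        moreover have "(1 - s) * d p (act t v) \<le> (1 - s) * e" using s t by (intro mult_left_mono) auto
        ultimately show ?thesis by (simp add: algebra_simps)
      qed (use t in simp)
      finally show "\<exists>t\<in>vecs. d (pt s p q) (act t v) < e" using z by blast
    qed
  qed
qed

lemma flat_act: assumes v: "v \<in> Y" and p: "p \<in> flat v" and t: "t \<in> vecs" shows "act t p \<in> flat v"
  unfolding flat_def
proof (intro CollectI conjI allI impI)
  have pY: "p \<in> Y" using flat_Y[OF v p] .
  then show "act t p \<in> M" using t by simp
  fix e :: real assume "e > 0"
  then obtain s where s: "s \<in> vecs" "d p (act s v) < e" using flatE[OF p] by blast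
  then have "d (act t p) (act (t @ s) v) < e" using t pY v by (simp add: act_append)
  then show "\<exists>s\<in>vecs. d (act t p) (act s v) < e" using s t by (intro bexI[of _ "t @ s"]) auto
qed

lemma flat_trans: assumes v: "v \<in> Y" and p: "p \<in> flat v" and q: "q \<in> flat p" shows "q \<in> flat v"
  unfolding flat_def
proof (intro CollectI conjI allI impI)
  have pY: "p \<in> Y" using flat_Y[OF v p] .
  show qM: "q \<in> M" using q flat_M by blast
  fix e :: real assume e: "e > 0"
  obtain t where t: "t \<in> vecs" "d q (act t p) < e / 2" using flatE[OF q, of "e / 2"] e by auto
  obtain s where s: "s \<in> vecs" "d p (act s v) < e / 2" using flatE[OF p, of "e / 2"] e by auto
  have "d q (act (t @ s) v) < e"
    using triangle[of q "act t p" "act t (act s v)"] qM t s pY v by (simp add: act_append)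
  then show "\<exists>s\<in>vecs. d q (act s v) < e" using s t by (intro bexI[of _ "t @ s"]) auto
qed

lemma flat_sym: assumes v: "v \<in> Y" and p: "p \<in> flat v" shows "v \<in> flat p"
  unfolding flat_def
proof (intro CollectI conjI allI impI)
  have pY: "p \<in> Y" using flat_Y[OF v p] .
  show "v \<in> M" using v by simp
  fix e :: real assume "e > 0"
  then obtain s where s: "s \<in> vecs" "d p (act s v) < e" using flatE[OF p] by blast
  have "d v (act (sc (-1) s) p) = d (act (sc (-1) s) (act s v)) (act (sc (-1) s) p)"
    using act_neg(1)[OF s(1) v] by simp
  also have "\<dots> = d p (act s v)" using s v pY by (simp add: commute)
  finally show "\<exists>s\<in>vecs. d v (act s p) < e" using s by (intro bexI[of _ "sc (-1) s"]) auto
qed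

lemma L_proj_flat:
  assumes u: "u \<in> Y" and v: "v \<in> Y" and s: "s \<in> vecs"
  shows "L s u (proj (flat v) u) = 0"
proof (rule L_zero_if_minimal[OF u _ s])
  have p: "proj (flat v) u \<in> flat v" using proj_in[OF flat_ccset[OF v]] u by simp
  then show "proj (flat v) u \<in> Y" by (rule flat_Y[OF v])
  show "d u (proj (flat v) u) \<le> d u (act (sc c s) (proj (flat v) u))" for c
    using u s by (intro proj_le[OF flat_ccset[OF v]] flat_act[OF v p]) auto
qed

text \<open>A converse to \<open>L_proj_flat\<close>: by Pythagoras no translate of \<open>p\<close>
  is closer to \<open>u\<close> than \<open>p\<close>, and the translates of \<open>p\<close> are
  dense in the flat.\<close>

lemma dset_flat_eq:
  assumes u: "u \<in> Y" and v: "v \<in> Y" and p: "p \<in> flat v" and L0: "\<And>s. s \<in> vecs \<Longrightarrow> L s u p = 0"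
  shows "dset (flat v) u = d u p"
proof (rule antisym)
  have pY: "p \<in> Y" using flat_Y[OF v p] .
  show "dset (flat v) u \<le> d u p" using dset_le[OF flat_ccset[OF v] _ p] u by simp
  define q where "q = proj (flat v) u"
  have q: "q \<in> flat v" using proj_in[OF flat_ccset[OF v]] u by (simp add: q_def)
  have qp: "q \<in> flat p" using flat_trans[OF pY flat_sym[OF v p] q] .
  have "d u p \<le> d u q + e" if e: "e > 0" for e
  proof -
    obtain t where t: "t \<in> vecs" "d q (act t p) < e" using flatE[OF qp e] .
    have "(d u p)\<^sup>2 \<le> (d u (act t p))\<^sup>2" using L0[OF t(1)] zero_le_power2[of "D u t"] unfolding L_def by linarith
    then have "d u p \<le> d u (act t p)" by (rule power2_le_imp_le) simp
    also have "\<dots> \<le> d u q + d q (act t p)" using triangle[of u q "act t p"] u t pY flat_M[OF q] by simp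
    finally show ?thesis using t by simp
  qed
  then show "d u p \<le> dset (flat v) u" unfolding dset_def q_def[symmetric] by (rule field_le_epsilon)
qed

section \<open>Isometries that normalize the abelian group, and their action on flats\<close>

definition nml :: "('a \<Rightarrow> 'a) \<Rightarrow> bool" where
  "nml h \<longleftrightarrow> iso h \<and> (\<forall>g\<in>\<Delta>. h \<otimes>\<^bsub>IG\<^esub> g \<otimes>\<^bsub>IG\<^esub> inv\<^bsub>IG\<^esub> h \<in> \<Delta>) \<and> (\<forall>g\<in>\<Delta>. inv\<^bsub>IG\<^esub> h \<otimes>\<^bsub>IG\<^esub> g \<otimes>\<^bsub>IG\<^esub> h \<in> \<Delta>)"

text \<open>The linear action on vectors induced by conjugation; by \<open>nml_act\<close>,
  \<open>h\<close> is affine along the flows with this linear part.\<close>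

definition cj :: "('a \<Rightarrow> 'a) \<Rightarrow> (('a \<Rightarrow> 'a) \<times> real) list \<Rightarrow> (('a \<Rightarrow> 'a) \<times> real) list" where
  "cj h xs = map (\<lambda>(g, r). (h \<otimes>\<^bsub>IG\<^esub> g \<otimes>\<^bsub>IG\<^esub> inv\<^bsub>IG\<^esub> h, r)) xs"

lemma nml_inv: "nml h \<Longrightarrow> nml (inv\<^bsub>IG\<^esub> h)" by (simp add: nml_def)

lemma nml_conj: "nml h \<Longrightarrow> g \<in> \<Delta> \<Longrightarrow> h \<otimes>\<^bsub>IG\<^esub> g \<otimes>\<^bsub>IG\<^esub> inv\<^bsub>IG\<^esub> h \<in> \<Delta>"
  "nml h \<Longrightarrow> g \<in> \<Delta> \<Longrightarrow> inv\<^bsub>IG\<^esub> h \<otimes>\<^bsub>IG\<^esub> g \<otimes>\<^bsub>IG\<^esub> h \<in> \<Delta>" by (simp_all add: nml_def)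

lemma nml_iso [simp]: "nml h \<Longrightarrow> iso h" by (simp add: nml_def)

lemma cj_vecs [simp]: "nml h \<Longrightarrow> xs \<in> vecs \<Longrightarrow> cj h xs \<in> vecs"
  by (auto simp: cj_def vecs_def nml_conj)

lemma cj_append [simp]: "cj h (xs @ ys) = cj h xs @ cj h ys" by (simp add: cj_def)

lemma cj_sc [simp]: "cj h (sc c xs) = sc c (cj h xs)" by (auto simp: cj_def sc_def)

lemma nml_Y [simp]: assumes h: "nml h" and u: "u \<in> Y" shows "h u \<in> Y"
proof (rule YI)
  show "h u \<in> M" using h u by simp
  fix g assume g: "g \<in> \<Delta>"
  define k where "k = inv\<^bsub>IG\<^esub> h \<otimes>\<^bsub>IG\<^esub> g \<otimes>\<^bsub>IG\<^esub> h"
  have k: "k \<in> \<Delta>" unfolding k_def by (rule nml_conj(2)[OF h g])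
  have "h \<otimes>\<^bsub>IG\<^esub> k \<otimes>\<^bsub>IG\<^esub> inv\<^bsub>IG\<^esub> h = g"
    by (rule iso_eqI) (use h g in \<open>auto simp: k_def\<close>)
  then show "minp g (h u)" using minp_conj[OF \<Delta>_iso[OF k] nml_iso[OF h] Y_minp[OF u k]] by simp
qed

lemma nml_act: assumes h: "nml h" and u: "u \<in> Y" shows "xs \<in> vecs \<Longrightarrow> h (act xs u) = act (cj h xs) (h u)"
proof (induction xs)
  case (Cons x xs)
  obtain g r where x: "x = (g, r)" by (cases x)
  have g: "g \<in> \<Delta>" and xs: "xs \<in> vecs" using Cons.prems by (auto simp: x)
  have "h (flow g r (act xs u)) = flow (h \<otimes>\<^bsub>IG\<^esub> g \<otimes>\<^bsub>IG\<^esub> inv\<^bsub>IG\<^esub> h) r (h (act xs u))"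
    by (rule flow_conj[OF \<Delta>_iso[OF g] nml_iso[OF h] Y_minp[OF act_Y[OF xs u] g]])
  then show ?case using Cons.IH[OF xs] by (simp add: x act_Cons cj_def)
qed (simp add: cj_def)

lemma nml_flat: assumes h: "nml h" and v: "v \<in> Y" and p: "p \<in> flat v" shows "h p \<in> flat (h v)"
  unfolding flat_def
proof (intro CollectI conjI allI impI)
  show "h p \<in> M" using h flat_M[OF p] by simp
  fix e :: real assume "e > 0"
  then obtain t where t: "t \<in> vecs" "d p (act t v) < e" using flatE[OF p] by blast
  have "d (h p) (act (cj h t) (h v)) = d p (act t v)"
    unfolding nml_act[OF h v t(1), symmetric] by (rule iso_dist) (use h v t flat_M[OF p] in auto)
  then show "\<exists>t\<in>vecs. d (h p) (act t (h v)) < e" using t h by (intro bexI[of _ "cj h t"]) auto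
qed

lemma dset_nml: assumes h: "nml h" and v: "v \<in> Y" and u: "u \<in> M"
  shows "dset (flat (h v)) (h u) = dset (flat v) u"
proof -
  have le: "dset (flat (h v)) (h u) \<le> dset (flat v) u" if h: "nml h" and v: "v \<in> Y" and u: "u \<in> M" for h v u
  proof -
    define p where "p = proj (flat v) u"
    have p: "p \<in> flat v" using proj_in[OF flat_ccset[OF v] u] by (simp add: p_def)
    have "dset (flat (h v)) (h u) \<le> d (h u) (h p)"
      by (rule dset_le[OF flat_ccset[OF nml_Y[OF h v]] iso_in[OF nml_iso[OF h] u] nml_flat[OF h v p]])
    then show ?thesis using h u flat_M[OF p] by (simp add: dset_def p_def[symmetric])
  qed
  have iv: "(inv\<^bsub>IG\<^esub> h) (h x) = x" if "x \<in> M" for x by (rule inv_apply(2)[OF nml_iso[OF h] that])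
  have "dset (flat ((inv\<^bsub>IG\<^esub> h) (h v))) ((inv\<^bsub>IG\<^esub> h) (h u)) \<le> dset (flat (h v)) (h u)"
    by (rule le[OF nml_inv[OF h] nml_Y[OF h v] iso_in[OF nml_iso[OF h] u]])
  then show ?thesis using le[OF assms] unfolding iv[OF u] iv[OF Y_M[OF v]] by linarith
qed

end

context complete_CAT0
begin

lemma dset_sublevel_closed:
  assumes C: "ccset C" shows "sclosed {u \<in> M. dset C u \<le> c}"
  unfolding sclosed_def
proof (intro conjI allI impI)
  fix x y assume a: "(\<forall>n. x n \<in> {u \<in> M. dset C u \<le> c}) \<and> conv x y"
  then have x: "\<And>n. x n \<in> M" "\<And>n. dset C (x n) \<le> c" and y: "conv x y" "y \<in> M" by (auto simp: conv_def)
  have "dset C y \<le> c + d (x n) y" for n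
    using dset_lipschitz[OF C y(2) x(1)[of n]] x(2)[of n] by (simp add: commute)
  moreover have "(\<lambda>n. c + d (x n) y) \<longlonglongrightarrow> c + 0"
    using y by (intro tendsto_add tendsto_const) (simp add: conv_def)
  ultimately have "dset C y \<le> c + 0" by (intro LIMSEQ_le_const) auto
  then show "y \<in> {u \<in> M. dset C u \<le> c}" using y by simp
qed auto

lemma dset_sublevel_convex:
  assumes C: "ccset C" shows "gconvex {u \<in> M. dset C u \<le> c}"
  unfolding gconvex_def
proof (intro ballI)
  fix x y s assume *: "x \<in> {u \<in> M. dset C u \<le> c}" "y \<in> {u \<in> M. dset C u \<le> c}" "s \<in> {0..1::real}"
  then have "dset C (pt s x y) \<le> (1 - s) * dset C x + s * dset C y" by (intro dset_convex[OF C]) auto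
  also have "\<dots> \<le> (1 - s) * c + s * c" using * by (intro add_mono mult_left_mono) auto
  finally show "pt s x y \<in> {u \<in> M. dset C u \<le> c}" using * by (simp add: algebra_simps)
qed

end

context translation_lattice
begin

text \<open>A circumcentre argument in the space of flats. \<open>G\<close> permutes the flats
  through the orbit of \<open>y\<close>, and the cosets of \<open>\<Delta>\<close> make them
  finitely many. Near their circumcentre, the set \<open>E c\<close> is so thin across the flats
  that \<open>G\<close> almost preserves the flat of each of its points. The hypothesis
  \<open>star\<close>, for the projection of \<open>y\<close> to \<open>E c\<close>, carries this
  back to \<open>y\<close>.\<close>

lemma orbit_in_flat:
  assumes G: "subgroup G IG" "\<And>g. g \<in> G \<Longrightarrow> nml g" "\<Delta> \<subseteq> G"
    and R: "finite R" "R \<subseteq> G" "\<And>g. g \<in> G \<Longrightarrow> \<exists>r\<in>R. \<exists>k\<in>\<Delta>. g = r \<otimes>\<^bsub>IG\<^esub> k"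
    and y: "y \<in> Y"
    and star: "\<And>C g. ccset C \<Longrightarrow> (\<And>h. h \<in> G \<Longrightarrow> stable h C) \<Longrightarrow> g \<in> G \<Longrightarrow> disp g (proj C y) = disp g y"
    and g: "g \<in> G"
  shows "g y \<in> flat y"
proof -
  have GI: "iso h" if "h \<in> G" for h using G(2)[OF that] by simp
  have hY: "h u \<in> Y" if "h \<in> G" "u \<in> Y" for h u using nml_Y[OF G(2)[OF that(1)] that(2)] .
  have cc: "ccset (flat (h y))" if "h \<in> G" for h using flat_ccset[OF hY[OF that y]] .
  \<comment> \<open>The common part, inside \<open>Y\<close>, of the c-neighbourhoods of all flats
    of the orbit. It is invariant under \<open>G\<close> and under the flows.\<close>
  define E where "E c = M \<inter> \<Inter>(insert Y ((\<lambda>h. {u \<in> M. dset (flat (h y)) u \<le> c}) ` G))" for c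
  have E_iff: "u \<in> E c \<longleftrightarrow> u \<in> Y \<and> (\<forall>h\<in>G. dset (flat (h y)) u \<le> c)" for u c
    by (auto simp: E_def)
  have E_cc: "ccset (E c)" if "E c \<noteq> {}" for c
    unfolding ccset_def
  proof (intro conjI that)
    show "sclosed (E c)" unfolding E_def
      using dset_sublevel_closed[OF cc] Y_closed by (intro sclosed_Inter) blast
    show "gconvex (E c)" unfolding E_def
      using dset_sublevel_convex[OF cc] Y_convex by (intro gconvex_Inter) blast
  qed
  have E_step: "h u \<in> E c" if h: "h \<in> G" and u: "u \<in> E c" for h u c
    unfolding E_iff
  proof (intro conjI ballI)
    have uY: "u \<in> Y" using u by (simp add: E_iff)
    show "h u \<in> Y" using hY[OF h uY] .
    fix k assume k: "k \<in> G"
    define k' where "k' = inv\<^bsub>IG\<^esub> h \<otimes>\<^bsub>IG\<^esub> k"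
    have k': "k' \<in> G" using subgroup.m_closed[OF G(1) subgroup.m_inv_closed[OF G(1) h] k] by (simp add: k'_def)
    have "h (k' y) = k y" using GI[OF h] GI[OF k] y by (simp add: k'_def)
    then have "dset (flat (k y)) (h u) = dset (flat (k' y)) u"
      using dset_nml[OF G(2)[OF h] hY[OF k' y] Y_M[OF uY]] by simp
    then show "dset (flat (k y)) (h u) \<le> c" using u k' by (simp add: E_iff)
  qed
  have E_stable: "stable h (E c)" if "h \<in> G" for h c
    unfolding stable_def using E_step[OF that] E_step[OF subgroup.m_inv_closed[OF G(1) that]] by blast
  have E_act: "act t u \<in> E c" if u: "u \<in> E c" and t: "t \<in> vecs" for t u c
    unfolding E_iff
  proof (intro conjI ballI)
    have uY: "u \<in> Y" using u by (simp add: E_iff)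
    then show "act t u \<in> Y" using t by simp
    fix h assume h: "h \<in> G"
    define p where "p = proj (flat (h y)) u"
    have p: "p \<in> flat (h y)" using proj_in[OF cc[OF h]] uY by (simp add: p_def)
    have "dset (flat (h y)) (act t u) \<le> d (act t u) (act t p)"
      using t uY by (intro dset_le[OF cc[OF h]] flat_act[OF hY[OF h y] p]) auto
    also have "\<dots> = dset (flat (h y)) u"
      using act_dist[OF t uY flat_Y[OF hY[OF h y] p]] by (simp add: dset_def p_def)
    finally show "dset (flat (h y)) (act t u) \<le> c" using u h by (auto simp: E_iff)
  qed
  \<comment> \<open>\<open>\<Delta>\<close> moves \<open>y\<close> within its flat, so the flat of
    \<open>h y\<close> depends only on the coset of \<open>h\<close>, and finitely many
    representatives bound all distances.\<close>
  define c0 where "c0 = (\<Sum>r\<in>R. d y (r y))"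
  have "y \<in> E c0"
    unfolding E_iff
  proof (intro conjI ballI y)
    fix h assume h: "h \<in> G"
    obtain r k where rk: "r \<in> R" "k \<in> \<Delta>" "h = r \<otimes>\<^bsub>IG\<^esub> k" using R(3)[OF h] by blast
    have rG: "r \<in> G" using R rk by blast
    have "k y \<in> flat y" using act_in_flat[OF y, of "[(k, 1)]"] flow_1[OF \<Delta>_iso[OF rk(2)] Y_minp[OF y rk(2)]] rk(2)
      by (simp add: act_Cons)
    then have "r (k y) \<in> flat (r y)" by (rule nml_flat[OF G(2)[OF rG] y])
    then have "r y \<in> flat (h y)"
      using flat_sym[OF hY[OF rG y]] rk GI[OF rG] y by simp
    then have "dset (flat (h y)) y \<le> d y (r y)" using y by (intro dset_le[OF cc[OF h]]) auto
    also have "\<dots> \<le> c0" unfolding c0_def using rk R by (intro member_le_sum) auto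
    finally show "dset (flat (h y)) y \<le> c0" .
  qed
  moreover have "c0 \<ge> 0" unfolding c0_def by (intro sum_nonneg) auto
  ultimately have ne: "{c. c \<ge> 0 \<and> E c \<noteq> {}} \<noteq> {}" by blast
  \<comment> \<open>The circumradius of the family of flats. It need not be attained, so radii
    slightly above it are used.\<close>
  define R0 where "R0 = Inf {c. c \<ge> 0 \<and> E c \<noteq> {}}"
  have bdd: "bdd_below {c. c \<ge> 0 \<and> E c \<noteq> {}}" by (rule bdd_belowI[of _ 0]) auto
  have R0: "R0 \<ge> 0" unfolding R0_def using ne by (intro cInf_greatest) auto
  have R0_le: "R0 \<le> c" if "c \<ge> 0" "u \<in> E c" for c u
    unfolding R0_def using that bdd by (intro cInf_lower) auto
  have near: "\<exists>t\<in>vecs. d (g y) (act t y) < e" if e: "e > 0" for e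
  proof -
    \<comment> \<open>Makes c^2 - R0^2 at most e^2/32, which the midpoint estimate below turns into
      d(g p, q) < e/2.\<close>
    define z where "z = min 1 (e\<^sup>2 / (32 * (2 * R0 + 1)))"
    have z: "z > 0" "z \<le> 1" using e R0 by (auto simp: z_def)
    obtain c where c: "c \<ge> 0" "E c \<noteq> {}" "c < R0 + z"
      using cInf_lessD[OF ne, of "R0 + z"] z by (auto simp: R0_def)
    have cR: "R0 \<le> c" using R0_le c by blast
    have "c\<^sup>2 - R0\<^sup>2 = (c - R0) * (c + R0)" by (simp add: power2_eq_square algebra_simps)
    also have "\<dots> \<le> z * (2 * R0 + 1)" using c cR z R0 by (intro mult_mono) auto
    also have "\<dots> \<le> (e\<^sup>2 / (32 * (2 * R0 + 1))) * (2 * R0 + 1)"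
      using R0 by (intro mult_right_mono) (auto simp: z_def)
    also have "\<dots> = e\<^sup>2 / 32"
    proof -
      have cancel: "x / (32 * a) * a = x / 32" if "a \<noteq> 0" for x a :: real using that by simp
      have "2 * R0 + 1 \<noteq> 0" using R0 by simp
      then show ?thesis by (rule cancel)
    qed
    finally have cc2: "c\<^sup>2 - R0\<^sup>2 \<le> e\<^sup>2 / 32" .
    define p where "p = proj (E c) y"
    have p: "p \<in> E c" using proj_in[OF E_cc[OF c(2)]] y by (simp add: p_def)
    have pY: "p \<in> Y" using p by (simp add: E_iff)
    have pstar: "disp h p = disp h y" if "h \<in> G" for h
      unfolding p_def by (rule star[OF E_cc[OF c(2)] E_stable that])
    have gp: "g p \<in> E c" "g p \<in> Y" using E_step[OF g p] by (auto simp: E_iff)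
    define q where "q = proj (flat p) (g p)"
    have q: "q \<in> flat p" using proj_in[OF flat_ccset[OF pY]] gp by (simp add: q_def)
    have qY: "q \<in> Y" using flat_Y[OF pY q] .
    have q_dset: "dset (flat (h y)) q \<le> c" if h: "h \<in> G" for h
    proof (rule field_le_epsilon)
      fix e :: real assume "e > 0"
      then obtain t where t: "t \<in> vecs" "d q (act t p) < e" using flatE[OF q] by blast
      have "dset (flat (h y)) q \<le> dset (flat (h y)) (act t p) + d q (act t p)"
        using qY pY t by (intro dset_lipschitz[OF cc[OF h]]) auto
      also have "dset (flat (h y)) (act t p) \<le> c" using E_act[OF p t(1)] h by (simp add: E_iff)
      finally show "dset (flat (h y)) q \<le> c + e" using t by simp
    qed
    \<comment> \<open>If \<open>g p\<close> were far from the flat of \<open>p\<close>, the midpoint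
      between it and its foot \<open>q\<close> would be closer than \<open>R0\<close> to all flats
      of the orbit.\<close>
    define m where "m = pt (1/2) (g p) q"
    have mY: "m \<in> Y" unfolding m_def using gp qY by (intro Y_pt) auto
    have m_le: "(dset (flat (h y)) m)\<^sup>2 \<le> c\<^sup>2 - (d (g p) q)\<^sup>2 / 4" if h: "h \<in> G" for h
    proof -
      define s where "s = proj (flat (h y)) (g p)"
      have s: "s \<in> flat (h y)" using proj_in[OF cc[OF h]] gp by (simp add: s_def)
      have sY: "s \<in> Y" using flat_Y[OF hY[OF h y] s] .
      \<comment> \<open>The segments from \<open>g p\<close> to \<open>q\<close> and to
        \<open>s\<close> are both orthogonal to the flows, hence so is the one from \<open>q\<close>
        to \<open>s\<close> by the cocycle rule. Thus \<open>s\<close> is the foot of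
        \<open>q\<close> as well as of \<open>g p\<close>, and CN can be applied with this common
        foot.\<close>
      have "L t q s = 0" if t: "t \<in> vecs" for t
        using L_cocycle[OF qY gp(2) sY t] L_antisym[OF gp(2) qY t]
          L_proj_flat[OF gp(2) pY t] L_proj_flat[OF gp(2) hY[OF h y] t] by (simp add: q_def s_def)
      then have "dset (flat (h y)) q = d q s" by (rule dset_flat_eq[OF qY hY[OF h y] s])
      then have dq: "d s q \<le> c" using q_dset[OF h] by (simp add: commute)
      have dg: "d s (g p) \<le> c" using gp(1) h by (auto simp: E_iff dset_def s_def commute)
      have "dset (flat (h y)) m \<le> d s m" using dset_le[OF cc[OF h] _ s] mY by (simp add: commute)
      then have "(dset (flat (h y)) m)\<^sup>2 \<le> (d s m)\<^sup>2" by (intro power_mono) auto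
      also have "\<dots> \<le> (d s (g p))\<^sup>2 / 2 + (d s q)\<^sup>2 / 2 - (d (g p) q)\<^sup>2 / 4"
        unfolding m_def using gp qY sY by (intro CN_midpoint) auto
      also have "\<dots> \<le> c\<^sup>2 / 2 + c\<^sup>2 / 2 - (d (g p) q)\<^sup>2 / 4"
        using dq dg by (intro diff_right_mono add_mono divide_right_mono power_mono) auto
      finally show ?thesis by simp
    qed
    define c' where "c' = sqrt (c\<^sup>2 - (d (g p) q)\<^sup>2 / 4)"
    have nonneg: "0 \<le> c\<^sup>2 - (d (g p) q)\<^sup>2 / 4"
      using order_trans[OF zero_le_power2 m_le[OF g]] .
    have "m \<in> E c'"
      unfolding E_iff c'_def using mY m_le real_le_rsqrt by blast
    then have "R0 \<le> c'" using nonneg by (intro R0_le) (auto simp: c'_def)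
    then have "R0\<^sup>2 \<le> c\<^sup>2 - (d (g p) q)\<^sup>2 / 4"
      using power_mono[of R0 c' 2] R0 nonneg by (simp add: c'_def)
    then have "(d (g p) q)\<^sup>2 \<le> 4 * (e\<^sup>2 / 32)" using cc2 by linarith
    also have "\<dots> < (e / 2)\<^sup>2" using e by (simp add: power2_eq_square)
    finally have gq: "d (g p) q < e / 2" using e by (intro power2_less_imp_less[of "d (g p) q" "e / 2"]) auto
    obtain t where t: "t \<in> vecs" "d q (act t p) < e / 2" using flatE[OF q, of "e / 2"] e by auto
    have gY: "g y \<in> Y" using hY[OF g y] .
    \<comment> \<open>\<open>star\<close> applied to the elements inv(k) g preserves the distances
      from \<open>g p\<close> to \<open>k p\<close> for k in \<open>\<Delta>\<close>. These
      determine \<open>L\<close> on single generators, and linearity extends the equality to all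
      vectors.\<close>
    have L_eq: "L t (g p) p = L t (g y) y" if "t \<in> vecs" for t
      using that
    proof (induction t)
      case Nil
      show ?case using zero[of "g p" "g p"] zero[of "g y" "g y"] gp gY by (simp add: L_def D_def)
    next
      case (Cons x t)
      obtain k r where x: "x = (k, r)" by (cases x)
      have k: "k \<in> \<Delta>" and tv: "t \<in> vecs" using Cons.prems by (auto simp: x)
      have kG: "inv\<^bsub>IG\<^esub> k \<otimes>\<^bsub>IG\<^esub> g \<in> G"
        using subgroup.m_closed[OF G(1) subgroup.m_inv_closed[OF G(1)] g] k G(3) by blast
      have dk: "d (g v) (k v) = disp (inv\<^bsub>IG\<^esub> k \<otimes>\<^bsub>IG\<^esub> g) v" if v: "v \<in> Y" for v
        using iso_dist[of k "(inv\<^bsub>IG\<^esub> k) (g v)" v] k GI[OF g] v by (simp add: disp_def commute)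
      have "d (g p) (k p) = d (g y) (k y)" using dk pY y pstar[OF kG] by simp
      moreover have "d (g p) p = d (g y) y" using pstar[OF g] by (simp add: disp_def commute)
      moreover have "act [(k, 1)] v = k v" if "v \<in> Y" for v
        using flow_1[OF \<Delta>_iso[OF k] Y_minp[OF that k]] by (simp add: act_Cons)
      ultimately have "L [(k, 1)] (g p) p = L [(k, 1)] (g y) y"
        using D_base[of "[(k, 1)]" "g p" "g y"] k gp gY pY y by (simp add: L_def)
      then have "L (sc r [(k, 1)]) (g p) p = L (sc r [(k, 1)]) (g y) y"
        using L_sc[OF gp(2) pY, of "[(k, 1)]" r] L_sc[OF gY y, of "[(k, 1)]" r] k by simp
      then have 1: "L [x] (g p) p = L [x] (g y) y" by (simp add: x)
      show ?case
        using L_append[OF gp(2) pY, of "[x]" t] L_append[OF gY y, of "[x]" t] 1 Cons.IH[OF tv] k tv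
        by (simp add: x)
    qed
    have "(d (g y) (act t y))\<^sup>2 = (d (g p) (act t p))\<^sup>2"
      using L_eq[OF t(1)] D_base[OF t(1) gp(2) gY] pstar[OF g] by (simp add: L_def disp_def commute)
    then have "d (g y) (act t y) = d (g p) (act t p)" by simp
    also have "\<dots> < e" using triangle[of "g p" q "act t p"] gp qY pY t gq by simp
    finally show ?thesis using t by blast
  qed
  then show ?thesis using hY[OF g y] by (simp add: flat_def)
qed

text \<open>\<open>F\<close> fixes a point \<open>q\<close> of the flat of \<open>y\<close>.
  Relative to \<open>q\<close> the elements of \<open>F\<close> act linearly on vectors, so a
  dilation from \<open>q\<close> by 1 + r multiplies their displacements by 1 + r. As the flat is a
  closure, \<open>y\<close> is only approximated by a translate of \<open>q\<close>, which costs
  \<open>e\<close>.\<close>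

lemma radial_growth:
  assumes F: "subgroup F IG" "finite F" "\<And>a. a \<in> F \<Longrightarrow> nml a" and y: "y \<in> Y"
    and Fy: "\<And>a. a \<in> F \<Longrightarrow> a y \<in> flat y"
  shows "\<exists>K\<ge>0. \<forall>r\<ge>0. \<forall>e>0.
    \<exists>t\<in>vecs. D y t \<le> K \<and> (\<forall>a\<in>F. (1 + r) * disp a y - e \<le> disp a (act (sc r t) y))"
proof -
  have st: "a p \<in> flat y" if a: "a \<in> F" and p: "p \<in> flat y" for a p
    using flat_trans[OF y Fy[OF a] nml_flat[OF F(3)[OF a] y p]] .
  have "stable a (flat y)" if "a \<in> F" for a
    unfolding stable_def using st[OF that] st[OF subgroup.m_inv_closed[OF F(1) that]] by blast
  then obtain q where q: "q \<in> flat y" "\<And>a. a \<in> F \<Longrightarrow> a q = q"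
    using finite_group_fixed_point[OF F(1,2) flat_ccset[OF y]] by metis
  have qY: "q \<in> Y" using flat_Y[OF y q(1)] .
  have yq: "y \<in> flat q" using flat_sym[OF y q(1)] .
  show ?thesis
  proof (intro exI[of _ "d q y + 1"] conjI allI impI)
    fix r e :: real assume r: "r \<ge> 0" and e: "e > 0"
    \<comment> \<open>Replacing \<open>y\<close> by \<open>z\<close> costs 2 e' before and 2 e'
      after the dilation; the former is multiplied by 1 + r, which makes (4 + 2 r) e' in
      total.\<close>
    define e' where "e' = min 1 (e / (4 + 2 * r))"
    have e': "e' > 0" "e' \<le> 1" using e r by (auto simp: e'_def)
    have e'2: "(4 + 2 * r) * e' \<le> e"
      using mult_left_mono[of e' "e / (4 + 2 * r)" "4 + 2 * r"] r by (simp add: e'_def)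
    obtain t where t: "t \<in> vecs" "d y (act t q) < e'" using flatE[OF yq e'(1)] .
    define z where "z = act t q"
    have z: "z \<in> Y" using t qY by (simp add: z_def)
    have "D y t = D q t" using D_base[OF t(1) y qY] .
    also have "\<dots> \<le> d q y + 1"
      using triangle[of q y z] t e' y qY z by (simp add: D_def z_def)
    finally have 1: "D y t \<le> d q y + 1" .
    have 2: "(1 + r) * disp a y - e \<le> disp a (act (sc r t) y)" if a: "a \<in> F" for a
    proof -
      have an: "nml a" "iso a" using F(3)[OF a] by auto
      have az: "a z = act (cj a t) q" using nml_act[OF an(1) qY t(1)] q(2)[OF a] by (simp add: z_def)
      have "act (sc r t) z = act (sc (1 + r) t) q"
        using act_sc_add[OF t(1) qY, of r 1] by (simp add: z_def add.commute)
      moreover have "a (act (sc (1 + r) t) q) = act (sc (1 + r) (cj a t)) q"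
        using nml_act[OF an(1) qY, of "sc (1 + r) t"] q(2)[OF a] t by simp
      ultimately have "disp a (act (sc r t) z) = d (act (sc (1 + r) t) q) (act (sc (1 + r) (cj a t)) q)"
        by (simp add: disp_def)
      also have "\<dots> = D q (sc (1 + r) (t @ sc (-1) (cj a t)))"
        using D_diff[of "sc (1 + r) t" "sc (1 + r) (cj a t)" q] t an qY by simp
      also have "\<dots> = (1 + r) * D q (t @ sc (-1) (cj a t))"
        using D_sc[of "t @ sc (-1) (cj a t)" q "1 + r"] t an qY r by (simp del: sc_append)
      also have "D q (t @ sc (-1) (cj a t)) = disp a z"
        using D_diff[of t "cj a t" q] t an qY az by (simp add: disp_def z_def)
      finally have e1: "disp a (act (sc r t) z) = (1 + r) * disp a z" .
      have "disp a y \<le> disp a z + 2 * e'"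
        using disp_lipschitz[OF an(2), of y z] t y z by (simp add: z_def)
      then have "(1 + r) * disp a y \<le> (1 + r) * (disp a z + 2 * e')" using r by (intro mult_left_mono) auto
      moreover have "disp a (act (sc r t) z) \<le> disp a (act (sc r t) y) + 2 * e'"
        using disp_lipschitz[OF an(2), of "act (sc r t) z" "act (sc r t) y"] t y z
        by (simp add: commute z_def[symmetric])
      moreover have "(1 + r) * (disp a z + 2 * e') + 2 * e' = (1 + r) * disp a z + (4 + 2 * r) * e'"
        by (simp add: algebra_simps)
      ultimately show ?thesis using e'2 e1 by linarith
    qed
    show "\<exists>t\<in>vecs. D y t \<le> d q y + 1 \<and> (\<forall>a\<in>F. (1 + r) * disp a y - e \<le> disp a (act (sc r t) y))"
      using t 1 2 by blast
  qed simp
qed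

text \<open>The length of w t - t for the linear action \<open>cj\<close>. By
  \<open>disp_min_on_flat\<close> it measures how the displacement of \<open>w\<close> grows from a
  minimum in the direction \<open>t\<close>.\<close>

definition pw :: "('a \<Rightarrow> 'a) \<Rightarrow> 'a \<Rightarrow> (('a \<Rightarrow> 'a) \<times> real) list \<Rightarrow> real" where
  "pw w y t = D y (cj w t @ sc (-1) t)"

lemma disp_act:
  assumes w: "nml w" and y: "y \<in> Y" and t: "t \<in> vecs"
  shows "disp w (act t y) = d y (act (cj w t @ sc (-1) t) (w y))"
proof -
  have wy: "w y \<in> Y" using w y by simp
  have "disp w (act t y) = d (act (sc (-1) t) (act t y)) (act (sc (-1) t) (act (cj w t) (w y)))"
    using w y t wy nml_act[OF w y t] by (simp add: disp_def)
  also have "act (sc (-1) t) (act (cj w t) (w y)) = act (cj w t) (act (sc (-1) t) (w y))"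
    by (rule act_commute) (use w t wy in auto)
  finally show ?thesis using act_neg(1)[OF t y] by (simp add: act_append)
qed

text \<open>Along the line through \<open>y\<close> in direction \<open>t\<close> the displacement
  is least at \<open>y\<close>, so the first variation \<open>L\<close> vanishes and the quadratic
  term remains.\<close>

lemma disp_min_on_flat:
  assumes w: "nml w" and y: "y \<in> Y" "disp w y = tl w" and t: "t \<in> vecs"
  shows "(disp w (act t y))\<^sup>2 = (tl w)\<^sup>2 + (pw w y t)\<^sup>2"
proof -
  define e where "e = cj w t @ sc (-1) t"
  have e: "e \<in> vecs" using w t by (simp add: e_def)
  have wy: "w y \<in> Y" using w y by simp
  have "L e y (w y) = 0"
  proof (rule L_zero_if_minimal[OF y(1) wy e])
    fix c
    have "tl w \<le> disp w (act (sc c t) y)" using t y by (intro tl_le) simp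
    also have "\<dots> = d y (act (sc c e) (w y))"
      using disp_act[OF w y(1), of "sc c t"] t by (simp add: e_def)
    finally show "d y (w y) \<le> d y (act (sc c e) (w y))" using y by (simp add: disp_def)
  qed
  then show ?thesis
    using disp_act[OF w y(1) t] dist_act_sc[OF y(1) wy e, of 1] y by (simp add: e_def pw_def disp_def)
qed

lemma pw_nonneg [simp]: "0 \<le> pw w y t" by (simp add: pw_def)

lemma pw_sc: "nml w \<Longrightarrow> y \<in> Y \<Longrightarrow> t \<in> vecs \<Longrightarrow> pw w y (sc c t) = \<bar>c\<bar> * pw w y t"
  using D_sc[of "cj w t @ sc (-1) t" y c] by (simp add: pw_def)

lemma D_append_ge:
  assumes "a \<in> vecs" "b \<in> vecs" "u \<in> Y"
  shows "D u a \<le> D u (a @ b) + D u b" "D u b \<le> D u (a @ b) + D u a"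
proof -
  have *: "D u a \<le> D u (a @ b) + D u b" if "a \<in> vecs" "b \<in> vecs" for a b
    using triangle[of u "act a (act b u)" "act a u"] that assms(3) act_dist[OF that(1), of "act b u" u]
    by (simp add: D_def act_append commute)
  show "D u a \<le> D u (a @ b) + D u b" using * assms by blast
  show "D u b \<le> D u (a @ b) + D u a"
    using *[of b a] act_commute[of a b u] assms by (simp add: D_def act_append)
qed

lemma pw_append:
  assumes w: "nml w" and y: "y \<in> Y" and s: "s \<in> vecs" and t: "t \<in> vecs"
  shows "pw w y s \<le> pw w y (s @ t) + pw w y t" "pw w y t \<le> pw w y (s @ t) + pw w y s"
proof -
  have "act (cj w (s @ t) @ sc (-1) (s @ t)) y = act (cj w s) (act (cj w t) (act (sc (-1) s) (act (sc (-1) t) y)))"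
    by (simp add: act_append)
  also have "\<dots> = act (cj w s) (act (sc (-1) s) (act (cj w t) (act (sc (-1) t) y)))"
    by (subst act_commute[of "cj w t" "sc (-1) s"]) (use w y s t in auto)
  finally have "pw w y (s @ t) = D y ((cj w s @ sc (-1) s) @ (cj w t @ sc (-1) t))"
    by (simp add: pw_def D_def act_append)
  then show "pw w y s \<le> pw w y (s @ t) + pw w y t" "pw w y t \<le> pw w y (s @ t) + pw w y s"
    using D_append_ge[of "cj w s @ sc (-1) s" "cj w t @ sc (-1) t" y] w y s t by (auto simp: pw_def)
qed

lemma small_multiple:
  fixes K c :: "'i \<Rightarrow> real"
  assumes "finite W" "\<And>w. w \<in> W \<Longrightarrow> 0 < c w"
  shows "\<exists>e>0. \<forall>w\<in>W. e * K w < c w"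
proof -
  have "\<forall>\<^sub>F e in at_right 0. \<forall>w\<in>W. e * K w < c w"
  proof (intro eventually_ball_finite[OF assms(1)] ballI)
    fix w assume w: "w \<in> W"
    have "((\<lambda>e. e * K w) \<longlongrightarrow> 0 * K w) (at_right 0)" by (intro tendsto_intros)
    then show "\<forall>\<^sub>F e in at_right 0. e * K w < c w" using assms(2)[OF w] by (intro order_tendstoD(2)) auto
  qed
  moreover have "\<forall>\<^sub>F e in at_right (0::real). 0 < e" by (simp add: eventually_at_right_less)
  ultimately have "\<forall>\<^sub>F e in at_right 0. 0 < e \<and> (\<forall>w\<in>W. e * K w < c w)" by eventually_elim blast
  then show ?thesis using eventually_happens'[of "at_right (0::real)"] by fastforce
qed

text \<open>Finitely many proper subspaces, the kernels of the maps t \<mapsto> w t - t, cannot fill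
  a neighbourhood. If the vector found so far ends in the kernel of a new \<open>w\<close>, a
  multiple of a vector outside that kernel is added, small enough not to spoil the elements already
  treated.\<close>

lemma generic_perturbation:
  assumes "finite W" and W: "\<And>w. w \<in> W \<Longrightarrow> nml w" "\<And>w. w \<in> W \<Longrightarrow> \<exists>t\<in>vecs. pw w y t > 0"
    and y: "y \<in> Y" and t0: "t0 \<in> vecs"
  shows "h > 0 \<Longrightarrow> \<exists>e\<in>vecs. D y e < h \<and> (\<forall>w\<in>W. pw w y (t0 @ e) > 0)"
  using assms(1) W
proof (induction W arbitrary: h rule: finite_induct)
  case empty
  have "D y [] < h" using empty y by (simp add: D_def)
  then show ?case by (intro bexI[of _ "[]"]) auto
next
  case (insert w W)
  obtain e where e: "e \<in> vecs" "D y e < h / 2" "\<forall>w\<in>W. pw w y (t0 @ e) > 0"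
    using insert.IH[of "h / 2"] insert.prems by auto
  have w: "nml w" using insert.prems by auto
  have Wn: "nml w'" if "w' \<in> W" for w' using insert.prems that by auto
  show ?case
  proof (cases "pw w y (t0 @ e) > 0")
    case True
    then show ?thesis using e insert.prems(1) by (intro bexI[of _ e]) auto
  next
    case False
    obtain t where t: "t \<in> vecs" "pw w y t > 0" using insert.prems by auto
    obtain q where q: "q > 0" "\<forall>w'\<in>W. q * pw w' y t < pw w' y (t0 @ e)"
      using small_multiple[of W "\<lambda>w'. pw w' y (t0 @ e)" "\<lambda>w'. pw w' y t"] insert.hyps e by blast
    define r where "r = min q (h / (4 * (D y t + 1)))"
    have Dt: "D y t + 1 > 0" using D_nonneg[of y t] by linarith
    have r: "r > 0" using q insert.prems Dt by (simp add: r_def)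
    have rD: "D y (sc r t) < h / 2"
    proof -
      have "D y (sc r t) = r * D y t" using D_sc[OF t(1) y, of r] r by simp
      also have "\<dots> \<le> (h / (4 * (D y t + 1))) * (D y t + 1)"
        using r insert.prems Dt by (intro mult_mono) (auto simp: r_def)
      also have "\<dots> = h / 4" using Dt by (simp add: field_simps)
      finally show ?thesis using insert.prems by simp
    qed
    have "D y (e @ sc r t) < h" using D_append[of e "sc r t" y] e t y rD by simp
    moreover have "pw w' y (t0 @ (e @ sc r t)) > 0" if w': "w' \<in> insert w W" for w'
    proof -
      have n: "nml w'" using w' w Wn by auto
      have sct: "pw w' y (sc r t) = r * pw w' y t" using pw_sc[OF n y t(1), of r] r by simp
      note ap = pw_append[OF n y, of "t0 @ e" "sc r t"]
      show ?thesis
      proof (cases "w' \<in> W")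
        case True
        have "r * pw w' y t \<le> q * pw w' y t" by (intro mult_right_mono) (auto simp: r_def)
        then have "pw w' y (sc r t) < pw w' y (t0 @ e)" using q True sct by force
        then show ?thesis using ap(1) e t t0 by simp
      next
        case False
        then have "w' = w" using w' by simp
        then have "pw w' y (sc r t) > 0" "pw w' y (t0 @ e) = 0"
          using sct t r \<open>\<not> pw w y (t0 @ e) > 0\<close> pw_nonneg[of w y "t0 @ e"] by auto
        then show ?thesis using ap(2) e t t0 by simp
      qed
    qed
    ultimately show ?thesis using e t by (intro bexI[of _ "e @ sc r t"]) auto
  qed
qed

end

subsection \<open>Words and potentials\<close>

lemma const_subseq_finite:
  fixes f :: "nat \<Rightarrow> 'b"
  assumes "finite A" "\<And>n. f n \<in> A"
  shows "\<exists>r c. strict_mono (r :: nat \<Rightarrow> nat) \<and> (\<forall>n. f (r n) = c) \<and> c \<in> A"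
proof -
  have "infinite (UNIV :: nat set)" by simp
  moreover have "finite (f ` UNIV)" using assms by (intro finite_subset[of "f ` UNIV" A]) auto
  ultimately obtain a where "infinite {n \<in> UNIV. f n = f a}" using pigeonhole_infinite by blast
  then obtain r :: "nat \<Rightarrow> nat" where r: "strict_mono r" "\<And>n. r n \<in> {n \<in> UNIV. f n = f a}"
    using infinite_enumerate by blast
  then show ?thesis using assms(2)[of a] by (intro exI[of _ r] exI[of _ "f a"]) auto
qed

context group
begin

definition word :: "'a list \<Rightarrow> 'a" where "word ws = foldr (\<otimes>) ws \<one>"

lemma word_Nil [simp]: "word [] = \<one>" by (simp add: word_def)

lemma word_Cons [simp]: "word (x # xs) = x \<otimes> word xs" by (simp add: word_def)

lemma word_closed [simp]: "set xs \<subseteq> carrier G \<Longrightarrow> word xs \<in> carrier G"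
  by (induction xs) auto

lemma word_append: "set xs \<subseteq> carrier G \<Longrightarrow> set ys \<subseteq> carrier G \<Longrightarrow> word (xs @ ys) = word xs \<otimes> word ys"
  by (induction xs) (auto simp: m_assoc)

lemma word_replicate_one: "word (replicate n \<one>) = \<one>"
  by (induction n) auto

lemma word_subgroup: "subgroup H G \<Longrightarrow> set xs \<subseteq> H \<Longrightarrow> word xs \<in> H"
  by (induction xs) (auto intro: subgroup.one_closed subgroup.m_closed)

lemma generate_word:
  assumes S: "S \<subseteq> carrier G" "\<And>s. s \<in> S \<Longrightarrow> inv s \<in> S" and g: "g \<in> generate G S"
  obtains ws where "set ws \<subseteq> S" "word ws = g"
  using g
proof (induction arbitrary: thesis rule: generate.induct)
  case one
  show ?case by (rule one[of "[]"]) auto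
next
  case (incl h)
  show ?case by (rule incl(2)[of "[h]"]) (use incl S in auto)
next
  case (inv h)
  show ?case by (rule inv(2)[of "[inv h]"]) (use inv S in auto)
next
  case (eng h1 h2)
  obtain w1 where w1: "set w1 \<subseteq> S" "word w1 = h1" using eng.IH(1) by blast
  obtain w2 where w2: "set w2 \<subseteq> S" "word w2 = h2" using eng.IH(2) by blast
  have "word (w1 @ w2) = h1 \<otimes> h2" using word_append[of w1 w2] w1 w2 S by auto
  then show ?case using eng.prems[of "w1 @ w2"] w1 w2 by auto
qed

lemma word_inv:
  assumes S: "S \<subseteq> carrier G" "\<And>s. s \<in> S \<Longrightarrow> inv s \<in> S"
  shows "set ws \<subseteq> S \<Longrightarrow> \<exists>vs. set vs \<subseteq> S \<and> length vs = length ws \<and> word vs = inv (word ws)"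
proof (induction ws)
  case (Cons x ws)
  obtain vs where vs: "set vs \<subseteq> S" "length vs = length ws" "word vs = inv (word ws)" using Cons by auto
  have cl: "set vs \<subseteq> carrier G" "x \<in> carrier G" "word ws \<in> carrier G" using vs Cons.prems S by auto
  have "word (vs @ [inv x]) = word vs \<otimes> word [inv x]" by (rule word_append) (use cl in auto)
  also have "\<dots> = word vs \<otimes> inv x" using cl by simp
  also have "\<dots> = inv (word (x # ws))" unfolding vs(3) word_Cons by (rule inv_mult_group[OF cl(2,3), symmetric])
  finally have "word (vs @ [inv x]) = inv (word (x # ws))" .
  then show ?case using vs S Cons.prems by (intro exI[of _ "vs @ [inv x]"]) auto
qed auto

text \<open>A weak form of Schreier's lemma: the elements of \<open>S\<close> reach every coset that they reach at all by
  words of length less than the number of cosets.\<close>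

lemma finite_if_short_words_avoid:
  assumes S: "S \<subseteq> carrier G" "\<And>s. s \<in> S \<Longrightarrow> inv s \<in> S" "\<one> \<in> S" "finite S"
    and C: "finite C" "card C \<le> N" "N \<ge> 1" "\<And>a. a \<in> generate G S \<Longrightarrow> \<kappa> a \<in> C"
    and K: "\<And>a b. a \<in> generate G S \<Longrightarrow> b \<in> generate G S \<Longrightarrow> \<kappa> a = \<kappa> b \<Longrightarrow> a \<otimes> inv b \<in> K"
    and short: "\<And>ws. set ws \<subseteq> S \<Longrightarrow> length ws \<le> 2 * N - 1 \<Longrightarrow> word ws \<in> K \<Longrightarrow> word ws = \<one>"
  shows "finite (generate G S)"
proof -
  \<comment> \<open>Words of length exactly k; as \<one> is a letter, these sets increase with
    k.\<close>
  define B where "B k = {word ws |ws. length ws = k \<and> set ws \<subseteq> S}" for k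
  have B_gen: "B k \<subseteq> generate G S" for k
  proof
    fix a assume "a \<in> B k"
    then obtain ws where ws: "a = word ws" "set ws \<subseteq> S" by (auto simp: B_def)
    have "set ws \<subseteq> generate G S" using ws generate.incl by (meson subset_eq)
    then show "a \<in> generate G S" unfolding ws(1) by (rule word_subgroup[OF generate_is_subgroup[OF S(1)]])
  qed
  have B_mono: "B k \<subseteq> B (Suc k)" for k
  proof
    fix a assume "a \<in> B k"
    then obtain ws where ws: "a = word ws" "set ws \<subseteq> S" "length ws = k" by (auto simp: B_def)
    have "word (\<one> # ws) = a" using ws S word_closed[of ws] by auto
    then show "a \<in> B (Suc k)" unfolding B_def using ws S by (intro CollectI exI[of _ "\<one> # ws"]) auto
  qed
  have B_fin: "finite (B k)" for k
  proof -
    have "B k = word ` {ws. set ws \<subseteq> S \<and> length ws = k}" by (auto simp: B_def)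
    then show ?thesis using finite_lists_length_eq[OF S(4)] by simp
  qed
  \<comment> \<open>The sets of cosets reached are nonempty with at most \<open>N\<close> elements,
    so they cannot grow strictly \<open>N\<close> times.\<close>
  have "\<exists>k<N. \<kappa> ` B (Suc k) = \<kappa> ` B k"
  proof (rule ccontr)
    assume no: "\<not> ?thesis"
    have "k \<le> N \<Longrightarrow> Suc k \<le> card (\<kappa> ` B k)" for k
    proof (induction k)
      case 0
      have "B 0 \<noteq> {}" by (auto simp: B_def)
      then show ?case using B_fin[of 0] by (simp add: Suc_le_eq card_gt_0_iff)
    next
      case (Suc k)
      have "\<kappa> ` B (Suc k) \<noteq> \<kappa> ` B k" using no Suc.prems by (simp add: Suc_le_eq)
      then have "\<kappa> ` B k \<subset> \<kappa> ` B (Suc k)" by (rule psubsetI[OF image_mono[OF B_mono] not_sym])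
      then have "card (\<kappa> ` B k) < card (\<kappa> ` B (Suc k))" using B_fin by (intro psubset_card_mono) auto
      then show ?case using Suc by simp
    qed
    moreover have "card (\<kappa> ` B N) \<le> card C" using C(1,4) B_gen[of N] by (intro card_mono) auto
    ultimately show False using C(2) by fastforce
  qed
  then obtain k where k: "k < N" "\<kappa> ` B (Suc k) = \<kappa> ` B k" by blast
  have Bk: "B (Suc k) \<subseteq> B k"
  proof
    fix a assume a: "a \<in> B (Suc k)"
    then have "\<kappa> a \<in> \<kappa> ` B k" unfolding k(2)[symmetric] by (rule imageI)
    then obtain b where b: "b \<in> B k" "\<kappa> a = \<kappa> b" by (elim imageE)
    obtain u where u: "a = word u" "length u = Suc k" "set u \<subseteq> S" using a by (auto simp: B_def)
    obtain v where v: "b = word v" "length v = k" "set v \<subseteq> S" using b by (auto simp: B_def)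
    obtain v' where v': "set v' \<subseteq> S" "length v' = k" "word v' = inv b" using word_inv[OF S(1,2) v(3)] v by auto
    have cl: "a \<in> carrier G" "b \<in> carrier G" using u v S by auto
    have w: "word (u @ v') = a \<otimes> inv b" using word_append[of u v'] u v' S by auto
    have "word (u @ v') \<in> K" unfolding w using a b B_gen by (intro K) auto
    \<comment> \<open>The word has length (k + 1) + k \<le> 2 N - 1 because k < N. This is the
      origin of the factor 2 I_0 - 1.\<close>
    then have "a \<otimes> inv b = \<one>" using short[of "u @ v'"] u v' k w by auto
    then have "a \<otimes> inv b \<otimes> b = b" using cl by simp
    then have "a = b" using cl by (simp add: m_assoc)
    then show "a \<in> B k" using b by simp
  qed
  have "B m \<subseteq> B k" if "m \<ge> k" for m
    using that
  proof (induction rule: dec_induct)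
    case (step m)
    show ?case
    proof
      fix a assume "a \<in> B (Suc m)"
      then obtain ws where ws: "a = word ws" "length ws = Suc m" "set ws \<subseteq> S" by (auto simp: B_def)
      then obtain x xs where x: "ws = x # xs" by (cases ws) auto
      have "word xs \<in> B m" using ws x by (auto simp: B_def)
      then obtain ys where ys: "word xs = word ys" "length ys = k" "set ys \<subseteq> S" using step.IH by (auto simp: B_def)
      have "a = word (x # ys)" using ws x ys by simp
      then have "a \<in> B (Suc k)" unfolding B_def using ws x ys by (intro CollectI exI[of _ "x # ys"]) auto
      then show "a \<in> B k" using Bk by blast
    qed
  qed simp
  then have B_le: "B m \<subseteq> B k" for m using lift_Suc_mono_le[of B, OF B_mono] by (cases "m \<ge> k") auto
  have "generate G S \<subseteq> B k"
  proof
    fix g assume "g \<in> generate G S"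
    then obtain ws where "set ws \<subseteq> S" "word ws = g" using generate_word[OF S(1,2)] by blast
    then have "g \<in> B (length ws)" by (auto simp: B_def)
    then show "g \<in> B k" using B_le by blast
  qed
  then show ?thesis using B_fin finite_subset by blast
qed

end

text \<open>\<open>\<mu>\<close> bounds the translation lengths in \<open>U\<close>,
  \<open>\<tau>\<close> the letters generating \<open>G\<close>, \<open>s\<^sub>1\<close> is the
  threshold of the first potential, and \<open>\<delta>\<close> the thickness at which minimizers
  are sought. The bound on the diastole is kept out of the locale; it reaches
  \<open>crit_impossible\<close> as a statement about one point.\<close>

locale thin_group = complete_CAT0 +
  fixes \<Gamma> :: "('a \<Rightarrow> 'a) set" and s\<^sub>1 \<mu> \<tau> \<delta> :: real
  assumes gc: "geodesically_complete M d"
    and \<Gamma>: "subgroup \<Gamma> (isom_group M d)"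
    and disc: "discrete_group M d \<Gamma>"
    and coc: "almost_cocompact M d \<Gamma>"
    and pos: "0 < \<delta>" "\<delta> \<le> s\<^sub>1" "s\<^sub>1 \<le> \<mu>" "\<mu> < \<tau>"
begin

definition \<Gamma>s :: "('a \<Rightarrow> 'a) set" where "\<Gamma>s = \<Gamma> - {\<one>\<^bsub>IG\<^esub>}"

lemma \<Gamma>_iso: "g \<in> \<Gamma> \<Longrightarrow> iso g"
  using subgroup.subset[OF \<Gamma>] by blast

lemma \<Gamma>s_\<Gamma>: "g \<in> \<Gamma>s \<Longrightarrow> g \<in> \<Gamma>" by (simp add: \<Gamma>s_def)

lemma \<Gamma>s_iso: "g \<in> \<Gamma>s \<Longrightarrow> iso g" by (simp add: \<Gamma>s_def \<Gamma>_iso)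

lemmas \<Gamma>_closed = subgroup.m_closed[OF \<Gamma>] subgroup.m_inv_closed[OF \<Gamma>] subgroup.one_closed[OF \<Gamma>]

lemma \<Gamma>s_conj: "h \<in> \<Gamma> \<Longrightarrow> g \<in> \<Gamma>s \<Longrightarrow> h \<otimes>\<^bsub>IG\<^esub> g \<otimes>\<^bsub>IG\<^esub> inv\<^bsub>IG\<^esub> h \<in> \<Gamma>s"
proof -
  assume h: "h \<in> \<Gamma>" and g: "g \<in> \<Gamma>s"
  have hg: "iso h" "iso g" using h g \<Gamma>_iso \<Gamma>s_iso by auto
  have "g = \<one>\<^bsub>IG\<^esub>" if "h \<otimes>\<^bsub>IG\<^esub> g \<otimes>\<^bsub>IG\<^esub> inv\<^bsub>IG\<^esub> h = \<one>\<^bsub>IG\<^esub>"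
  proof (rule iso_eqI)
    fix x assume x: "x \<in> M"
    have "(h \<otimes>\<^bsub>IG\<^esub> g \<otimes>\<^bsub>IG\<^esub> inv\<^bsub>IG\<^esub> h) (h x) = h x" using that x hg by simp
    then have "h (g x) = h x" using hg x by simp
    then have "(inv\<^bsub>IG\<^esub> h) (h (g x)) = (inv\<^bsub>IG\<^esub> h) (h x)" by simp
    then show "g x = \<one>\<^bsub>IG\<^esub> x" using hg x by simp
  qed (use hg in auto)
  moreover have "h \<otimes>\<^bsub>IG\<^esub> g \<otimes>\<^bsub>IG\<^esub> inv\<^bsub>IG\<^esub> h \<in> \<Gamma>"
    by (intro \<Gamma>_closed h \<Gamma>s_\<Gamma>[OF g])
  ultimately show ?thesis using g by (auto simp: \<Gamma>s_def)
qed

lemma finite_disp: assumes "x \<in> M" shows "finite {g \<in> \<Gamma>. disp g x < c}"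
proof (cases "c \<ge> 0")
  case True
  then show ?thesis using disc assms by (auto simp: discrete_group_def disp_def)
next
  case False
  then have "\<not> disp g x < c" for g using disp_nonneg[of g x] by linarith
  then show ?thesis by simp
qed

lemma disp_conj': "h \<in> \<Gamma> \<Longrightarrow> g \<in> \<Gamma> \<Longrightarrow> x \<in> M \<Longrightarrow> disp (inv\<^bsub>IG\<^esub> h \<otimes>\<^bsub>IG\<^esub> g \<otimes>\<^bsub>IG\<^esub> h) x = disp g (h x)"
  using disp_conj[of "inv\<^bsub>IG\<^esub> h" g x] \<Gamma>_iso[of h] \<Gamma>_iso[of g] by simp

definition thick :: "real \<Rightarrow> 'a set" where
  "thick c = {x \<in> M. \<forall>g\<in>\<Gamma>s. c \<le> disp g x}"

lemma thick_compact:
  assumes c: "c > 0" and x: "\<And>n. x n \<in> thick c"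
  shows "\<exists>r g k l. strict_mono (r :: nat \<Rightarrow> nat) \<and> (\<forall>n. g n \<in> \<Gamma>) \<and> (\<forall>n. k n \<in> M) \<and>
    (\<forall>n. x n = g n (k n)) \<and> conv (k \<circ> r) l"
proof -
  have "cocompact_on M d \<Gamma> (Thick M d \<Gamma> c)" using coc c by (simp add: almost_cocompact_def)
  then obtain K where K: "compactin mtopology K" "Thick M d \<Gamma> c = (\<Union>g\<in>\<Gamma>. g ` K)" "K \<subseteq> Thick M d \<Gamma> c"
    by (auto simp: cocompact_on_def)
  have "x n \<in> Thick M d \<Gamma> c" for n
    using x[of n] unfolding Thick_def thick_def sys_def nontrivial_def \<Gamma>s_def disp_def
    by (auto intro!: INF_greatest)
  then have "\<exists>g k. g \<in> \<Gamma> \<and> k \<in> K \<and> x n = g k" for n using K by blast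
  then obtain g k where gk: "\<And>n. g n \<in> \<Gamma>" "\<And>n. k n \<in> K" "\<And>n. x n = g n (k n)" by metis
  have "range k \<subseteq> K" using gk by auto
  then obtain l r where lr: "l \<in> K" "strict_mono r" "limitin mtopology (k \<circ> r) l sequentially"
    using K(1) unfolding compactin_sequentially by meson
  have KM: "K \<subseteq> M" using K by (auto simp: Thick_def)
  have "conv (k \<circ> r) l" using lr(3) gk KM by (auto simp: limitin_metric_dist_null conv_def)
  then show ?thesis
    using gk lr(2) KM by (intro exI[of _ r] exI[of _ g] exI[of _ k] exI[of _ l] conjI allI) auto
qed

text \<open>Almost-cocompactness gives convergence after moving by elements of
  \<open>\<Gamma>\<close>. Boundedness confines these elements to a finite set by discreteness, so
  they are constant on a subsequence.\<close>

lemma thick_bounded_compact: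
  assumes c: "c > 0" and x: "\<And>n. x n \<in> thick c" and y: "y \<in> M" "\<And>n. d (x n) y \<le> B"
  shows "\<exists>r l. strict_mono (r :: nat \<Rightarrow> nat) \<and> conv (x \<circ> r) l"
proof -
  obtain r g k l where *: "strict_mono (r :: nat \<Rightarrow> nat)" "\<forall>n. g n \<in> \<Gamma>" "\<forall>n. k n \<in> M"
    "\<forall>n. x n = g n (k n)" "conv (k \<circ> r) l" using thick_compact[of c x, OF c x]
    by (elim exE conjE) (rule that; assumption)
  have l: "l \<in> M" using *(5) by (simp add: conv_def)
  have "Bseq (\<lambda>n. d (k (r n)) l)" using *(5) by (intro convergent_imp_Bseq) (auto simp: conv_def convergent_def)
  then obtain C where C: "\<And>n. d (k (r n)) l \<le> C" by (auto simp: Bseq_def)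
  define H where "H = {h \<in> \<Gamma>. disp h l < d l y + B + C + 1}"
  have H: "finite H" unfolding H_def by (rule finite_disp[OF l])
  have mem: "g (r n) \<in> H" for n
  proof -
    have gi: "iso (g (r n))" using * \<Gamma>_iso by auto
    have "d l (g (r n) l) \<le> d l y + d y (g (r n) l)" using l y gi by (intro triangle) auto
    also have "d y (g (r n) l) \<le> d y (x (r n)) + d (x (r n)) (g (r n) l)"
      using l y gi *(3,4) by (intro triangle) auto
    also have "d (x (r n)) (g (r n) l) = d (k (r n)) l" using gi *(3,4) l by simp
    finally show ?thesis using C[of n] y(2)[of "r n"] *(2) by (simp add: H_def disp_def commute)
  qed
  have "\<exists>q c. strict_mono (q :: nat \<Rightarrow> nat) \<and> (\<forall>n. g (r (q n)) = c) \<and> c \<in> H"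
    using const_subseq_finite[of H "\<lambda>n. g (r n)", OF H mem] .
  then obtain q h where q: "strict_mono (q :: nat \<Rightarrow> nat)" "\<forall>n. g (r (q n)) = h" "h \<in> H"
    by (elim exE conjE) (rule that; assumption)
  have "conv ((k \<circ> r) \<circ> q) l" by (rule conv_subseq[OF *(5) q(1)])
  then have "conv (\<lambda>n. h (((k \<circ> r) \<circ> q) n)) (h l)" 
    using q(3) by (intro iso_conv[OF \<Gamma>_iso[of h]]) (auto simp: H_def simp del: o_apply)
  moreover have "(\<lambda>n. h (((k \<circ> r) \<circ> q) n)) = x \<circ> (r \<circ> q)" using *(4) q(2) by auto
  ultimately have "conv (x \<circ> (r \<circ> q)) (h l)" by simp
  then show ?thesis using strict_mono_o[OF *(1) q(1)] by blast
qed

text \<open>The factors \<open>t - disp g x\<close> vanish at the threshold \<open>t\<close>, which makes \<open>\<Psi>\<close> continuous although the set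
  of admissible words jumps.\<close>

definition wt :: "real \<Rightarrow> ('a \<Rightarrow> 'a) list \<Rightarrow> 'a \<Rightarrow> real" where
  "wt t ws x = prod_list (map (\<lambda>g. max 0 (t - disp g x)) ws) / (1 + disp (I.word ws) x)"

definition W :: "real \<Rightarrow> nat \<Rightarrow> 'a \<Rightarrow> ('a \<Rightarrow> 'a) list set" where
  "W t n x = {ws. set ws \<subseteq> {g \<in> \<Gamma>. disp g x < t} \<and> length ws = n}"

text \<open>The denominators in \<open>wt\<close> make the sum sensitive to the displacement of each
  product, besides those of its letters. Words have length exactly \<open>n\<close>; for t > 0 the
  letter \<one> lets them stand for shorter words as well.\<close>

definition \<Psi> :: "real \<Rightarrow> nat \<Rightarrow> 'a \<Rightarrow> real" where
  "\<Psi> t n x = (\<Sum>ws\<in>W t n x. wt t ws x)"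

lemma finite_W: "x \<in> M \<Longrightarrow> finite (W t n x)"
  unfolding W_def by (intro finite_lists_length_eq finite_disp)

lemma word_\<Gamma>: "set ws \<subseteq> \<Gamma> \<Longrightarrow> I.word ws \<in> \<Gamma>"
  by (rule I.word_subgroup[OF \<Gamma>])

lemma prod_list_nonneg: "(\<And>x. x \<in> set xs \<Longrightarrow> 0 \<le> f x) \<Longrightarrow> 0 \<le> prod_list (map f xs :: real list)"
  by (induction xs) auto

lemma wt_nonneg: "0 \<le> wt t ws x"
  unfolding wt_def by (intro divide_nonneg_nonneg prod_list_nonneg add_nonneg_nonneg) auto

lemma wt_outside:
  assumes "g \<in> set ws" "t \<le> disp g x" shows "wt t ws x = 0"
proof -
  have "0 \<in> (\<lambda>g. max 0 (t - disp g x)) ` set ws" using assms by (auto intro!: image_eqI[of _ _ g])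
  then show ?thesis by (simp add: wt_def prod_list_zero_iff)
qed

lemma \<Psi>_eq:
  assumes A: "finite A" "W t n x \<subseteq> A" "\<And>ws. ws \<in> A \<Longrightarrow> set ws \<subseteq> \<Gamma> \<and> length ws = n"
  shows "\<Psi> t n x = (\<Sum>ws\<in>A. wt t ws x)"
  unfolding \<Psi>_def
proof (rule sum.mono_neutral_left[OF A(1,2)], rule ballI)
  fix ws assume ws: "ws \<in> A - W t n x"
  then obtain g where "g \<in> set ws" "\<not> disp g x < t" using A(3)[of ws] by (auto simp: W_def)
  then show "wt t ws x = 0" using wt_outside by auto
qed

lemma \<Psi>_nonneg: "0 \<le> \<Psi> t n x"
  unfolding \<Psi>_def by (intro sum_nonneg wt_nonneg)

lemma tendsto_prod_list:
  fixes f :: "'b \<Rightarrow> 'c \<Rightarrow> real"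
  shows "(\<And>i. i \<in> set xs \<Longrightarrow> (f i \<longlongrightarrow> l i) F) \<Longrightarrow>
    ((\<lambda>z. prod_list (map (\<lambda>i. f i z) xs)) \<longlongrightarrow> prod_list (map l xs)) F"
  by (induction xs) (auto intro: tendsto_mult)

text \<open>Words admissible close to \<open>y\<close> have letters of displacement below t + 2 at
  \<open>y\<close>. Over this fixed finite set of words the potentials are sums of continuous
  weights, inadmissible words contributing 0.\<close>

lemma \<Psi>_cont:
  assumes x: "conv x y" shows "(\<lambda>k. \<Psi> t n (x k)) \<longlonglongrightarrow> \<Psi> t n y"
proof -
  have M: "\<And>k. x k \<in> M" "y \<in> M" using x by (auto simp: conv_def)
  define A where "A = W (t + 2) n y"
  have A: "finite A" unfolding A_def by (rule finite_W[OF M(2)])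
  have A': "set ws \<subseteq> \<Gamma> \<and> length ws = n" if "ws \<in> A" for ws using that by (auto simp: A_def W_def)
  have "(\<lambda>k. \<Sum>ws\<in>A. wt t ws (x k)) \<longlonglongrightarrow> (\<Sum>ws\<in>A. wt t ws y)"
    unfolding wt_def
  proof (intro tendsto_sum tendsto_divide tendsto_prod_list tendsto_max tendsto_diff tendsto_add tendsto_const)
    fix ws assume ws: "ws \<in> A"
    show "(\<lambda>k. disp (I.word ws) (x k)) \<longlonglongrightarrow> disp (I.word ws) y"
      using A'[OF ws] by (intro disp_conv[OF \<Gamma>_iso[OF word_\<Gamma>] x]) auto
    show "(\<lambda>k. disp g (x k)) \<longlonglongrightarrow> disp g y" if "g \<in> set ws" for g
      using A'[OF ws] that by (intro disp_conv[OF \<Gamma>_iso x]) auto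
    show "1 + disp (I.word ws) y \<noteq> 0" using disp_nonneg[of "I.word ws" y] by linarith
  qed
  also have "(\<Sum>ws\<in>A. wt t ws y) = \<Psi> t n y"
    by (rule \<Psi>_eq[symmetric, OF A _ A']) (auto simp: A_def W_def)
  finally have lim: "(\<lambda>k. \<Sum>ws\<in>A. wt t ws (x k)) \<longlonglongrightarrow> \<Psi> t n y" .
  have "\<forall>\<^sub>F k in sequentially. d (x k) y < 1"
    using x by (intro order_tendstoD(2)) (auto simp: conv_def)
  then have "\<forall>\<^sub>F k in sequentially. (\<Sum>ws\<in>A. wt t ws (x k)) = \<Psi> t n (x k)"
  proof eventually_elim
    case (elim k)
    have "disp g y < t + 2" if "g \<in> \<Gamma>" "disp g (x k) < t" for g
      using disp_lipschitz[OF \<Gamma>_iso[OF that(1)] M(2) M(1)[of k]] that elim by (simp add: commute)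
    then have "W t n (x k) \<subseteq> A" by (auto simp: W_def A_def)
    then show ?case by (rule \<Psi>_eq[symmetric, OF A _ A'])
  qed
  then show ?thesis using lim by (rule Lim_transform_eventually[rotated])
qed

text \<open>Conjugation by \<open>h\<close> matches the words admissible at \<open>h x\<close> with
  those admissible at \<open>x\<close> and preserves all displacements involved.\<close>

lemma \<Psi>_inv:
  assumes h: "h \<in> \<Gamma>" and x: "x \<in> M" shows "\<Psi> t n (h x) = \<Psi> t n x"
proof -
  have hI: "iso h" using \<Gamma>_iso[OF h] .
  define c where "c g = inv\<^bsub>IG\<^esub> h \<otimes>\<^bsub>IG\<^esub> g \<otimes>\<^bsub>IG\<^esub> h" for g
  define c' where "c' g = h \<otimes>\<^bsub>IG\<^esub> g \<otimes>\<^bsub>IG\<^esub> inv\<^bsub>IG\<^esub> h" for g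
  have c\<Gamma>: "c g \<in> \<Gamma>" "c' g \<in> \<Gamma>" if "g \<in> \<Gamma>" for g
    using that h \<Gamma>_closed by (auto simp: c_def c'_def)
  have cc: "c (c' g) = g" "c' (c g) = g" if "g \<in> \<Gamma>" for g
    by (rule iso_eqI; use \<Gamma>_iso[OF that] hI in \<open>auto simp: c_def c'_def\<close>)+
  have dc: "disp (c g) x = disp g (h x)" if "g \<in> \<Gamma>" for g
    unfolding c_def by (rule disp_conj'[OF h that x])
  have dc': "disp (c' g) (h x) = disp g x" if "g \<in> \<Gamma>" for g
    using dc[OF c\<Gamma>(2)[OF that]] cc[OF that] by simp
  have wc: "I.word (map c ws) = c (I.word ws)" if "set ws \<subseteq> \<Gamma>" for ws
    using that
  proof (induction ws)
    case Nil show ?case using hI by (simp add: c_def)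
  next
    case (Cons g ws)
    have "I.word (map c (g # ws)) = c g \<otimes>\<^bsub>IG\<^esub> c (I.word ws)" using Cons by simp
    also have "\<dots> = c (g \<otimes>\<^bsub>IG\<^esub> I.word ws)"
      by (rule iso_eqI) (use hI Cons.prems \<Gamma>_iso word_\<Gamma>[of ws] in \<open>auto simp: c_def\<close>)
    finally show ?case by simp
  qed
  show ?thesis
    unfolding \<Psi>_def
  proof (rule sum.reindex_bij_witness[of _ "map c'" "map c"])
    fix ws assume ws: "ws \<in> W t n (h x)"
    then have w\<Gamma>: "set ws \<subseteq> \<Gamma>" by (auto simp: W_def)
    show "map c' (map c ws) = ws" unfolding map_map by (rule map_idI) (use w\<Gamma> cc in auto)
    show "map c ws \<in> W t n x" using ws c\<Gamma> dc by (auto simp: W_def)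
    have "map (\<lambda>g. max 0 (t - disp (c g) x)) ws = map (\<lambda>g. max 0 (t - disp g (h x))) ws"
      using w\<Gamma> dc by auto
    then show "wt t (map c ws) x = wt t ws (h x)"
      by (simp only: wt_def map_map comp_def wc[OF w\<Gamma>] dc[OF word_\<Gamma>[OF w\<Gamma>]])
  next
    fix ws assume ws: "ws \<in> W t n x"
    then have w\<Gamma>: "set ws \<subseteq> \<Gamma>" by (auto simp: W_def)
    show "map c (map c' ws) = ws" unfolding map_map by (rule map_idI) (use w\<Gamma> cc in auto)
    show "map c' ws \<in> W t n (h x)" using ws c\<Gamma> dc' by (auto simp: W_def)
  qed
qed

section \<open>Admissible points and lexicographic minimization of the potentials\<close>

definition U :: "'a set" where
  "U = {x \<in> M. \<forall>w\<in>\<Gamma>s. tl w \<le> \<mu> \<longrightarrow> tl w < disp w x}"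

text \<open>A limit of points of \<open>U\<close> may lie in one of the excluded minimal sets, so
  minimizers cannot be sought in \<open>U\<close> itself. In its closure within the thick part,
  minimizing sequences converge up to \<open>\<Gamma>\<close>.\<close>

definition Z :: "'a set" where
  "Z = {x \<in> thick \<delta>. \<forall>e>0. \<exists>u\<in>U. d u x < e}"

lemma UM: "u \<in> U \<Longrightarrow> u \<in> M" by (simp add: U_def)

lemma ZM: "u \<in> Z \<Longrightarrow> u \<in> M" by (simp add: Z_def thick_def)

lemma disp_inv_move:
  assumes "h \<in> \<Gamma>" "x \<in> M" "g \<in> \<Gamma>s"
  obtains g' where "g' \<in> \<Gamma>s" "disp g (h x) = disp g' x" "tl g' = tl g"
proof -
  have i: "inv\<^bsub>IG\<^esub> h \<in> \<Gamma>" using \<Gamma>_closed assms by auto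
  have "inv\<^bsub>IG\<^esub> h \<otimes>\<^bsub>IG\<^esub> g \<otimes>\<^bsub>IG\<^esub> h \<in> \<Gamma>s" using \<Gamma>s_conj[OF i assms(3)] \<Gamma>_iso assms by simp
  moreover have "tl (inv\<^bsub>IG\<^esub> h \<otimes>\<^bsub>IG\<^esub> g \<otimes>\<^bsub>IG\<^esub> h) = tl g"
    using tl_conj[of "inv\<^bsub>IG\<^esub> h" g] \<Gamma>_iso[OF assms(1)] \<Gamma>s_iso[OF assms(3)] by simp
  ultimately show thesis using that disp_conj'[OF assms(1) \<Gamma>s_\<Gamma>[OF assms(3)] assms(2)] by simp
qed

lemma U_inv: assumes h: "h \<in> \<Gamma>" and u: "u \<in> U" shows "h u \<in> U"
  unfolding U_def
proof (intro CollectI conjI ballI impI)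
  show "h u \<in> M" using \<Gamma>_iso[OF h] UM[OF u] by simp
  fix w assume w: "w \<in> \<Gamma>s" "tl w \<le> \<mu>"
  obtain w' where w': "w' \<in> \<Gamma>s" "disp w (h u) = disp w' u" "tl w' = tl w"
    using disp_inv_move[OF h UM[OF u] w(1)] .
  then show "tl w < disp w (h u)" using u w by (auto simp: U_def)
qed

lemma Z_inv: assumes h: "h \<in> \<Gamma>" and u: "u \<in> Z" shows "h u \<in> Z"
  unfolding Z_def thick_def
proof (intro CollectI conjI ballI allI impI)
  have uM: "u \<in> M" using ZM[OF u] .
  show "h u \<in> M" using \<Gamma>_iso[OF h] uM by simp
  show "\<delta> \<le> disp g (h u)" if g: "g \<in> \<Gamma>s" for g
  proof -
    obtain g' where "g' \<in> \<Gamma>s" "disp g (h u) = disp g' u" using disp_inv_move[OF h uM g] .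
    then show ?thesis using u by (auto simp: Z_def thick_def)
  qed
  fix e :: real assume "e > 0"
  then obtain v where v: "v \<in> U" "d v u < e" using u by (auto simp: Z_def)
  then have "d (h v) (h u) < e" using \<Gamma>_iso[OF h] uM UM by simp
  then show "\<exists>v\<in>U. d v (h u) < e" using U_inv[OF h v(1)] by blast
qed

lemma Z_closed: "sclosed Z"
  unfolding sclosed_def
proof (intro conjI allI impI)
  show "Z \<subseteq> M" using ZM by blast
  fix x y assume "(\<forall>n. x n \<in> Z) \<and> conv x y"
  then have x: "\<And>n. x n \<in> Z" "\<And>n. x n \<in> M" and y: "conv x y" "y \<in> M" by (auto simp: conv_def)
  show "y \<in> Z"
    unfolding Z_def thick_def
  proof (intro CollectI conjI ballI allI impI y)
    show "\<delta> \<le> disp g y" if g: "g \<in> \<Gamma>s" for g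
      by (rule LIMSEQ_le_const[OF disp_conv[OF \<Gamma>s_iso[OF g] y(1)]]) (use x g in \<open>auto simp: Z_def thick_def\<close>)
    fix e :: real assume e: "e > 0"
    have "\<forall>\<^sub>F n in sequentially. d (x n) y < e / 2"
      using y e by (intro order_tendstoD(2)) (auto simp: conv_def)
    then obtain n where n: "d (x n) y < e / 2" using eventually_happens'[OF sequentially_bot] by blast
    have "\<forall>e>0. \<exists>u\<in>U. d u (x n) < e" using x(1)[of n] by (simp add: Z_def)
    then obtain u where u: "u \<in> U" "d u (x n) < e / 2" using half_gt_zero[OF e] by blast
    have "d u y < e" using triangle[of u "x n" y] n u UM[OF u(1)] x y by simp
    then show "\<exists>u\<in>U. d u y < e" using u by blast
  qed
qed

text \<open>A minimizing sequence lies in the thick part, so a subsequence converges after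
  translation by \<open>\<Gamma>\<close>; the invariance of \<open>A\<close> and of the potential
  makes the translation harmless. The three conclusions are what minimizing the next potential over
  \<open>B\<close> requires.\<close>

lemma argmin_closed:
  fixes t :: real and n :: nat
  assumes A: "A \<subseteq> Z" "sclosed A" "\<And>h x. h \<in> \<Gamma> \<Longrightarrow> x \<in> A \<Longrightarrow> h x \<in> A" "A \<noteq> {}"
  defines "B \<equiv> {x \<in> A. \<forall>u\<in>A. \<Psi> t n x \<le> \<Psi> t n u}"
  shows "B \<noteq> {}" "sclosed B" "\<And>h x. h \<in> \<Gamma> \<Longrightarrow> x \<in> B \<Longrightarrow> h x \<in> B"
proof -
  have AM: "x \<in> M" if "x \<in> A" for x using A that ZM by blast
  define i where "i = Inf (\<Psi> t n ` A)"
  have bdd: "bdd_below (\<Psi> t n ` A)" using \<Psi>_nonneg by (auto intro!: bdd_belowI2)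
  have i_le: "i \<le> \<Psi> t n x" if "x \<in> A" for x unfolding i_def using that bdd by (auto intro: cInf_lower)
  have "\<exists>x\<in>A. \<Psi> t n x < i + 1 / Suc k" for k
    using cInf_lessD[of "\<Psi> t n ` A" "i + 1 / Suc k"] A by (auto simp: i_def)
  then obtain x where x: "\<And>k. x k \<in> A" "\<And>k. \<Psi> t n (x k) < i + 1 / Suc k" by metis
  have xt: "x k \<in> thick \<delta>" for k using x(1)[of k] A by (auto simp: Z_def)
  obtain r g k l where *: "strict_mono (r :: nat \<Rightarrow> nat)" "\<forall>n. g n \<in> \<Gamma>" "\<forall>n. k n \<in> M"
    "\<forall>n. x n = g n (k n)" "conv (k \<circ> r) l" using thick_compact[of \<delta> x, OF pos(1) xt]
    by (elim exE conjE) (rule that; assumption)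
  have k_eq: "k m = (inv\<^bsub>IG\<^esub> (g m)) (x m)" for m
    using *(2,3) inv_apply(2)[OF \<Gamma>_iso] unfolding *(4)[rule_format, of m] by simp
  have kA: "k m \<in> A" for m unfolding k_eq using A(3) \<Gamma>_closed(2)[OF *(2)[rule_format]] x(1) by blast
  have lA: "l \<in> A" using sclosedD[OF A(2) _ *(5)] kA by simp
  have "\<Psi> t n (k m) = \<Psi> t n (x m)" for m
    unfolding k_eq using \<Psi>_inv[OF \<Gamma>_closed(2)[OF *(2)[rule_format]]] AM[OF x(1)] by blast
  then have bd: "\<Psi> t n ((k \<circ> r) m) \<le> i + 1 / Suc (r m)" for m using x(2)[of "r m"] by simp
  have "(\<lambda>m. i + 1 / Suc (r m)) \<longlonglongrightarrow> i + 0"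
    using LIMSEQ_subseq_LIMSEQ[OF lim_inverse_n'[THEN LIMSEQ_Suc] *(1)]
    by (intro tendsto_add tendsto_const) (simp add: o_def)
  then have "\<Psi> t n l \<le> i + 0"
    using LIMSEQ_le[OF \<Psi>_cont[OF *(5)]] bd by blast
  then have "l \<in> B" using lA i_le by (force simp: B_def)
  then show "B \<noteq> {}" by blast
  show "sclosed B"
    unfolding sclosed_def
  proof (intro conjI allI impI)
    show "B \<subseteq> M" using AM by (auto simp: B_def)
    fix x y assume "(\<forall>n. x n \<in> B) \<and> conv x y"
    then have x: "\<And>n. x n \<in> B" and y: "conv x y" by auto
    have yA: "y \<in> A" using sclosedD[OF A(2) _ y] x by (auto simp: B_def)
    have "\<Psi> t n y \<le> \<Psi> t n u" if "u \<in> A" for u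
      by (rule LIMSEQ_le_const2[OF \<Psi>_cont[OF y]]) (use x that in \<open>auto simp: B_def\<close>)
    then show "y \<in> B" using yA by (simp add: B_def)
  qed
  show "h x \<in> B" if "h \<in> \<Gamma>" "x \<in> B" for h x
    using that A(3) \<Psi>_inv[of h x] AM by (auto simp: B_def)
qed

text \<open>The levels increase to \<open>\<tau>\<close>, so that every element of the group generated by letters of displacement
  less than \<open>\<tau>\<close> is a word seen by all but finitely many of the potentials.\<close>

definition lev :: "nat \<Rightarrow> real" where "lev n = \<tau> - (\<tau> - s\<^sub>1) / (real n + 1)"

lemma lev_0 [simp]: "lev 0 = s\<^sub>1" by (simp add: lev_def)

lemma lev_less: "lev n < \<tau>" using pos by (simp add: lev_def)

lemma lev_mono: "m \<le> n \<Longrightarrow> lev m \<le> lev n"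
  using pos by (simp add: lev_def frac_le)

lemma lev_ge: "s\<^sub>1 \<le> lev n" using lev_mono[of 0 n] by simp

lemma lev_unbounded: assumes "c < \<tau>" obtains n where "c < lev n" "n \<ge> k"
proof -
  obtain n :: nat where n: "(\<tau> - s\<^sub>1) / (\<tau> - c) < n" using reals_Archimedean2 by blast
  define m where "m = max n k"
  have "(\<tau> - s\<^sub>1) / (\<tau> - c) < real m + 1" using n by (simp add: m_def)
  then have "\<tau> - s\<^sub>1 < (real m + 1) * (\<tau> - c)" using assms by (simp add: divide_less_eq)
  then have "(\<tau> - s\<^sub>1) / (real m + 1) < \<tau> - c" by (simp add: divide_less_eq mult.commute)
  then have "c < lev m" by (simp add: lev_def)
  then show thesis using that[of m] by (simp add: m_def)
qed

primrec Zs :: "nat \<Rightarrow> 'a set" where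
  "Zs 0 = Z"
| "Zs (Suc n) = {x \<in> Zs n. \<forall>u\<in>Zs n. \<Psi> (lev n) (Suc n) x \<le> \<Psi> (lev n) (Suc n) u}"

lemma Zs_mono: "m \<le> n \<Longrightarrow> Zs n \<subseteq> Zs m"
  by (induction n rule: dec_induct) auto

lemma Zs_props:
  assumes "Z \<noteq> {}"
  shows "Zs n \<noteq> {} \<and> sclosed (Zs n) \<and> (\<forall>h\<in>\<Gamma>. \<forall>x\<in>Zs n. h x \<in> Zs n)"
proof (induction n)
  case 0
  then show ?case using assms Z_closed Z_inv by simp
next
  case (Suc n)
  have "Zs n \<subseteq> Z" using Zs_mono[of 0 n] by simp
  then show ?case using argmin_closed[where A = "Zs n" and t = "lev n" and n = "Suc n"] Suc by simp
qed

definition crit :: "'a \<Rightarrow> bool" where "crit y \<longleftrightarrow> (\<forall>n. y \<in> Zs n)"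

text \<open>Points chosen from the decreasing sets \<open>Zs n\<close> converge, up to
  \<open>\<Gamma>\<close> and along a subsequence; every \<open>Zs n\<close> contains a tail and is
  closed.\<close>

lemma crit_exists: assumes "Z \<noteq> {}" obtains y where "crit y"
proof -
  have "\<exists>x. x \<in> Zs n" for n using Zs_props[OF assms, of n] by blast
  then obtain x where x: "\<And>n. x n \<in> Zs n" by metis
  have xt: "x k \<in> thick \<delta>" for k using x[of k] Zs_mono[of 0 k] by (auto simp: Z_def)
  obtain r g k l where *: "strict_mono (r :: nat \<Rightarrow> nat)" "\<forall>n. g n \<in> \<Gamma>" "\<forall>n. k n \<in> M"
    "\<forall>n. x n = g n (k n)" "conv (k \<circ> r) l" using thick_compact[of \<delta> x, OF pos(1) xt]
    by (elim exE conjE) (rule that; assumption)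
  have k_eq: "k m = (inv\<^bsub>IG\<^esub> (g m)) (x m)" for m
    using *(2,3) inv_apply(2)[OF \<Gamma>_iso] unfolding *(4)[rule_format, of m] by simp
  have kZ: "k m \<in> Zs m" for m unfolding k_eq using Zs_props[OF assms, of m] \<Gamma>_closed(2)[OF *(2)[rule_format]] x by blast
  have lZ: "l \<in> Zs n" for n
  proof -
    have "strict_mono (\<lambda>m. m + n)" by (simp add: strict_mono_def)
    then have c: "conv ((k \<circ> r) \<circ> (\<lambda>m. m + n)) l" by (rule conv_subseq[OF *(5)])
    have "((k \<circ> r) \<circ> (\<lambda>m. m + n)) m \<in> Zs n" for m
    proof -
      have "n \<le> r (m + n)" using seq_suble[OF *(1), of "m + n"] by simp
      then show ?thesis using kZ[of "r (m + n)"] Zs_mono by auto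
    qed
    then show ?thesis using sclosedD[OF _ _ c] Zs_props[OF assms, of n] by blast
  qed
  show thesis by (rule that[of l]) (use lZ in \<open>auto simp only: crit_def\<close>)
qed

lemma crit_Z: "crit y \<Longrightarrow> y \<in> Z" unfolding crit_def using Zs.simps(1) by metis

lemma crit_M: "crit y \<Longrightarrow> y \<in> M" using crit_Z ZM by blast

lemma crit_disp: "crit y \<Longrightarrow> g \<in> \<Gamma>s \<Longrightarrow> \<delta> \<le> disp g y"
  using crit_Z by (force simp: Z_def thick_def)

text \<open>By induction \<open>u\<close> stays in all the sets \<open>Zs m\<close>, since at each
  level it is no worse than \<open>y\<close>, which minimizes there.\<close>

lemma crit_lex:
  assumes y: "crit y" and u: "u \<in> Z" and le: "\<And>m. m \<le> n \<Longrightarrow> \<Psi> (lev m) (Suc m) u \<le> \<Psi> (lev m) (Suc m) y"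
  shows "\<Psi> (lev n) (Suc n) u = \<Psi> (lev n) (Suc n) y"
proof -
  have "m \<le> n \<Longrightarrow> u \<in> Zs m" for m
  proof (induction m)
    case (Suc m)
    have "y \<in> Zs (Suc m)" using y unfolding crit_def by blast
    then have "\<Psi> (lev m) (Suc m) y \<le> \<Psi> (lev m) (Suc m) v" if "v \<in> Zs m" for v using that by simp
    then show ?case using Suc le[of m] by force
  qed (simp add: u)
  then have "u \<in> Zs n" by simp
  moreover have "y \<in> Zs (Suc n)" using y unfolding crit_def by blast
  ultimately show ?thesis using le[of n] by force
qed

lemma prod_list_mono:
  fixes f h :: "'b \<Rightarrow> real"
  assumes "\<And>x. x \<in> set xs \<Longrightarrow> 0 \<le> f x \<and> f x \<le> h x"
  shows "prod_list (map f xs) \<le> prod_list (map h xs)"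
  using assms by (induction xs) (auto intro!: mult_mono prod_list_nonneg intro: order_trans)

lemma wt_le:
  assumes ws: "set ws \<subseteq> \<Gamma>" and le: "\<And>g. g \<in> set ws \<Longrightarrow> disp g y \<le> disp g u"
    and w: "disp (I.word ws) y \<le> disp (I.word ws) u"
  shows "wt t ws u \<le> wt t ws y"
  unfolding wt_def
proof (intro frac_le)
  show "prod_list (map (\<lambda>g. max 0 (t - disp g u)) ws) \<le> prod_list (map (\<lambda>g. max 0 (t - disp g y)) ws)"
    using le by (intro prod_list_mono conjI max.mono) auto
  show "0 < 1 + disp (I.word ws) y" using disp_nonneg[of "I.word ws" y] by linarith
qed (use w in \<open>auto intro: prod_list_nonneg\<close>)

text \<open>Both potentials are sums over the words admissible at \<open>y\<close>, and termwise
  domination with equal sums forces termwise equality.\<close>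

lemma \<Psi>_le:
  assumes y: "y \<in> M" and u: "u \<in> M" and sub: "W t n u \<subseteq> W t n y"
    and le: "\<And>ws. ws \<in> W t n y \<Longrightarrow> wt t ws u \<le> wt t ws y"
  shows "\<Psi> t n u \<le> \<Psi> t n y"
    and "\<Psi> t n u = \<Psi> t n y \<Longrightarrow> ws \<in> W t n y \<Longrightarrow> wt t ws u = wt t ws y"
proof -
  have eq: "\<Psi> t n u = (\<Sum>ws\<in>W t n y. wt t ws u)"
    using sub by (intro \<Psi>_eq finite_W y) (auto simp: W_def)
  show "\<Psi> t n u \<le> \<Psi> t n y" unfolding eq by (subst \<Psi>_def) (intro sum_mono le)
  show "wt t ws u = wt t ws y" if "\<Psi> t n u = \<Psi> t n y" "ws \<in> W t n y"
  proof (rule sum_mono_inv[of "\<lambda>ws. wt t ws u" "W t n y" "\<lambda>ws. wt t ws y"])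
    show "(\<Sum>ws\<in>W t n y. wt t ws u) = (\<Sum>ws\<in>W t n y. wt t ws y)"
      using that(1) unfolding eq by (simp only: \<Psi>_def)
  qed (use le that(2) finite_W[OF y] in auto)
qed

text \<open>Admissibility at \<open>y\<close> makes the numerator positive there, so the larger
  denominator at \<open>u\<close> counts.\<close>

lemma wt_strict:
  assumes ws: "ws \<in> W t n y" and le: "\<And>g. g \<in> set ws \<Longrightarrow> disp g y \<le> disp g u"
    and w: "disp (I.word ws) y < disp (I.word ws) u"
  shows "wt t ws u < wt t ws y"
proof -
  define P where "P v = prod_list (map (\<lambda>g. max 0 (t - disp g v)) ws)" for v
  have "P y > 0"
  proof -
    have "\<forall>g\<in>set ws. disp g y < t" using ws by (auto simp: W_def)
    then show ?thesis unfolding P_def by (induction ws) auto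
  qed
  moreover have "P u \<le> P y"
    unfolding P_def using le by (intro prod_list_mono conjI max.mono) auto
  moreover have "0 \<le> P u" unfolding P_def by (intro prod_list_nonneg) auto
  ultimately have "P u * (1 + disp (I.word ws) y) < P y * (1 + disp (I.word ws) u)"
    using mult_right_mono[of "P u" "P y" "1 + disp (I.word ws) y"]
      mult_strict_left_mono[of "1 + disp (I.word ws) y" "1 + disp (I.word ws) u" "P y"]
      w disp_nonneg[of "I.word ws" y] by linarith
  moreover have "0 < 1 + disp (I.word ws) y" "0 < 1 + disp (I.word ws) u"
    using disp_nonneg[of "I.word ws" y] disp_nonneg[of "I.word ws" u] by linarith+
  ultimately have "P u / (1 + disp (I.word ws) u) < P y / (1 + disp (I.word ws) y)"
    by (simp only: pos_divide_less_eq times_divide_eq_left pos_less_divide_eq)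
  then show ?thesis unfolding wt_def P_def[symmetric] .
qed

end

context thin_group
begin

text \<open>This is how geodesic completeness enters the pushing argument: the geodesic from
  \<open>q\<close> to \<open>x\<close> is continued beyond \<open>x\<close> by \<rho>.\<close>

lemma extend_geodesic:
  assumes q: "q \<in> M" and x: "x \<in> M" and ne: "q \<noteq> x" and \<rho>: "\<rho> > 0"
  obtains u where "u \<in> M" "d x u = \<rho>" "pt (d q x / (d q x + \<rho>)) q u = x"
proof -
  define a where "a = d q x"
  have a: "a > 0" using assms by (simp add: a_def)
  obtain S where "geodesic_segment M d q x S" using geodesic_segment_exists[OF q x] .
  then obtain c where c: "geodesic_on M d {0..a} c" "c 0 = q" "c a = x"
    by (auto simp: geodesic_segment_def a_def)
  obtain \<gamma> where \<gamma>: "geodesic_on M d UNIV \<gamma>" "\<forall>t\<in>{0..a}. \<gamma> t = c t"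
    using gc a c(1) unfolding geodesically_complete_def by blast
  define u where "u = \<gamma> (a + \<rho>)"
  have e: "\<gamma> 0 = q" "\<gamma> a = x" using \<gamma>(2) a c by auto
  have dd: "d (\<gamma> s) (\<gamma> t) = \<bar>s - t\<bar>" and inM: "\<gamma> s \<in> M" for s t
    using \<gamma>(1) by (auto simp: geodesic_on_def)
  have u: "u \<in> M" "d q u = a + \<rho>" "d x u = \<rho>"
    using inM[of "a + \<rho>"] dd[of 0 "a + \<rho>"] dd[of a "a + \<rho>"] a \<rho> by (auto simp: u_def e)
  have "pt (a / (a + \<rho>)) q u = x"
    using a \<rho> u x q by (intro pt_eqI) (auto simp: a_def[symmetric] field_simps)
  then show thesis using that u by (simp add: a_def)
qed

end

subsection \<open>Critical points\<close>

locale critical_point = thin_group +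
  fixes y
  assumes crit_y: "crit y"
begin

lemma y_M [simp]: "y \<in> M" using crit_M[OF crit_y] .

definition G where "G = generate IG {g \<in> \<Gamma>. disp g y < \<tau>}"

lemma letters_iso: "{g \<in> \<Gamma>. disp g y < c} \<subseteq> carrier IG"
  using \<Gamma>_iso by auto

lemma letters_inv: "g \<in> {g \<in> \<Gamma>. disp g y < c} \<Longrightarrow> inv\<^bsub>IG\<^esub> g \<in> {g \<in> \<Gamma>. disp g y < c}"
  using \<Gamma>_closed(2) disp_inv[OF \<Gamma>_iso] by auto

lemma G_subgroup: "subgroup G IG"
  unfolding G_def by (rule I.generate_is_subgroup[OF letters_iso])

lemma G_\<Gamma>: "g \<in> G \<Longrightarrow> g \<in> \<Gamma>"
  using I.generate_subgroup_incl[OF _ \<Gamma>, of "{g \<in> \<Gamma>. disp g y < \<tau>}"] unfolding G_def by blast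

lemma G_iso: "g \<in> G \<Longrightarrow> iso g" by (rule \<Gamma>_iso[OF G_\<Gamma>])

lemmas G_closed = subgroup.m_closed[OF G_subgroup] subgroup.m_inv_closed[OF G_subgroup]
  subgroup.one_closed[OF G_subgroup]

lemma G_letter: "g \<in> \<Gamma> \<Longrightarrow> disp g y < \<tau> \<Longrightarrow> g \<in> G"
  unfolding G_def by (intro generate.incl) simp

lemma G_word: "set ws \<subseteq> G \<Longrightarrow> I.word ws \<in> G"
  by (rule I.word_subgroup[OF G_subgroup])

text \<open>Prolong the segment from the projection \<open>q\<close> of \<open>x\<close> through
  \<open>x\<close>. A displacement by an element of \<open>G\<close> is convex there and not larger
  at \<open>q\<close> than at \<open>x\<close>, so it cannot drop from \<open>x\<close> to
  \<open>u\<close>. Elements displacing \<open>u\<close> by at most \<open>\<mu>\<close> belong to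
  \<open>G\<close>, as \<open>u\<close> is close to \<open>y\<close>; this keeps \<open>u\<close> in
  \<open>U\<close>.\<close>

lemma flow_away_approx:
  assumes C: "ccset C" "\<And>g. g \<in> G \<Longrightarrow> stable g C"
    and x: "x \<in> U" "x \<notin> C" and \<rho>: "\<rho> > 0" "2 * \<rho> + 2 * d x y < \<tau> - \<mu>" and cl: "4 * d x y \<le> \<delta>"
  shows "\<exists>u\<in>U. d x u = \<rho> \<and> (\<forall>g\<in>G. disp g x \<le> disp g u) \<and> dset C x + \<rho> \<le> dset C u \<and> u \<in> thick (\<delta> / 2)"
proof -
  have xM: "x \<in> M" using UM[OF x(1)] .
  define q where "q = proj C x"
  have q: "q \<in> C" "q \<in> M" using proj_in[OF C(1) xM] ccset_subset[OF C(1)] by (auto simp: q_def)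
  obtain u where u: "u \<in> M" "d x u = \<rho>" "pt (d q x / (d q x + \<rho>)) q u = x"
    using extend_geodesic[OF q(2) xM _ \<rho>(1)] q(1) x(2) by metis
  define s where "s = d q x / (d q x + \<rho>)"
  have qx: "d q x > 0" using q x xM by (metis mdist_pos_less)
  have s: "0 < s" "s < 1" using qx \<rho> by (auto simp: s_def field_simps)
  have xs: "pt s q u = x" using u by (simp add: s_def)
  have mono: "disp g x \<le> disp g u" if g: "g \<in> G" for g
  proof -
    have "disp g x \<le> (1 - s) * disp g q + s * disp g u"
      using disp_convex[OF G_iso[OF g] q(2) u(1), of s] s xs by simp
    also have "\<dots> \<le> (1 - s) * disp g x + s * disp g u"
      using disp_proj[OF C(1) G_iso[OF g] C(2)[OF g] xM] s by (intro add_mono mult_left_mono) (auto simp: q_def)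
    finally have "s * disp g x \<le> s * disp g u" by (simp add: algebra_simps)
    then show ?thesis using s by simp
  qed
  have dset: "dset C x + \<rho> \<le> dset C u"
  proof -
    have "dset C x \<le> (1 - s) * dset C q + s * dset C u"
      using dset_convex[OF C(1) q(2) u(1), of s] s xs by simp
    moreover have "dset C q = 0" using dset_zero[OF C(1) q(2)] q by simp
    moreover have "dset C x = s * (dset C x + \<rho>)"
      using qx \<rho> by (simp add: s_def dset_def q_def[symmetric] commute[of x q])
    ultimately have "s * (dset C x + \<rho>) \<le> s * dset C u" by simp
    then show ?thesis using s by simp
  qed
  have near: "g \<in> G" if g: "g \<in> \<Gamma>" "disp g u \<le> \<mu>" for g
  proof (rule G_letter[OF g(1)])
    have "d y u \<le> d x y + \<rho>" using triangle[of y x u] xM u by (simp add: commute)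
    moreover have "disp g y \<le> disp g u + 2 * d y u" by (rule disp_lipschitz[OF \<Gamma>_iso[OF g(1)] y_M u(1)])
    ultimately show "disp g y < \<tau>" using g(2) \<rho>(2) by linarith
  qed
  have "u \<in> U"
    unfolding U_def
  proof (intro CollectI conjI ballI impI u)
    fix w assume w: "w \<in> \<Gamma>s" "tl w \<le> \<mu>"
    show "tl w < disp w u"
    proof (cases "disp w u \<le> \<mu>")
      case True
      then show ?thesis using near[OF \<Gamma>s_\<Gamma>[OF w(1)]] mono[of w] x(1) w by (force simp: U_def)
    qed (use w in linarith)
  qed
  moreover have "u \<in> thick (\<delta> / 2)"
    unfolding thick_def
  proof (intro CollectI conjI ballI u)
    fix g assume g: "g \<in> \<Gamma>s"
    show "\<delta> / 2 \<le> disp g u"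
    proof (cases "disp g u \<le> \<mu>")
      case True
      have "\<delta> \<le> disp g y" by (rule crit_disp[OF crit_y g])
      also have "\<dots> \<le> disp g x + 2 * d y x" by (rule disp_lipschitz[OF \<Gamma>s_iso[OF g] y_M xM])
      finally show ?thesis using mono[OF near[OF \<Gamma>s_\<Gamma>[OF g] True]] cl by (simp add: commute)
    qed (use pos in linarith)
  qed
  ultimately show ?thesis using u mono dset by blast
qed

text \<open>The points of \<open>U\<close> near \<open>y\<close> are pushed, and a limit
  \<open>u\<close> is extracted in the thick part. Displacements by \<open>G\<close> are at least as
  large at \<open>u\<close> as at \<open>y\<close>, so no potential up to level \<open>n\<close>
  exceeds its value at \<open>y\<close>. Now \<open>crit_lex\<close> gives equality at level
  \<open>n\<close>, and \<open>wt_strict\<close> turns it into equality for each word.\<close>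

lemma flow_away:
  assumes C: "ccset C" "\<And>g. g \<in> G \<Longrightarrow> stable g C"
    and x: "\<And>k. x k \<in> U" "\<And>k. x k \<notin> C" "conv x y"
  shows "\<exists>\<rho>>0. \<exists>u\<in>M. d u y \<le> \<rho> \<and> dset C y + \<rho> \<le> dset C u \<and>
    (\<forall>ws\<in>W (lev n) (Suc n) y. disp (I.word ws) u = disp (I.word ws) y)"
proof -
  \<comment> \<open>A push by \<rho> changes displacements by at most 2 \<rho>. Since the level
    stays below \<tau>, elements displacing \<open>u\<close> by less than \<open>lev n\<close>, or
    by less than \<open>\<delta>\<close>, displace \<open>y\<close> by less than \<tau> and so lie
    in \<open>G\<close>.\<close>
  define \<rho> where "\<rho> = min (\<tau> - \<mu>) (\<tau> - lev n) / 4"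
  have \<rho>: "\<rho> > 0" "4 * \<rho> \<le> \<tau> - \<mu>" "4 * \<rho> \<le> \<tau> - lev n" using pos lev_less[of n] by (auto simp: \<rho>_def)
  define h where "h = min \<rho> (\<delta> / 4)"
  have h: "h > 0" "h \<le> \<rho>" "4 * h \<le> \<delta>" using \<rho> pos by (auto simp: h_def)
  have lim: "(\<lambda>k. d (x k) y) \<longlonglongrightarrow> 0" and xM: "\<And>k. x k \<in> M" using x(3) by (auto simp: conv_def)
  obtain N where N: "\<And>k. k \<ge> N \<Longrightarrow> d (x k) y < h"
    using order_tendstoD(2)[OF lim h(1)] unfolding eventually_sequentially by blast
  define z where "z k = x (k + N)" for k
  have z: "z k \<in> U" "z k \<notin> C" "d (z k) y < h" "z k \<in> M" for k using x N xM by (auto simp: z_def)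
  have zc: "conv z y" using conv_subseq[OF x(3), of "\<lambda>k. k + N"] by (simp add: strict_mono_def o_def z_def[abs_def])
  have "\<exists>u\<in>U. d (z k) u = \<rho> \<and> (\<forall>g\<in>G. disp g (z k) \<le> disp g u) \<and> dset C (z k) + \<rho> \<le> dset C u \<and> u \<in> thick (\<delta> / 2)" for k
    by (rule flow_away_approx[OF C z(1,2) \<rho>(1)]) (use z(3)[of k] \<rho> h in linarith)+
  then obtain v where v: "\<And>k. v k \<in> U" "\<And>k. d (z k) (v k) = \<rho>" "\<And>k g. g \<in> G \<Longrightarrow> disp g (z k) \<le> disp g (v k)"
    "\<And>k. dset C (z k) + \<rho> \<le> dset C (v k)" "\<And>k. v k \<in> thick (\<delta> / 2)" by metis
  have vM: "v k \<in> M" for k using UM[OF v(1)] .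
  have vy: "d (v k) y \<le> \<rho> + h" for k
    using triangle[OF vM[of k] z(4)[of k] y_M] v(2)[of k] z(3)[of k] by (simp add: commute)
  have "\<exists>r l. strict_mono (r :: nat \<Rightarrow> nat) \<and> conv (v \<circ> r) l"
    using thick_bounded_compact[of "\<delta> / 2" v y "\<rho> + h"] v(5) vy pos by simp
  then obtain r u where ru: "strict_mono (r :: nat \<Rightarrow> nat)" "conv (v \<circ> r) u" by blast
  have uM: "u \<in> M" using ru(2) by (simp add: conv_def)
  have zr: "conv (z \<circ> r) y" by (rule conv_subseq[OF zc ru(1)])
  have duy: "d u y = \<rho>"
  proof -
    have "(\<lambda>k. d ((z \<circ> r) k) ((v \<circ> r) k)) \<longlonglongrightarrow> d y u" by (rule conv_dist[OF zr ru(2)])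
    moreover have "(\<lambda>k. d ((z \<circ> r) k) ((v \<circ> r) k)) = (\<lambda>_. \<rho>)" using v(2) by simp
    ultimately show ?thesis by (simp add: LIMSEQ_const_iff commute)
  qed
  have mono: "disp g y \<le> disp g u" if g: "g \<in> G" for g
    by (rule LIMSEQ_le[OF disp_conv[OF G_iso[OF g] zr] disp_conv[OF G_iso[OF g] ru(2)]]) (use v(3)[OF g] in auto)
  have lip: "\<bar>dset C a - dset C b\<bar> \<le> d a b" if "a \<in> M" "b \<in> M" for a b
    using dset_lipschitz[OF C(1) that] dset_lipschitz[OF C(1) that(2,1)] by (simp add: commute)
  have dset_conv: "(\<lambda>k. dset C (w k)) \<longlonglongrightarrow> dset C a" if w: "conv w a" for w a
  proof -
    have wM: "\<And>k. w k \<in> M" "a \<in> M" and lim: "(\<lambda>k. d (w k) a) \<longlonglongrightarrow> 0" using w by (auto simp: conv_def)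
    show ?thesis
      by (rule LIM_zero_cancel, rule Lim_null_comparison[OF _ lim]) (use lip[OF wM] in \<open>auto intro!: always_eventually\<close>)
  qed
  have dset: "dset C y + \<rho> \<le> dset C u"
    by (rule LIMSEQ_le[OF tendsto_add[OF dset_conv[OF zr] tendsto_const] dset_conv[OF ru(2)]]) (use v(4) in auto)
  have near: "g \<in> G" if g: "g \<in> \<Gamma>" "disp g u < \<tau> - 2 * \<rho>" for g
    by (rule G_letter[OF g(1)]) (use disp_lipschitz[OF \<Gamma>_iso[OF g(1)] y_M uM] g(2) duy in \<open>simp add: commute\<close>)
  have "u \<in> Z"
    unfolding Z_def thick_def
  proof (intro CollectI conjI ballI allI impI uM)
    fix g assume g: "g \<in> \<Gamma>s"
    \<comment> \<open>The approximating pushes only kept thickness \<delta>/2. In the limit the full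
      bound returns: an element violating it lies in \<open>G\<close> and displaces \<open>u\<close>
      at least as much as \<open>y\<close>.\<close>
    show "\<delta> \<le> disp g u"
    proof (rule ccontr)
      assume a: "\<not> ?thesis"
      then have "g \<in> G" using near[OF \<Gamma>s_\<Gamma>[OF g]] pos \<rho> by linarith
      then show False using mono[of g] crit_disp[OF crit_y g] a by linarith
    qed
  next
    fix e :: real assume e: "e > 0"
    have "(\<lambda>k. d ((v \<circ> r) k) u) \<longlonglongrightarrow> 0" using ru(2) by (simp add: conv_def)
    from eventually_happens'[OF sequentially_bot order_tendstoD(2)[OF this e]]
    show "\<exists>v\<in>U. d v u < e" using v(1) by auto
  qed
  have W_G: "set ws \<subseteq> G" if "ws \<in> W (lev m) (Suc m) y" for m ws
  proof
    fix g assume "g \<in> set ws"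
    then have "g \<in> \<Gamma>" "disp g y < lev m" using that by (auto simp: W_def)
    then show "g \<in> G" using G_letter lev_less[of m] by force
  qed
  have W_sub: "W (lev m) (Suc m) u \<subseteq> W (lev m) (Suc m) y" if "m \<le> n" for m
  proof
    fix ws assume ws: "ws \<in> W (lev m) (Suc m) u"
    have "disp g y < lev m" if g: "g \<in> set ws" for g
    proof -
      have gu: "g \<in> \<Gamma>" "disp g u < lev m" using g ws by (auto simp: W_def)
      have "lev m \<le> lev n" by (rule lev_mono[OF \<open>m \<le> n\<close>])
      then have "g \<in> G" using near[OF gu(1)] gu(2) \<rho> by linarith
      then show ?thesis using mono[of g] gu(2) by linarith
    qed
    then show "ws \<in> W (lev m) (Suc m) y" using ws by (auto simp: W_def)
  qed
  have W_le: "wt t ws u \<le> wt t ws y" if "ws \<in> W (lev m) (Suc m) y" for m ws t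
    by (rule wt_le) (use W_G[OF that] G_\<Gamma> mono G_word in \<open>auto simp: subset_iff\<close>)
  have le: "\<Psi> (lev m) (Suc m) u \<le> \<Psi> (lev m) (Suc m) y" if "m \<le> n" for m
    by (rule \<Psi>_le(1)[OF y_M uM W_sub[OF that] W_le])
  have eq: "\<Psi> (lev n) (Suc n) u = \<Psi> (lev n) (Suc n) y" by (rule crit_lex[OF crit_y \<open>u \<in> Z\<close> le])
  have "disp (I.word ws) u = disp (I.word ws) y" if ws: "ws \<in> W (lev n) (Suc n) y" for ws
  proof -
    have "wt (lev n) ws u = wt (lev n) ws y" by (rule \<Psi>_le(2)[OF y_M uM W_sub[OF order_refl] W_le eq ws])
    moreover have "wt (lev n) ws u < wt (lev n) ws y" if "disp (I.word ws) y < disp (I.word ws) u"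
      by (rule wt_strict[OF ws _ that]) (use W_G[OF ws] mono in auto)
    ultimately show ?thesis using mono[OF G_word[OF W_G[OF ws]]] by force
  qed
  then show ?thesis using \<rho>(1) uM duy dset by (intro exI[of _ \<rho>] conjI bexI[of _ u]) auto
qed

lemma word_pad: "set ws \<subseteq> carrier IG \<Longrightarrow> I.word (ws @ replicate n \<one>\<^bsub>IG\<^esub>) = I.word ws"
  by (subst I.word_append) (auto simp: I.word_replicate_one)

lemma one_letter: "\<one>\<^bsub>IG\<^esub> \<in> {g \<in> \<Gamma>. disp g y < lev n}"
  using \<Gamma>_closed(3) lev_ge[of n] pos by simp

lemma W_pad:
  assumes ws: "set ws \<subseteq> {g \<in> \<Gamma>. disp g y < lev n}" "length ws \<le> Suc n"
  shows "\<exists>vs\<in>W (lev n) (Suc n) y. I.word vs = I.word ws"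
proof (intro bexI[of _ "ws @ replicate (Suc n - length ws) \<one>\<^bsub>IG\<^esub>"])
  show "I.word (ws @ replicate (Suc n - length ws) \<one>\<^bsub>IG\<^esub>) = I.word ws"
    using ws(1) letters_iso by (intro word_pad) blast
  show "ws @ replicate (Suc n - length ws) \<one>\<^bsub>IG\<^esub> \<in> W (lev n) (Suc n) y"
    using ws one_letter[of n] by (auto simp: W_def set_replicate_conv_if)
qed

text \<open>The finitely many letters of a word stay below some c < \<tau>. A level above c whose
  index is also at least the length of the word admits it after padding with \<one>.\<close>

lemma G_level:
  assumes g: "g \<in> G"
  obtains n ws where "ws \<in> W (lev n) (Suc n) y" "I.word ws = g"
proof -
  obtain ws where ws: "set ws \<subseteq> {g \<in> \<Gamma>. disp g y < \<tau>}" "I.word ws = g"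
    using I.generate_word[OF letters_iso letters_inv] g unfolding G_def by blast
  define c where "c = Max (insert 0 ((\<lambda>g. disp g y) ` set ws))"
  have "c < \<tau>" unfolding c_def using ws pos by (subst Max_less_iff) auto
  then obtain n where n: "c < lev n" "n \<ge> length ws" using lev_unbounded by blast
  have "disp g y \<le> c" if "g \<in> set ws" for g unfolding c_def using that by (intro Max_ge) auto
  then have "set ws \<subseteq> {g \<in> \<Gamma>. disp g y < lev n}" using ws n by force
  then show thesis using W_pad[of ws n] n ws that by auto
qed

lemma U_approx: "\<exists>x. (\<forall>k. x k \<in> U) \<and> conv x y"
proof -
  have "\<exists>x\<in>U. d x y < e" if "e > 0" for e using crit_Z[OF crit_y] that by (auto simp: Z_def)
  then show ?thesis using conv_from_close[OF y_M, of U] UM by blast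
qed

text \<open>By \<open>flow_away\<close> the displacement is the same at \<open>u\<close> and at
  \<open>y\<close>, where \<open>y\<close> lies between \<open>q\<close> and \<open>u\<close>.
  Convexity then prevents it from being smaller at \<open>q\<close>, while projecting cannot
  increase it.\<close>

lemma disp_proj_eq:
  assumes C: "ccset C" "\<And>g. g \<in> G \<Longrightarrow> stable g C" and g: "g \<in> G"
  shows "disp g (proj C y) = disp g y"
proof (cases "y \<in> C")
  case True
  then show ?thesis using proj_id[OF C(1)] by simp
next
  case False
  obtain x where x: "\<And>k. x k \<in> U" "conv x y" using U_approx by blast
  define q where "q = proj C y"
  have q: "q \<in> C" "q \<in> M" using proj_in[OF C(1) y_M] ccset_subset[OF C(1)] by (auto simp: q_def)
  define a where "a = d q y"
  have a: "a > 0" using q False by (auto simp: a_def)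
  have ad: "dset C y = a" by (simp add: dset_def a_def q_def commute)
  have lim: "(\<lambda>k. d (x k) y) \<longlonglongrightarrow> 0" using x(2) by (auto simp: conv_def)
  obtain N where N: "\<And>k. k \<ge> N \<Longrightarrow> d (x k) y < a"
    using order_tendstoD(2)[OF lim a] unfolding eventually_sequentially by blast
  have out: "x (k + N) \<notin> C" for k
    using N[of "k + N"] dset_le[OF C(1) y_M, of "x (k + N)"] ad by (auto simp: commute)
  have c: "conv (\<lambda>k. x (k + N)) y" using conv_subseq[OF x(2), of "\<lambda>k. k + N"] by (simp add: strict_mono_def o_def)
  obtain n ws where ws: "ws \<in> W (lev n) (Suc n) y" "I.word ws = g" using G_level[OF g] .
  obtain \<rho> u where u: "\<rho> > 0" "u \<in> M" "d u y \<le> \<rho>" "a + \<rho> \<le> dset C u" "disp g u = disp g y"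
    using flow_away[of C "\<lambda>k. x (k + N)" n, OF C x(1) out c] ws unfolding ad by blast
  \<comment> \<open>The distance from \<open>C\<close> grows at the full rate, which forces
    \<open>q\<close>, \<open>y\<close>, \<open>u\<close> to lie on one geodesic in this
    order.\<close>
  have "dset C u \<le> d q u" using dset_le[OF C(1) u(2) q(1)] by (simp add: commute)
  moreover have "d q u \<le> a + d y u" unfolding a_def using q u by (intro triangle) auto
  ultimately have du: "d q u = a + \<rho>" "d y u = \<rho>" using u by (auto simp: commute)
  define s where "s = a / (a + \<rho>)"
  have s: "0 < s" "s < 1" using a u by (auto simp: s_def)
  have "pt s q u = y"
    using a u q du s by (intro pt_eqI) (auto simp: s_def a_def[symmetric] field_simps)
  then have "disp g y \<le> (1 - s) * disp g q + s * disp g u"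
    using disp_convex[OF G_iso[OF g] q(2) u(2), of s] s by simp
  then have "(1 - s) * disp g y \<le> (1 - s) * disp g q" using u(5) by (simp add: algebra_simps)
  then have "disp g y \<le> disp g q" using s by simp
  then show ?thesis using disp_proj[OF C(1) G_iso[OF g] C(2)[OF g] y_M] by (simp add: q_def)
qed

lemma conj_sublevels_ccset:
  assumes A: "A \<subseteq> G" "\<And>g a. g \<in> G \<Longrightarrow> a \<in> A \<Longrightarrow> g \<otimes>\<^bsub>IG\<^esub> a \<otimes>\<^bsub>IG\<^esub> inv\<^bsub>IG\<^esub> g \<in> A"
    and ne: "u \<in> M" "\<And>a. a \<in> A \<Longrightarrow> disp a u \<le> c"
  shows "ccset (M \<inter> \<Inter>((\<lambda>a. sublevel a c) ` A))"
    and "g \<in> G \<Longrightarrow> stable g (M \<inter> \<Inter>((\<lambda>a. sublevel a c) ` A))"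
proof -
  have iA: "iso a" if "a \<in> A" for a using A(1) G_iso that by blast
  show "ccset (M \<inter> \<Inter>((\<lambda>a. sublevel a c) ` A))"
    unfolding ccset_def
  proof (intro conjI gconvex_Inter sclosed_Inter)
    show "M \<inter> \<Inter>((\<lambda>a. sublevel a c) ` A) \<noteq> {}" using ne by (auto simp: sublevel_def)
  qed (use iA sublevel_closed sublevel_convex in blast)+
  have move: "disp a (g x) \<le> c" if "g \<in> G" "a \<in> A" "x \<in> M" "\<And>b. b \<in> A \<Longrightarrow> disp b x \<le> c" for g a x
  proof -
    have gi: "iso g" "inv\<^bsub>IG\<^esub> g \<in> G" using that G_iso G_closed by auto
    have "inv\<^bsub>IG\<^esub> g \<otimes>\<^bsub>IG\<^esub> a \<otimes>\<^bsub>IG\<^esub> g \<in> A" using A(2)[OF gi(2) that(2)] gi by simp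
    then show ?thesis using that(4)[of "inv\<^bsub>IG\<^esub> g \<otimes>\<^bsub>IG\<^esub> a \<otimes>\<^bsub>IG\<^esub> g"]
      disp_conj'[of g a x] that(1,2,3) G_\<Gamma> A(1) by auto
  qed
  show "stable g (M \<inter> \<Inter>((\<lambda>a. sublevel a c) ` A))" if g: "g \<in> G"
    unfolding stable_def sublevel_def using move[of g] move[of "inv\<^bsub>IG\<^esub> g"] g G_closed(2)[OF g] G_iso G_closed
    by auto
qed

text \<open>Let \<open>C\<close> be the set where all conjugates of \<open>w\<close> under
  \<open>G\<close> attain their minimum. It contains \<open>y\<close> but misses \<open>U\<close>,
  so nearby points can be pushed away from it. The conjugates are single letters below a suitable
  level, so the limit of the push has the same displacements as \<open>y\<close> and lies in
  \<open>C\<close>, although it is at positive distance from \<open>C\<close>.\<close>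

lemma no_short_invariant:
  assumes w: "w \<in> \<Gamma>s" "tl w \<le> \<mu>" and min: "\<And>g. g \<in> G \<Longrightarrow> disp (g \<otimes>\<^bsub>IG\<^esub> w \<otimes>\<^bsub>IG\<^esub> inv\<^bsub>IG\<^esub> g) y = tl w"
  shows False
proof -
  define A where "A = (\<lambda>g. g \<otimes>\<^bsub>IG\<^esub> w \<otimes>\<^bsub>IG\<^esub> inv\<^bsub>IG\<^esub> g) ` G"
  have wi: "iso w" by (rule \<Gamma>s_iso[OF w(1)])
  have wA: "w \<in> A"
    unfolding A_def using wi G_closed(3) by (intro image_eqI[of _ _ "\<one>\<^bsub>IG\<^esub>"]) auto
  have Ay: "disp a y = tl w" if "a \<in> A" for a using that min by (auto simp: A_def)
  have "disp w y < \<tau>" using Ay[OF wA] w pos by linarith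
  then have wG: "w \<in> G" by (rule G_letter[OF \<Gamma>s_\<Gamma>[OF w(1)]])
  have AG: "A \<subseteq> G" unfolding A_def using wG by (auto intro!: G_closed)
  have Ac: "g \<otimes>\<^bsub>IG\<^esub> a \<otimes>\<^bsub>IG\<^esub> inv\<^bsub>IG\<^esub> g \<in> A" if g: "g \<in> G" and a: "a \<in> A" for g a
  proof -
    obtain h where h: "h \<in> G" "a = h \<otimes>\<^bsub>IG\<^esub> w \<otimes>\<^bsub>IG\<^esub> inv\<^bsub>IG\<^esub> h" using a by (auto simp: A_def)
    have i: "iso g" "iso h" using g h G_iso by auto
    have "g \<otimes>\<^bsub>IG\<^esub> a \<otimes>\<^bsub>IG\<^esub> inv\<^bsub>IG\<^esub> g = (g \<otimes>\<^bsub>IG\<^esub> h) \<otimes>\<^bsub>IG\<^esub> w \<otimes>\<^bsub>IG\<^esub> inv\<^bsub>IG\<^esub> (g \<otimes>\<^bsub>IG\<^esub> h)"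
      unfolding h(2) using i wi by (simp add: I.m_assoc I.inv_mult_group)
    then show ?thesis unfolding A_def using G_closed(1)[OF g h(1)] by blast
  qed
  define C where "C = M \<inter> \<Inter>((\<lambda>a. sublevel a (tl w)) ` A)"
  have C: "ccset C" "\<And>g. g \<in> G \<Longrightarrow> stable g C"
    unfolding C_def using conj_sublevels_ccset[of A y "tl w", OF AG Ac y_M] Ay by auto
  have yC: "y \<in> C" using Ay by (auto simp: C_def sublevel_def)
  obtain x where x: "\<And>k. x k \<in> U" "conv x y" using U_approx by blast
  have out: "x k \<notin> C" for k
  proof
    assume "x k \<in> C"
    then have "disp w (x k) \<le> tl w" using wA by (auto simp: C_def sublevel_def)
    moreover have "x k \<in> U" using x(1) by blast
    ultimately show False using w by (force simp: U_def)
  qed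
  obtain n where n: "\<mu> < lev n" using lev_unbounded[OF pos(4)] by blast
  obtain \<rho> u where u: "\<rho> > 0" "u \<in> M" "dset C y + \<rho> \<le> dset C u"
    "\<And>ws. ws \<in> W (lev n) (Suc n) y \<Longrightarrow> disp (I.word ws) u = disp (I.word ws) y"
    using flow_away[of C x n, OF C x(1) out x(2)] by blast
  have "disp a u = tl w" if a: "a \<in> A" for a
  proof -
    have "disp a y < lev n" using Ay[OF a] w n by linarith
    then have "set [a] \<subseteq> {g \<in> \<Gamma>. disp g y < lev n}" using AG a G_\<Gamma> by auto
    then obtain vs where vs: "vs \<in> W (lev n) (Suc n) y" "I.word vs = I.word [a]" using W_pad[of "[a]" n] by auto
    have "I.word [a] = a" using AG a G_iso by auto
    then show ?thesis using u(4)[OF vs(1)] vs(2) Ay[OF a] by simp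
  qed
  then have "u \<in> C" using u by (auto simp: C_def sublevel_def)
  then have "dset C u = 0" using dset_zero[OF C(1) u(2)] by simp
  then show False using u dset_nonneg[of C y] by linarith
qed

end

section \<open>Nilpotent groups and central commutators\<close>

context group
begin

lemma lower_central_closed: "lower_central G n \<subseteq> carrier G"
proof (induction n)
  case (Suc n)
  then have "(\<Union>a\<in>lower_central G n. \<Union>b\<in>carrier G. {a \<otimes> b \<otimes> inv a \<otimes> inv b}) \<subseteq> carrier G" by auto
  then show ?case unfolding lower_central.simps by (rule generate_incl)
qed simp

lemma commutator_in_lower_central:
  "a \<in> lower_central G n \<Longrightarrow> b \<in> carrier G \<Longrightarrow> a \<otimes> b \<otimes> inv a \<otimes> inv b \<in> lower_central G (Suc n)"
  by (auto intro: generate.incl)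

lemma commute_if_commutator_one:
  assumes "a \<in> carrier G" "b \<in> carrier G" "a \<otimes> b \<otimes> inv a \<otimes> inv b = \<one>"
  shows "a \<otimes> b = b \<otimes> a"
proof -
  have "inv b \<otimes> (b \<otimes> a) = a" using assms(1,2) by (simp add: m_assoc[symmetric])
  then have "a \<otimes> b \<otimes> inv a \<otimes> inv b \<otimes> (b \<otimes> a) = a \<otimes> b"
    using assms(1,2) by (simp add: m_assoc)
  then show ?thesis using assms by simp
qed

text \<open>Descent along the lower central series: if term n + 2 is trivial, term n + 1 is central,
  so the commutators generating it are central, hence trivial by assumption, and term n + 1 vanishes
  already.\<close>

lemma abelian_if_central_commutators_trivial:
  assumes comm: "\<And>a b. a \<in> carrier G \<Longrightarrow> b \<in> carrier G \<Longrightarrow>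
      (\<And>c. c \<in> carrier G \<Longrightarrow> (a \<otimes> b \<otimes> inv a \<otimes> inv b) \<otimes> c = c \<otimes> (a \<otimes> b \<otimes> inv a \<otimes> inv b)) \<Longrightarrow>
      a \<otimes> b \<otimes> inv a \<otimes> inv b = \<one>"
  shows "lower_central G (Suc n) = {\<one>} \<Longrightarrow> a \<in> carrier G \<Longrightarrow> b \<in> carrier G \<Longrightarrow> a \<otimes> b = b \<otimes> a"
proof (induction n arbitrary: a b)
  case 0
  then have "a \<otimes> b \<otimes> inv a \<otimes> inv b = \<one>" using commutator_in_lower_central[of a 0 b] by auto
  then show ?case using commute_if_commutator_one 0 by blast
next
  case (Suc n)
  have central: "z \<otimes> c = c \<otimes> z" if z: "z \<in> lower_central G (Suc n)" and c: "c \<in> carrier G" for z c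
  proof (rule commute_if_commutator_one[OF _ c])
    show "z \<in> carrier G" using z lower_central_closed by blast
    show "z \<otimes> c \<otimes> inv z \<otimes> inv c = \<one>"
      using commutator_in_lower_central[OF z c] unfolding Suc.prems(1) by simp
  qed
  have "x \<otimes> c \<otimes> inv x \<otimes> inv c = \<one>" if x: "x \<in> lower_central G n" and c: "c \<in> carrier G" for x c
    by (rule comm) (use x c lower_central_closed central[OF commutator_in_lower_central[OF x c]] in auto)
  then have "(\<Union>a\<in>lower_central G n. \<Union>b\<in>carrier G. {a \<otimes> b \<otimes> inv a \<otimes> inv b}) \<subseteq> {\<one>}" by auto
  then have "lower_central G (Suc n) \<subseteq> {\<one>}"
    unfolding lower_central.simps by (rule generate_subgroup_incl) (rule triv_subgroup)
  moreover have "\<one> \<in> lower_central G (Suc n)" unfolding lower_central.simps by (rule generate.one)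
  ultimately have "lower_central G (Suc n) = {\<one>}" by blast
  then show ?case using Suc.IH Suc.prems by blast
qed

text \<open>The relation of the Heisenberg group: a central commutator is collected to the power m
  n. For m = n its exponent grows quadratically while those of the other factors grow
  linearly.\<close>

lemma pow_mult_swap:
  assumes cl: "a \<in> carrier G" "b \<in> carrier G" "z \<in> carrier G"
    and za: "z \<otimes> a = a \<otimes> z" and zb: "z \<otimes> b = b \<otimes> z" and ab: "a \<otimes> b = z \<otimes> (b \<otimes> a)"
  shows "a [^] (m::nat) \<otimes> b [^] (n::nat) = z [^] (m * n) \<otimes> (b [^] n \<otimes> a [^] m)"
proof -
  have zap: "z [^] k \<otimes> a = a \<otimes> z [^] k" and zbp: "b [^] k \<otimes> z = z \<otimes> b [^] k" for k :: nat
    using group_commutes_pow[OF za cl(3,1)] group_commutes_pow[OF zb[symmetric] cl(2,3)] by auto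
  have one: "a \<otimes> b [^] n = z [^] n \<otimes> (b [^] n \<otimes> a)" for n :: nat
  proof (induction n)
    case (Suc n)
    have "a \<otimes> b [^] Suc n = (a \<otimes> b [^] n) \<otimes> b" using cl by (simp add: m_assoc)
    also have "\<dots> = z [^] n \<otimes> (b [^] n \<otimes> (a \<otimes> b))" unfolding Suc using cl by (simp add: m_assoc)
    also have "\<dots> = z [^] n \<otimes> ((b [^] n \<otimes> z) \<otimes> (b \<otimes> a))" unfolding ab using cl by (simp add: m_assoc)
    also note zbp
    finally show ?case using cl by (simp add: m_assoc)
  qed (use cl in simp)
  show ?thesis
  proof (induction m)
    case (Suc m)
    have "a [^] Suc m \<otimes> b [^] n = a [^] m \<otimes> (a \<otimes> b [^] n)" using cl by (simp add: m_assoc)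
    also have "\<dots> = (a [^] m \<otimes> z [^] n) \<otimes> (b [^] n \<otimes> a)" unfolding one using cl by (simp add: m_assoc)
    also have "a [^] m \<otimes> z [^] n = z [^] n \<otimes> a [^] m"
      using group_commutes_pow[OF zap[symmetric] cl(1)] cl by simp
    also have "z [^] n \<otimes> a [^] m \<otimes> (b [^] n \<otimes> a) = z [^] n \<otimes> (a [^] m \<otimes> b [^] n) \<otimes> a" using cl by (simp add: m_assoc)
    also have "\<dots> = (z [^] n \<otimes> z [^] (m * n)) \<otimes> (b [^] n \<otimes> a [^] Suc m)" unfolding Suc using cl by (simp add: m_assoc)
    also have "z [^] n \<otimes> z [^] (m * n) = z [^] (Suc m * n)" using cl by (simp add: nat_pow_mult)
    finally show ?case .
  next
    case 0
    show ?case using cl by simp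
  qed
qed

end

lemma (in group_hom) lower_central_image:
  assumes "h ` carrier G = carrier H"
  shows "h ` lower_central G n = lower_central H n"
proof (induction n)
  case (Suc n)
  let ?A = "\<Union>a\<in>lower_central G n. \<Union>b\<in>carrier G. {a \<otimes> b \<otimes> inv a \<otimes> inv b}"
  let ?B = "\<Union>a\<in>lower_central H n. \<Union>b\<in>carrier H. {a \<otimes>\<^bsub>H\<^esub> b \<otimes>\<^bsub>H\<^esub> inv\<^bsub>H\<^esub> a \<otimes>\<^bsub>H\<^esub> inv\<^bsub>H\<^esub> b}"
  have cl: "lower_central G n \<subseteq> carrier G" by (rule G.lower_central_closed)
  have "?A \<subseteq> carrier G" using cl by auto
  moreover have "h ` ?A = ?B"
    unfolding Suc[symmetric] assms[symmetric] image_UN using cl by (auto simp: subset_iff)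
  ultimately show ?case using generate_img[of ?A] by simp
qed (simp add: assms)

section \<open>Structure of the group at a critical point\<close>

context critical_point
begin

text \<open>The fixed points of \<open>N\<close> form a nonempty, closed, convex and
  \<open>G\<close>-stable set. Projecting \<open>y\<close> to it preserves displacements, so
  \<open>N\<close> fixes \<open>y\<close>, whereas nontrivial elements move \<open>y\<close> by at
  least \<open>\<delta>\<close>.\<close>

lemma finite_normal_trivial:
  assumes N: "subgroup N IG" "finite N" "N \<subseteq> G"
    and norm: "\<And>g a. g \<in> G \<Longrightarrow> a \<in> N \<Longrightarrow> g \<otimes>\<^bsub>IG\<^esub> a \<otimes>\<^bsub>IG\<^esub> inv\<^bsub>IG\<^esub> g \<in> N"
  shows "N = {\<one>\<^bsub>IG\<^esub>}"
proof -
  have M: "ccset M" unfolding ccset_def sclosed_def gconvex_def using y_M by (auto simp: conv_def simp del: y_M)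
  have st: "stable g M" if "g \<in> N" for g
    using subgroup.subset[OF N(1)] that unfolding stable_def by auto
  obtain q where q: "q \<in> M" "\<And>g. g \<in> N \<Longrightarrow> g q = q" using finite_group_fixed_point[OF N(1,2) M st] by blast
  have q0: "disp a q \<le> 0" if "a \<in> N" for a using q(1) q(2)[OF that] by (simp add: disp_def)
  define C where "C = M \<inter> \<Inter>((\<lambda>a. sublevel a 0) ` N)"
  have C: "ccset C" "\<And>g. g \<in> G \<Longrightarrow> stable g C"
    unfolding C_def using conj_sublevels_ccset[of N q 0, OF N(3) norm q(1)] q0 by auto
  have "a = \<one>\<^bsub>IG\<^esub>" if a: "a \<in> N" for a
  proof (rule ccontr)
    assume "a \<noteq> \<one>\<^bsub>IG\<^esub>"
    then have "a \<in> \<Gamma>s" using a N(3) G_\<Gamma> by (auto simp: \<Gamma>s_def)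
    then have "\<delta> \<le> disp a y" by (rule crit_disp[OF crit_y])
    moreover have "disp a (proj C y) = disp a y" by (rule disp_proj_eq[OF C]) (use a N in auto)
    moreover have "disp a (proj C y) \<le> 0" using proj_in[OF C(1) y_M] a by (auto simp: C_def sublevel_def)
    ultimately show False using pos by linarith
  qed
  then show ?thesis using subgroup.one_closed[OF N(1)] by blast
qed

text \<open>The points displaced by at most l + e by all of \<open>A\<close> form a
  \<open>G\<close>-stable closed convex set, nonempty by \<open>near_minimal_commuting\<close>. The
  projection of \<open>y\<close> to it has the displacements of \<open>y\<close>, and e is
  arbitrary.\<close>

lemma min_if_finite_commuting_class:
  assumes A: "finite A" "A \<subseteq> G" "\<And>g a. g \<in> G \<Longrightarrow> a \<in> A \<Longrightarrow> g \<otimes>\<^bsub>IG\<^esub> a \<otimes>\<^bsub>IG\<^esub> inv\<^bsub>IG\<^esub> g \<in> A"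
    and comm: "\<And>g h. g \<in> A \<Longrightarrow> h \<in> A \<Longrightarrow> g \<otimes>\<^bsub>IG\<^esub> h = h \<otimes>\<^bsub>IG\<^esub> g"
    and tl: "\<And>a. a \<in> A \<Longrightarrow> tl a = l" and z: "z \<in> A"
  shows "disp z y = tl z"
proof (rule antisym)
  show "tl z \<le> disp z y" by (rule tl_le[OF y_M])
  show "disp z y \<le> tl z"
  proof (rule field_le_epsilon)
    fix e :: real assume e: "e > 0"
    have AI: "A \<subseteq> carrier IG" using A(2) G_iso by blast
    have "M \<noteq> {}" using y_M by blast
    then have "\<exists>u\<in>M. \<forall>g\<in>A. disp g u \<le> tl g + e" by (rule near_minimal_commuting[OF A(1) AI _ e comm])
    then obtain u where u: "u \<in> M" "\<And>a. a \<in> A \<Longrightarrow> disp a u \<le> l + e" using tl by auto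
    define C where "C = M \<inter> \<Inter>((\<lambda>a. sublevel a (l + e)) ` A)"
    have C: "ccset C" "\<And>g. g \<in> G \<Longrightarrow> stable g C"
      unfolding C_def using conj_sublevels_ccset[of A u "l + e", OF A(2,3) u] by auto
    have "disp z (proj C y) = disp z y" by (rule disp_proj_eq[OF C]) (use z A in auto)
    moreover have "disp z (proj C y) \<le> l + e" using proj_in[OF C(1) y_M] z by (auto simp: C_def sublevel_def)
    ultimately show "disp z y \<le> tl z + e" using tl[OF z] by simp
  qed
qed

text \<open>\<open>\<Lambda>\<close> is trivial by \<open>finite_normal_trivial\<close>, so
  \<open>\<Delta>\<close> is nilpotent. Central elements of \<open>\<Delta>\<close> have finitely
  many, commuting conjugates under \<open>G\<close>, hence are minimal at \<open>y\<close>. A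
  central commutator z of a and b is then trivial: the power of z with exponent n^2 is the
  commutator of a^n and b^n, so n^2 tl(z) grows at most linearly. Hence \<open>\<Delta>\<close> is
  abelian, and all its elements are central.\<close>

lemma virtually_abelian:
  assumes an: "almost_nilpotent (IG\<lparr>carrier := G\<rparr>) N S" and S: "S \<ge> 1"
  shows "\<exists>\<Delta>. subgroup \<Delta> IG \<and> \<Delta> \<subseteq> G \<and> (\<forall>g\<in>G. \<forall>k\<in>\<Delta>. g \<otimes>\<^bsub>IG\<^esub> k \<otimes>\<^bsub>IG\<^esub> inv\<^bsub>IG\<^esub> g \<in> \<Delta>) \<and>
    (\<forall>a\<in>\<Delta>. \<forall>b\<in>\<Delta>. a \<otimes>\<^bsub>IG\<^esub> b = b \<otimes>\<^bsub>IG\<^esub> a) \<and> (\<forall>k\<in>\<Delta>. disp k y = tl k) \<and>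
    finite ((\<lambda>g. \<Delta> #>\<^bsub>IG\<^esub> g) ` G) \<and> card ((\<lambda>g. \<Delta> #>\<^bsub>IG\<^esub> g) ` G) \<le> N"
proof -
  define H0 where "H0 = IG\<lparr>carrier := G\<rparr>"
  obtain \<Delta> \<Lambda> where norm: "\<Delta> \<lhd> H0" "\<Lambda> \<lhd> H0" "finite (rcosets\<^bsub>H0\<^esub> \<Delta>)" "card (rcosets\<^bsub>H0\<^esub> \<Delta>) \<le> N"
    "\<Lambda> \<subseteq> \<Delta>" "finite \<Lambda>" "nilpotent_of_step_le (H0\<lparr>carrier := \<Delta>\<rparr> Mod \<Lambda>) S"
    using an unfolding almost_nilpotent_def H0_def by blast
  have cosets: "rcosets\<^bsub>H0\<^esub> \<Delta> = (\<lambda>g. \<Delta> #>\<^bsub>IG\<^esub> g) ` G"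
    by (auto simp: RCOSETS_def r_coset_def H0_def)
  have inv_eq: "inv\<^bsub>H0\<^esub> g = inv\<^bsub>IG\<^esub> g" if "g \<in> G" for g
    unfolding H0_def by (rule I.m_inv_consistent[OF G_subgroup that])
  have conj: "g \<otimes>\<^bsub>IG\<^esub> k \<otimes>\<^bsub>IG\<^esub> inv\<^bsub>IG\<^esub> g \<in> K" if "K \<lhd> H0" "g \<in> G" "k \<in> K" for K g k
    using normal.inv_op_closed2[OF that(1), of g k] that inv_eq[OF that(2)] by (simp add: H0_def)
  have sub: "subgroup K IG" "K \<subseteq> G" if "K \<lhd> H0" for K
    using I.incl_subgroup[OF G_subgroup] subgroup.subset[OF normal_imp_subgroup[OF that]]
      normal_imp_subgroup[OF that] unfolding H0_def by auto
  have \<Delta>: "subgroup \<Delta> IG" "\<Delta> \<subseteq> G" using sub[OF norm(1)] by auto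
  have \<Delta>_iso: "iso a" if "a \<in> \<Delta>" for a using \<Delta>(2) that G_iso by blast
  have \<Lambda>: "\<Lambda> = {\<one>\<^bsub>IG\<^esub>}" using finite_normal_trivial sub[OF norm(2)] norm(6) conj[OF norm(2)] by blast
  define K where "K = IG\<lparr>carrier := \<Delta>\<rparr>"
  interpret K: group K unfolding K_def by (rule I.subgroup_imp_group[OF \<Delta>(1)])
  have K: "carrier K = \<Delta>" "\<one>\<^bsub>K\<^esub> = \<one>\<^bsub>IG\<^esub>" "a \<otimes>\<^bsub>K\<^esub> b = a \<otimes>\<^bsub>IG\<^esub> b" for a b by (auto simp: K_def)
  have Kinv: "inv\<^bsub>K\<^esub> a = inv\<^bsub>IG\<^esub> a" if "a \<in> \<Delta>" for a
    unfolding K_def by (rule I.m_inv_consistent[OF \<Delta>(1) that])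
  have "lower_central K S = {\<one>\<^bsub>K\<^esub>}"
  proof -
    have nil: "group (K Mod {\<one>\<^bsub>K\<^esub>})" "lower_central (K Mod {\<one>\<^bsub>K\<^esub>}) S = {\<one>\<^bsub>K Mod {\<one>\<^bsub>K\<^esub>}\<^esub>}"
      using norm(7) unfolding nilpotent_of_step_le_def \<Lambda> by (simp_all add: K_def H0_def)
    \<comment> \<open>\<open>almost_nilpotent\<close> speaks of the quotient by
      \<open>\<Lambda>\<close>. With \<open>\<Lambda>\<close> trivial, its elements are singletons
      and \<open>the_elem\<close> identifies it with \<open>\<Delta>\<close>.\<close>
    have "the_elem \<in> Group.iso (K Mod {\<one>\<^bsub>K\<^esub>}) K" by (rule K.trivial_factor_iso)
    then have h: "the_elem \<in> hom (K Mod {\<one>\<^bsub>K\<^esub>}) K" "the_elem ` carrier (K Mod {\<one>\<^bsub>K\<^esub>}) = carrier K"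
      by (auto simp: Group.iso_def bij_betw_def)
    interpret h: group_hom "K Mod {\<one>\<^bsub>K\<^esub>}" K the_elem
      using nil(1) h(1) K.group_axioms by (simp add: group_hom_def group_hom_axioms_def)
    show ?thesis using h.lower_central_image[OF h(2), of S] nil(2) h.hom_one by simp
  qed
  then obtain n where lc: "lower_central K (Suc n) = {\<one>\<^bsub>K\<^esub>}" using S by (cases S) auto
  have min: "disp z y = tl z" if z: "z \<in> \<Delta>" and zc: "\<And>c. c \<in> \<Delta> \<Longrightarrow> z \<otimes>\<^bsub>IG\<^esub> c = c \<otimes>\<^bsub>IG\<^esub> z" for z
  proof -
    \<comment> \<open>A conjugate of \<open>z\<close> depends only on the coset of the conjugating
      element, which makes the conjugacy class finite.\<close>
    define cj where "cj g = g \<otimes>\<^bsub>IG\<^esub> z \<otimes>\<^bsub>IG\<^esub> inv\<^bsub>IG\<^esub> g" for g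
    have zi: "iso z" using \<Delta>_iso[OF z] .
    have cj_in: "cj g \<in> \<Delta>" if "g \<in> G" for g unfolding cj_def by (rule conj[OF norm(1) that z])
    have cj_mult: "cj (g \<otimes>\<^bsub>IG\<^esub> h) = g \<otimes>\<^bsub>IG\<^esub> cj h \<otimes>\<^bsub>IG\<^esub> inv\<^bsub>IG\<^esub> g" if "g \<in> G" "h \<in> G" for g h
      unfolding cj_def using that[THEN G_iso] zi by (simp add: I.m_assoc I.inv_mult_group)
    have cj_\<Delta>: "cj c = z" if "c \<in> \<Delta>" for c
      unfolding cj_def by (rule conj_commute[OF zi \<Delta>_iso[OF that] zc[OF that]])
    have cj_coset: "cj g = cj h" if gh: "g \<in> G" "h \<in> G" "\<Delta> #>\<^bsub>IG\<^esub> g = \<Delta> #>\<^bsub>IG\<^esub> h" for g h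
    proof -
      have "g \<in> \<Delta> #>\<^bsub>IG\<^esub> h" using I.rcos_self[OF G_iso[OF gh(1)] \<Delta>(1)] gh(3) by simp
      then obtain k where k: "k \<in> \<Delta>" "g = k \<otimes>\<^bsub>IG\<^esub> h" by (auto simp: r_coset_def)
      have ih: "iso h" "inv\<^bsub>IG\<^esub> h \<in> G" using gh G_iso G_closed by auto
      have m: "inv\<^bsub>IG\<^esub> h \<otimes>\<^bsub>IG\<^esub> k \<otimes>\<^bsub>IG\<^esub> h \<in> \<Delta>" using conj[OF norm(1) ih(2) k(1)] ih by simp
      have "g = h \<otimes>\<^bsub>IG\<^esub> (inv\<^bsub>IG\<^esub> h \<otimes>\<^bsub>IG\<^esub> k \<otimes>\<^bsub>IG\<^esub> h)"
        unfolding k(2) using ih \<Delta>_iso[OF k(1)] by (simp add: I.m_assoc[symmetric])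
      then have "cj g = h \<otimes>\<^bsub>IG\<^esub> cj (inv\<^bsub>IG\<^esub> h \<otimes>\<^bsub>IG\<^esub> k \<otimes>\<^bsub>IG\<^esub> h) \<otimes>\<^bsub>IG\<^esub> inv\<^bsub>IG\<^esub> h"
        using cj_mult[OF gh(2)] m \<Delta>(2) by (metis subsetD)
      then show ?thesis unfolding cj_\<Delta>[OF m] by (simp add: cj_def)
    qed
    define A where "A = cj ` G"
    have "finite A"
    proof -
      have "A \<subseteq> (\<lambda>X. cj (SOME g. g \<in> G \<and> \<Delta> #>\<^bsub>IG\<^esub> g = X)) ` (rcosets\<^bsub>H0\<^esub> \<Delta>)"
      proof
        fix a assume "a \<in> A"
        then obtain g where g: "g \<in> G" "a = cj g" by (auto simp: A_def)
        define g' where "g' = (SOME g'. g' \<in> G \<and> \<Delta> #>\<^bsub>IG\<^esub> g' = \<Delta> #>\<^bsub>IG\<^esub> g)"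
        have "g' \<in> G \<and> \<Delta> #>\<^bsub>IG\<^esub> g' = \<Delta> #>\<^bsub>IG\<^esub> g" unfolding g'_def by (rule someI[of _ g]) (simp add: g)
        then have "a = cj g'" using cj_coset[of g g'] g by simp
        then show "a \<in> (\<lambda>X. cj (SOME g. g \<in> G \<and> \<Delta> #>\<^bsub>IG\<^esub> g = X)) ` (rcosets\<^bsub>H0\<^esub> \<Delta>)"
          unfolding cosets g'_def using g by blast
      qed
      then show ?thesis using norm(3) finite_surj by blast
    qed
    moreover have "A \<subseteq> G" using cj_in \<Delta>(2) by (auto simp: A_def)
    moreover have "g \<otimes>\<^bsub>IG\<^esub> a \<otimes>\<^bsub>IG\<^esub> inv\<^bsub>IG\<^esub> g \<in> A" if "g \<in> G" "a \<in> A" for g a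
    proof -
      obtain h where h: "h \<in> G" "a = cj h" using \<open>a \<in> A\<close> by (auto simp: A_def)
      show ?thesis
        unfolding h(2) cj_mult[OF that(1) h(1), symmetric] A_def by (rule imageI[OF G_closed(1)[OF that(1) h(1)]])
    qed
    \<comment> \<open>As \<open>\<Delta>\<close> is normal, a conjugate of \<open>z\<close> is again
      central in \<open>\<Delta>\<close> and commutes with every other conjugate.\<close>
    moreover have "a \<otimes>\<^bsub>IG\<^esub> b = b \<otimes>\<^bsub>IG\<^esub> a" if "a \<in> A" "b \<in> A" for a b
    proof -
      obtain g where g: "g \<in> G" "a = cj g" using \<open>a \<in> A\<close> by (auto simp: A_def)
      have b: "b \<in> \<Delta>" using \<open>b \<in> A\<close> cj_in by (auto simp: A_def)
      have gi: "iso g" "inv\<^bsub>IG\<^esub> g \<in> G" "iso b" using g G_iso G_closed \<Delta>_iso[OF b] by auto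
      define c where "c = inv\<^bsub>IG\<^esub> g \<otimes>\<^bsub>IG\<^esub> b \<otimes>\<^bsub>IG\<^esub> g"
      have c: "c \<in> \<Delta>" using conj[OF norm(1) gi(2) b] gi by (simp add: c_def)
      have bc: "b = g \<otimes>\<^bsub>IG\<^esub> c \<otimes>\<^bsub>IG\<^esub> inv\<^bsub>IG\<^esub> g"
        by (rule iso_eqI) (use gi in \<open>auto simp: c_def\<close>)
      have ci: "iso c" using \<Delta>_iso[OF c] .
      have swap: "z (c x) = c (z x)" if "x \<in> M" for x
        using arg_cong[OF zc[OF c], of "\<lambda>f. f x"] zi ci that by simp
      show ?thesis
      proof (rule iso_eqI)
        fix x assume x: "x \<in> M"
        have gx: "(inv\<^bsub>IG\<^esub> g) x \<in> M" using gi x by simp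
        have "(a \<otimes>\<^bsub>IG\<^esub> b) x = g (z (c ((inv\<^bsub>IG\<^esub> g) x)))" unfolding g(2) cj_def bc using gi zi ci x by simp
        also have "\<dots> = g (c (z ((inv\<^bsub>IG\<^esub> g) x)))" by (simp only: swap[OF gx])
        also have "\<dots> = (b \<otimes>\<^bsub>IG\<^esub> a) x" unfolding g(2) cj_def bc using gi zi ci x by simp
        finally show "(a \<otimes>\<^bsub>IG\<^esub> b) x = (b \<otimes>\<^bsub>IG\<^esub> a) x" .
      qed (use gi g cj_in \<Delta>_iso in auto)
    qed
    moreover have "tl a = tl z" if "a \<in> A" for a
      using that zi G_iso tl_conj by (auto simp: A_def cj_def)
    moreover have "z \<in> A"
      unfolding A_def using cj_\<Delta>[of "\<one>\<^bsub>IG\<^esub>"] subgroup.one_closed[OF \<Delta>(1)] G_closed(3) by force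
    ultimately show ?thesis by (rule min_if_finite_commuting_class)
  qed
  have comm: "a \<otimes>\<^bsub>IG\<^esub> b = b \<otimes>\<^bsub>IG\<^esub> a" if ab: "a \<in> \<Delta>" "b \<in> \<Delta>" for a b
  proof -
    have "a \<otimes>\<^bsub>K\<^esub> b = b \<otimes>\<^bsub>K\<^esub> a"
    proof (rule K.abelian_if_central_commutators_trivial[OF _ lc])
      fix a b assume ab: "a \<in> carrier K" "b \<in> carrier K"
        and cen: "\<And>c. c \<in> carrier K \<Longrightarrow> (a \<otimes>\<^bsub>K\<^esub> b \<otimes>\<^bsub>K\<^esub> inv\<^bsub>K\<^esub> a \<otimes>\<^bsub>K\<^esub> inv\<^bsub>K\<^esub> b) \<otimes>\<^bsub>K\<^esub> c = c \<otimes>\<^bsub>K\<^esub> (a \<otimes>\<^bsub>K\<^esub> b \<otimes>\<^bsub>K\<^esub> inv\<^bsub>K\<^esub> a \<otimes>\<^bsub>K\<^esub> inv\<^bsub>K\<^esub> b)"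
      define z where "z = a \<otimes>\<^bsub>K\<^esub> b \<otimes>\<^bsub>K\<^esub> inv\<^bsub>K\<^esub> a \<otimes>\<^bsub>K\<^esub> inv\<^bsub>K\<^esub> b"
      have zK: "z \<in> carrier K" using ab by (simp add: z_def)
      have z\<Delta>: "z \<in> \<Delta>" using zK by (simp add: K)
      have zc: "z \<otimes>\<^bsub>IG\<^esub> c = c \<otimes>\<^bsub>IG\<^esub> z" if "c \<in> \<Delta>" for c
        using cen[of c, folded z_def] that by (simp only: K)
      have minz: "disp z y = tl z" by (rule min[OF z\<Delta> zc])
      have i: "iso a" "iso b" "iso z" using ab z\<Delta> \<Delta>_iso by (auto simp: K)
      have zab: "a \<otimes>\<^bsub>IG\<^esub> b = z \<otimes>\<^bsub>IG\<^esub> (b \<otimes>\<^bsub>IG\<^esub> a)"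
        by (rule iso_eqI) (use i ab Kinv in \<open>auto simp: z_def K\<close>)
      have bound: "real n * tl z \<le> 2 * (disp a y + disp b y)" if n: "n > 0" for n :: nat
      proof -
        let ?p = "\<lambda>g. g [^]\<^bsub>IG\<^esub> n"
        have pi: "iso (?p a)" "iso (?p b)" using i by auto
        have e: "z [^]\<^bsub>IG\<^esub> (n * n) = ?p a \<otimes>\<^bsub>IG\<^esub> ?p b \<otimes>\<^bsub>IG\<^esub> inv\<^bsub>IG\<^esub> (?p b \<otimes>\<^bsub>IG\<^esub> ?p a)"
          using I.pow_mult_swap[OF i zc zc zab, of n n] ab i pi
          by (simp add: K I.inv_solve_right)
        have "real n * (real n * tl z) = disp (z [^]\<^bsub>IG\<^esub> (n * n)) y"
          using disp_pow_Min[OF i(3) y_M minz, of "n * n"] by simp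
        also have "\<dots> \<le> disp (?p a \<otimes>\<^bsub>IG\<^esub> ?p b) y + disp (?p b \<otimes>\<^bsub>IG\<^esub> ?p a) y"
          unfolding e using disp_mult[of "?p a \<otimes>\<^bsub>IG\<^esub> ?p b" "inv\<^bsub>IG\<^esub> (?p b \<otimes>\<^bsub>IG\<^esub> ?p a)" y]
            disp_inv[of "?p b \<otimes>\<^bsub>IG\<^esub> ?p a" y] pi by simp
        also have "\<dots> \<le> 2 * (disp (?p a) y + disp (?p b) y)"
          using disp_mult[OF pi y_M] disp_mult[OF pi(2,1) y_M] by simp
        also have "\<dots> \<le> 2 * (real n * disp a y + real n * disp b y)"
          using disp_pow_le[OF i(1) y_M, of n] disp_pow_le[OF i(2) y_M, of n] by simp
        also have "\<dots> = real n * (2 * (disp a y + disp b y))" by (simp add: algebra_simps)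
        finally show ?thesis using n by simp
      qed
      have "tl z \<le> 0" by (rule nonpos_if_multiples_bounded[OF bound]) simp
      then have "z = \<one>\<^bsub>IG\<^esub>"
        using crit_disp[OF crit_y, of z] z\<Delta> \<Delta>(2) G_\<Gamma> minz pos by (force simp: \<Gamma>s_def)
      then show "a \<otimes>\<^bsub>K\<^esub> b \<otimes>\<^bsub>K\<^esub> inv\<^bsub>K\<^esub> a \<otimes>\<^bsub>K\<^esub> inv\<^bsub>K\<^esub> b = \<one>\<^bsub>K\<^esub>" by (simp add: z_def K)
    qed (use ab K in auto)
    then show ?thesis by (simp add: K)
  qed
  then have "disp k y = tl k" if "k \<in> \<Delta>" for k using min that by blast
  then show ?thesis using \<Delta> comm conj[OF norm(1)] norm(3,4) unfolding cosets by blast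
qed

end

section \<open>The contradiction obtained by moving a critical point inside its flat\<close>

context critical_point
begin

lemma disp_word_le:
  "set ws \<subseteq> {g \<in> \<Gamma>. disp g y < s} \<Longrightarrow> disp (I.word ws) y \<le> real (length ws) * s"
proof (induction ws)
  case (Cons a ws)
  then have "a \<in> \<Gamma>" "disp a y < s" "I.word ws \<in> \<Gamma>" by (auto intro: word_\<Gamma>)
  then have "disp (a \<otimes>\<^bsub>IG\<^esub> I.word ws) y \<le> s + disp (I.word ws) y"
    using disp_mult[of a "I.word ws" y] \<Gamma>_iso by force
  then show ?case using Cons by (simp add: algebra_simps)
qed simp

text \<open>\<open>thin\<close> is how the small diastole enters: the first potential has a nonzero
  term at \<open>y\<close>. The margin between \<open>s\<^sub>1\<close> and \<open>s\<close> makes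
  every element displacing the moved point \<open>u\<close> by less than \<open>s\<^sub>1\<close>
  lie in the finite group \<open>F\<close>, so that all terms of the first potential are under
  control.\<close>

lemma crit_impossible:
  assumes an: "almost_nilpotent (IG\<lparr>carrier := G\<rparr>) N S" and N: "N \<ge> 1" and S: "S \<ge> 1"
    and s: "s\<^sub>1 < s" "(2 * real N - 1) * s \<le> \<mu>" and thin: "\<exists>g\<in>\<Gamma>s. disp g y < s\<^sub>1"
  shows False
proof -
  obtain \<Delta> where \<Delta>1: "subgroup \<Delta> IG" "\<Delta> \<subseteq> G"
    "\<forall>g\<in>G. \<forall>k\<in>\<Delta>. g \<otimes>\<^bsub>IG\<^esub> k \<otimes>\<^bsub>IG\<^esub> inv\<^bsub>IG\<^esub> g \<in> \<Delta>"
    "\<forall>a\<in>\<Delta>. \<forall>b\<in>\<Delta>. a \<otimes>\<^bsub>IG\<^esub> b = b \<otimes>\<^bsub>IG\<^esub> a" "\<forall>k\<in>\<Delta>. disp k y = tl k"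
    and cosets: "finite ((\<lambda>g. \<Delta> #>\<^bsub>IG\<^esub> g) ` G)" "card ((\<lambda>g. \<Delta> #>\<^bsub>IG\<^esub> g) ` G) \<le> N"
    using virtually_abelian[OF an S] by (elim exE conjE) (rule that; assumption)
  note \<Delta> = \<Delta>1(1,2) \<Delta>1(3)[rule_format] \<Delta>1(4)[rule_format] \<Delta>1(5)[rule_format]
  interpret T: translation_lattice M d \<Delta> 
    by (intro translation_lattice.intro translation_lattice_axioms.intro complete_CAT0_axioms \<Delta>(1) \<Delta>(4))
  have yY: "y \<in> T.Y" 
    unfolding T.Y_def by (intro CollectI conjI ballI y_M) (rule \<Delta>(5))
  have nml: "T.nml g" if g: "g \<in> G" for g
    unfolding T.nml_def
  proof (intro conjI ballI)
    show "iso g" by (rule G_iso[OF g])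
    show "g \<otimes>\<^bsub>IG\<^esub> k \<otimes>\<^bsub>IG\<^esub> inv\<^bsub>IG\<^esub> g \<in> \<Delta>" if "k \<in> \<Delta>" for k by (rule \<Delta>(3)[OF g that])
    show "inv\<^bsub>IG\<^esub> g \<otimes>\<^bsub>IG\<^esub> k \<otimes>\<^bsub>IG\<^esub> g \<in> \<Delta>" if "k \<in> \<Delta>" for k
      using \<Delta>(3)[OF G_closed(2)[OF g] that] G_iso[OF g] by simp
  qed
  have coset_eq: "a \<otimes>\<^bsub>IG\<^esub> inv\<^bsub>IG\<^esub> b \<in> \<Delta>" if "a \<in> G" "b \<in> G" "\<Delta> #>\<^bsub>IG\<^esub> a = \<Delta> #>\<^bsub>IG\<^esub> b" for a b
  proof -
    have "a \<in> \<Delta> #>\<^bsub>IG\<^esub> b" using I.rcos_self[OF G_iso[OF that(1)] \<Delta>(1)] that(3) by simp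
    then obtain k where k: "k \<in> \<Delta>" "a = k \<otimes>\<^bsub>IG\<^esub> b" by (auto simp: r_coset_def)
    then show ?thesis using G_iso[OF that(2)] T.\<Delta>_iso[OF k(1)] by (simp add: I.m_assoc)
  qed
  define rep where "rep X = (SOME g. g \<in> G \<and> \<Delta> #>\<^bsub>IG\<^esub> g = X)" for X
  have rep: "rep (\<Delta> #>\<^bsub>IG\<^esub> g) \<in> G \<and> \<Delta> #>\<^bsub>IG\<^esub> rep (\<Delta> #>\<^bsub>IG\<^esub> g) = \<Delta> #>\<^bsub>IG\<^esub> g" if "g \<in> G" for g
    unfolding rep_def by (rule someI[of _ g]) (simp add: that)
  define R where "R = rep ` ((\<lambda>g. \<Delta> #>\<^bsub>IG\<^esub> g) ` G)"
  have R: "finite R" "R \<subseteq> G" using cosets(1) rep by (auto simp: R_def)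
  have R_rep: "\<exists>r\<in>R. \<exists>k\<in>\<Delta>. g = r \<otimes>\<^bsub>IG\<^esub> k" if g: "g \<in> G" for g
  proof -
    define r where "r = rep (\<Delta> #>\<^bsub>IG\<^esub> g)"
    have r: "r \<in> R" "r \<in> G" "\<Delta> #>\<^bsub>IG\<^esub> g = \<Delta> #>\<^bsub>IG\<^esub> r" using rep[OF g] g by (auto simp: r_def R_def)
    have i: "iso r" "iso g" "inv\<^bsub>IG\<^esub> r \<in> G" using r g G_iso G_closed by auto
    have "inv\<^bsub>IG\<^esub> r \<otimes>\<^bsub>IG\<^esub> (g \<otimes>\<^bsub>IG\<^esub> inv\<^bsub>IG\<^esub> r) \<otimes>\<^bsub>IG\<^esub> inv\<^bsub>IG\<^esub> (inv\<^bsub>IG\<^esub> r) \<in> \<Delta>"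
      by (rule \<Delta>(3)[OF i(3) coset_eq[OF g r(2,3)]])
    moreover have "g = r \<otimes>\<^bsub>IG\<^esub> (inv\<^bsub>IG\<^esub> r \<otimes>\<^bsub>IG\<^esub> (g \<otimes>\<^bsub>IG\<^esub> inv\<^bsub>IG\<^esub> r) \<otimes>\<^bsub>IG\<^esub> inv\<^bsub>IG\<^esub> (inv\<^bsub>IG\<^esub> r))"
      by (rule iso_eqI) (use i in auto)
    ultimately show ?thesis using r(1) by blast
  qed
  have flat: "g y \<in> T.flat y" if "g \<in> G" for g
    by (rule T.orbit_in_flat[OF G_subgroup nml \<Delta>(2) R R_rep yY disp_proj_eq that])
  have no_short: "w = \<one>\<^bsub>IG\<^esub>" if w: "w \<in> \<Delta>" "disp w y \<le> \<mu>" for w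
  proof (rule ccontr)
    assume "w \<noteq> \<one>\<^bsub>IG\<^esub>"
    then have "w \<in> \<Gamma>s" using w \<Delta>(2) G_\<Gamma> by (auto simp: \<Gamma>s_def)
    moreover have "tl w \<le> \<mu>" using w \<Delta>(5) by simp
    moreover have "disp (g \<otimes>\<^bsub>IG\<^esub> w \<otimes>\<^bsub>IG\<^esub> inv\<^bsub>IG\<^esub> g) y = tl w" if "g \<in> G" for g
      using \<Delta>(5)[OF \<Delta>(3)[OF that w(1)]] tl_conj[OF G_iso[OF that] T.\<Delta>_iso[OF w(1)]] by simp
    ultimately show False by (rule no_short_invariant)
  qed
  define A where "A = {g \<in> \<Gamma>. disp g y < s}"
  have s0: "s > 0" using s pos by linarith
  have "1 * s \<le> (2 * real N - 1) * s" using N s0 by (intro mult_right_mono) auto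
  then have s\<tau>: "s < \<tau>" using s pos by linarith
  have A_G: "A \<subseteq> G"
  proof
    fix a assume "a \<in> A"
    then have "a \<in> \<Gamma>" "disp a y < \<tau>" using s\<tau> by (auto simp: A_def)
    then show "a \<in> G" by (rule G_letter)
  qed
  define F where "F = generate IG A"
  have F_sub: "subgroup F IG" unfolding F_def A_def by (rule I.generate_is_subgroup[OF letters_iso])
  have F_G: "F \<subseteq> G" unfolding F_def by (rule I.generate_subgroup_incl[OF A_G G_subgroup])
  have A_F: "A \<subseteq> F" unfolding F_def by (rule subsetI) (rule generate.incl)
  have F_fin: "finite F"
    unfolding F_def
  proof (rule I.finite_if_short_words_avoid[where \<kappa> = "\<lambda>g. \<Delta> #>\<^bsub>IG\<^esub> g" and K = \<Delta>, OF _ _ _ _ cosets N])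
    show "inv\<^bsub>IG\<^esub> a \<in> A" if "a \<in> A" for a
      using letters_inv[of a s] that unfolding A_def by blast
    show "A \<subseteq> carrier IG" unfolding A_def by (rule letters_iso)
    show "\<one>\<^bsub>IG\<^esub> \<in> A" using \<Gamma>_closed(3) s0 by (simp add: A_def)
    show "finite A" unfolding A_def by (rule finite_disp[OF y_M])
    show "\<Delta> #>\<^bsub>IG\<^esub> a \<in> (\<lambda>g. \<Delta> #>\<^bsub>IG\<^esub> g) ` G" if "a \<in> generate IG A" for a
      using that F_G unfolding F_def by blast
    show "a \<otimes>\<^bsub>IG\<^esub> inv\<^bsub>IG\<^esub> b \<in> \<Delta>"
      if "a \<in> generate IG A" "b \<in> generate IG A" "\<Delta> #>\<^bsub>IG\<^esub> a = \<Delta> #>\<^bsub>IG\<^esub> b" for a b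
      using that F_G unfolding F_def by (intro coset_eq) auto
    \<comment> \<open>Such a word displaces \<open>y\<close> by at most (2 N - 1) s \<le> \<mu>, and
      \<open>no_short\<close> leaves only \<one> in \<open>\<Delta>\<close> with this
      property.\<close>
    show "I.word ws = \<one>\<^bsub>IG\<^esub>" if ws: "set ws \<subseteq> A" "length ws \<le> 2 * N - 1" "I.word ws \<in> \<Delta>" for ws
    proof (rule no_short[OF ws(3)])
      have "real (length ws) \<le> 2 * real N - 1" using ws(2) N by linarith
      then have "real (length ws) * s \<le> (2 * real N - 1) * s" using s0 by (intro mult_right_mono) auto
      then show "disp (I.word ws) y \<le> \<mu>" using disp_word_le[of ws s] ws(1) s(2) by (simp add: A_def)
    qed
  qed
  have nmlF: "T.nml a" and flatF: "a y \<in> T.flat y" if "a \<in> F" for a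
    using nml flat subsetD[OF F_G that] by blast+
  have "\<exists>K\<ge>0. \<forall>r\<ge>0. \<forall>e>0.
    \<exists>t\<in>T.vecs. T.D y t \<le> K \<and> (\<forall>a\<in>F. (1 + r) * disp a y - e \<le> disp a (T.act (T.sc r t) y))"
    by (rule T.radial_growth[of F y, OF F_sub F_fin nmlF yY]) (simp_all add: flatF)
  then obtain K where K: "K \<ge> 0" "\<forall>r\<ge>0. \<forall>e>0.
    \<exists>t\<in>T.vecs. T.D y t \<le> K \<and> (\<forall>a\<in>F. (1 + r) * disp a y - e \<le> disp a (T.act (T.sc r t) y))"
    by (elim exE conjE) (rule that; assumption)
  \<comment> \<open>Two kinds of elements could keep the moved point out of \<open>U\<close>: those
    minimal at \<open>y\<close>, which a generic direction must take off their minimum, and those of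
    \<open>W2\<close> below, already off their minimum at \<open>y\<close>, for which a short move
    suffices.\<close>
  define W1 where "W1 = {w \<in> \<Gamma>s. tl w \<le> \<mu> \<and> disp w y = tl w}"
  have W1_sub: "W1 \<subseteq> {g \<in> \<Gamma>. disp g y < \<tau>}" using pos \<Gamma>s_\<Gamma> by (auto simp: W1_def)
  have W1_fin: "finite W1" by (rule finite_subset[OF W1_sub finite_disp[OF y_M]])
  have W1_nml: "T.nml w" if "w \<in> W1" for w using nml G_letter W1_sub that by blast
  \<comment> \<open>If no direction took \<open>w\<close> off its minimum, its displacement would be
    constant on the flat. As the flat contains the orbit of \<open>y\<close>, all conjugates of
    \<open>w\<close> would be minimal at \<open>y\<close>, which \<open>no_short_invariant\<close>
    forbids.\<close>
  have W1_pw: "\<exists>t\<in>T.vecs. T.pw w y t > 0" if w: "w \<in> W1" for w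
  proof (rule ccontr)
    assume none: "\<not> ?thesis"
    have wi: "iso w" "tl w \<ge> 0" "disp w y = tl w" using w \<Gamma>s_iso disp_nonneg[of w y] by (auto simp: W1_def simp del: disp_nonneg)
    have 1: "disp w (T.act t y) = tl w" if t: "t \<in> T.vecs" for t
    proof -
      have "\<not> 0 < T.pw w y t" using none t by blast
      then have "T.pw w y t = 0" using T.pw_nonneg[of w y t] by linarith
      then have "(disp w (T.act t y))\<^sup>2 = (tl w)\<^sup>2"
        using T.disp_min_on_flat[OF W1_nml[OF w] yY wi(3) t] by simp
      then show ?thesis using wi(2) by (simp add: power2_eq_iff_nonneg)
    qed
    have 2: "disp w p = tl w" if p: "p \<in> T.flat y" for p
    proof (rule antisym)
      have pM: "p \<in> M" by (rule T.flat_M[OF p])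
      show "tl w \<le> disp w p" by (rule tl_le[OF pM])
      show "disp w p \<le> tl w"
      proof (rule field_le_epsilon)
        fix e :: real assume "e > 0"
        then have "e / 2 > 0" by simp
        then obtain t where t: "t \<in> T.vecs" "d p (T.act t y) < e / 2" by (rule T.flatE[OF p])
        then show "disp w p \<le> tl w + e"
          using disp_lipschitz[OF wi(1) pM T.act_M[OF t(1) yY]] 1[OF t(1)] by linarith
      qed
    qed
    have "disp (g \<otimes>\<^bsub>IG\<^esub> w \<otimes>\<^bsub>IG\<^esub> inv\<^bsub>IG\<^esub> g) y = tl w" if g: "g \<in> G" for g
      using disp_conj[OF G_iso[OF g] wi(1) y_M] 2[OF flat[OF G_closed(2)[OF g]]] by simp
    then show False using no_short_invariant[of w] w by (auto simp: W1_def)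
  qed
  define W2 where "W2 = {w \<in> \<Gamma>s. tl w \<le> \<mu> \<and> tl w < disp w y \<and> disp w y < \<tau>}"
  have "finite W2" by (rule finite_subset[OF _ finite_disp[OF y_M, of \<tau>]]) (auto simp: W2_def \<Gamma>s_\<Gamma>)
  then obtain h1 where h1: "h1 > 0" "\<And>w. w \<in> W2 \<Longrightarrow> h1 * 2 < disp w y - tl w"
    using T.small_multiple[of W2 "\<lambda>w. disp w y - tl w" "\<lambda>_. 2"] by (auto simp: W2_def)
  \<comment> \<open>A move by less than \<open>h\<close> changes displacements by less than 2 h.
    This keeps \<open>W2\<close> off its minima, elements from \<open>\<tau>\<close> upwards above
    \<open>\<mu>\<close>, and elements below \<open>s\<^sub>1\<close> at the new point below
    \<open>s\<close> at \<open>y\<close>.\<close>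
  define h where "h = min h1 (min ((\<tau> - \<mu>) / 4) ((s - s\<^sub>1) / 4))"
  have "h > 0" using h1 pos s by (simp add: h_def)
  moreover have "h \<le> h1" "h \<le> (\<tau> - \<mu>) / 4" "h \<le> (s - s\<^sub>1) / 4"
    unfolding h_def by (rule min.cobounded1 min.coboundedI2[OF min.cobounded1] min.coboundedI2[OF min.cobounded2])+
  ultimately have h: "h > 0" "h \<le> h1" "4 * h \<le> \<tau> - \<mu>" "4 * h \<le> s - s\<^sub>1"
    by (simp_all add: field_simps)
  \<comment> \<open>The radial move has length at most r K \<le> h/2; the other half of
    \<open>h\<close> is left for the perturbation.\<close>
  define r where "r = (h / 2) / (K + 1)"
  have r: "r > 0" "2 * (r * K) \<le> h"
  proof -
    show "r > 0" using h K by (simp add: r_def)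
    have k: "K + 1 \<noteq> 0" using K(1) by linarith
    have "r * (K + 1) = h / 2" using r_def by (simp only: nonzero_eq_divide_eq[OF k])
    then show "2 * (r * K) \<le> h" using \<open>r > 0\<close> by (simp add: algebra_simps)
  qed
  have r\<delta>: "r * \<delta> > 0" using r pos by simp
  then obtain t where t: "t \<in> T.vecs" "T.D y t \<le> K"
    "\<And>a. a \<in> F \<Longrightarrow> (1 + r) * disp a y - r * \<delta> / 4 \<le> disp a (T.act (T.sc r t) y)"
    using K(2)[rule_format, of r "r * \<delta> / 4"] r(1) by auto
  have rt: "T.sc r t \<in> T.vecs" using t by simp
  \<comment> \<open>For nontrivial elements of \<open>F\<close> the radial move gains at least r
    \<delta> up to the error r \<delta>/4, and the perturbation loses less than 2 \<epsilon> \<le> r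
    \<delta>/2, so a positive gain remains.\<close>
  define \<epsilon> where "\<epsilon> = min (h / 2) (r * \<delta> / 4)"
  have "\<epsilon> > 0" using h r\<delta> by (simp add: \<epsilon>_def)
  moreover have "\<epsilon> \<le> h / 2" "\<epsilon> \<le> r * \<delta> / 4"
    unfolding \<epsilon>_def by (rule min.cobounded1 min.cobounded2)+
  ultimately have \<epsilon>: "\<epsilon> > 0" "2 * \<epsilon> \<le> h" "4 * \<epsilon> \<le> r * \<delta>"
    by (simp_all add: field_simps)
  obtain e where e: "e \<in> T.vecs" "T.D y e < \<epsilon>" "\<And>w. w \<in> W1 \<Longrightarrow> T.pw w y (T.sc r t @ e) > 0"
    using T.generic_perturbation[OF W1_fin W1_nml W1_pw yY rt \<epsilon>(1)] by blast
  define u where "u = T.act (T.sc r t @ e) y"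
  have rte: "T.sc r t @ e \<in> T.vecs" using rt e by simp
  have uM: "u \<in> M" unfolding u_def by (rule T.act_M[OF rte yY])
  have duy: "d y u < h"
  proof -
    have "d y u \<le> T.D y (T.sc r t) + T.D y e"
      using T.D_append[OF rt e(1) yY] by (simp add: T.D_def u_def)
    moreover have "T.D y (T.sc r t) \<le> r * K"
      using T.D_sc[OF t(1) yY, of r] r t(2) by (simp add: mult_left_mono)
    ultimately show ?thesis using e(2) \<epsilon> r by linarith
  qed
  have grow: "disp a y < disp a u" if a: "a \<in> F" "a \<noteq> \<one>\<^bsub>IG\<^esub>" for a
  proof -
    have aG: "a \<in> G" "a \<in> \<Gamma>s" using a F_G G_\<Gamma> by (auto simp: \<Gamma>s_def)
    have vM: "T.act (T.sc r t) y \<in> M" by (rule T.act_M[OF rt yY])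
    have "d (T.act (T.sc r t) y) u = T.D y e"
      unfolding u_def T.act_append using rt e(1) yY by (simp add: T.D_def)
    then have "disp a (T.act (T.sc r t) y) \<le> disp a u + 2 * T.D y e"
      using disp_lipschitz[OF G_iso[OF aG(1)] vM uM] by simp
    moreover have "r * \<delta> \<le> r * disp a y" using crit_disp[OF crit_y aG(2)] r by simp
    moreover have "disp a y + r * disp a y - r * \<delta> / 4 \<le> disp a (T.act (T.sc r t) y)"
      using t(3)[OF a(1)] by (simp add: algebra_simps)
    ultimately show ?thesis using e(2) \<epsilon>(3) r\<delta> by linarith
  qed
  have near: "a \<in> F" if a: "a \<in> \<Gamma>" "disp a u < s\<^sub>1" for a
    using disp_lipschitz[OF \<Gamma>_iso[OF a(1)] y_M uM] duy h a A_F by (auto simp: A_def)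
  have "u \<in> U"
    unfolding U_def
  proof (intro CollectI conjI ballI impI uM)
    fix w assume w: "w \<in> \<Gamma>s" "tl w \<le> \<mu>"
    have lip: "disp w y \<le> disp w u + 2 * d y u" by (rule disp_lipschitz[OF \<Gamma>s_iso[OF w(1)] y_M uM])
    consider "w \<in> W1" | "w \<in> W2" | "disp w y \<ge> \<tau>"
      using w tl_le[OF y_M, of w] unfolding W1_def W2_def by force
    then show "tl w < disp w u"
    proof cases
      case 1
      have "disp w y = tl w" using 1 by (simp add: W1_def)
      then have "(disp w u)\<^sup>2 = (tl w)\<^sup>2 + (T.pw w y (T.sc r t @ e))\<^sup>2"
        unfolding u_def by (rule T.disp_min_on_flat[OF W1_nml[OF 1] yY _ rte])
      moreover have "(T.pw w y (T.sc r t @ e))\<^sup>2 > 0" using e(3)[OF 1] by simp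
      ultimately have "(tl w)\<^sup>2 < (disp w u)\<^sup>2" by linarith
      then show ?thesis by (rule power2_less_imp_less) simp
    next
      case 2
      then show ?thesis using h1(2)[OF 2] lip duy h by linarith
    next
      case 3
      then show ?thesis using lip duy h w pos by linarith
    qed
  qed
  moreover have "u \<in> thick \<delta>"
    unfolding thick_def
  proof (intro CollectI conjI ballI uM)
    fix g assume g: "g \<in> \<Gamma>s"
    show "\<delta> \<le> disp g u"
    proof (rule ccontr)
      assume a: "\<not> ?thesis"
      then have "g \<in> F" using near[OF \<Gamma>s_\<Gamma>[OF g]] pos by linarith
      then show False using grow[of g] crit_disp[OF crit_y g] g a by (auto simp: \<Gamma>s_def)
    qed
  qed
  ultimately have uZ: "u \<in> Z" using uM by (auto simp: Z_def intro!: bexI[of _ u])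
  have le: "disp a y \<le> disp a u" if "a \<in> F" for a
    using grow[OF that] uM by (cases "a = \<one>\<^bsub>IG\<^esub>") auto
  have W_F: "\<exists>a\<in>F. ws = [a]" if ws: "ws \<in> W s\<^sub>1 1 y" for ws
  proof -
    obtain a where a: "ws = [a]" using ws by (auto simp: W_def length_Suc_conv)
    have "a \<in> A" using ws s by (auto simp: W_def A_def a)
    then show ?thesis using a A_F by blast
  qed
  have F_iso: "iso a" "a \<in> \<Gamma>" if "a \<in> F" for a using that F_G G_iso G_\<Gamma> by auto
  have W_sub: "W s\<^sub>1 1 u \<subseteq> W s\<^sub>1 1 y"
  proof
    fix ws assume ws: "ws \<in> W s\<^sub>1 1 u"
    obtain a where a: "ws = [a]" using ws by (auto simp: W_def length_Suc_conv)
    have "a \<in> \<Gamma>" "disp a u < s\<^sub>1" using ws by (auto simp: W_def a)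
    then show "ws \<in> W s\<^sub>1 1 y" using le[OF near[of a]] by (auto simp: W_def a)
  qed
  have W_le: "wt s\<^sub>1 ws u \<le> wt s\<^sub>1 ws y" if ws: "ws \<in> W s\<^sub>1 1 y" for ws
  proof -
    obtain a where a: "a \<in> F" "ws = [a]" using W_F[OF ws] by blast
    show ?thesis by (rule wt_le) (use a le F_iso in auto)
  qed
  \<comment> \<open>Level 0 is \<open>s\<^sub>1\<close> with words of one letter, so only the first
    potential has to be compared.\<close>
  have "\<Psi> (lev 0) (Suc 0) u = \<Psi> (lev 0) (Suc 0) y"
    by (rule crit_lex[OF crit_y uZ]) (use \<Psi>_le(1)[OF y_M uM W_sub W_le] in simp)
  then have eq: "\<Psi> s\<^sub>1 1 u = \<Psi> s\<^sub>1 1 y" by simp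
  obtain a where a: "a \<in> \<Gamma>s" "disp a y < s\<^sub>1" using thin by blast
  have aF: "a \<in> F" using a s A_F \<Gamma>s_\<Gamma> by (auto simp: A_def)
  have aW: "[a] \<in> W s\<^sub>1 1 y" using a \<Gamma>s_\<Gamma> by (auto simp: W_def)
  have g: "disp a y < disp a u" using grow[OF aF] a(1) by (auto simp: \<Gamma>s_def)
  have "wt s\<^sub>1 [a] u < wt s\<^sub>1 [a] y"
    by (rule wt_strict[OF aW]) (use g F_iso[OF aF] in auto)
  then show False using \<Psi>_le(2)[OF y_M uM W_sub W_le eq aW] by simp
qed

end

theorem theorem3p1:
  fixes M :: "'a set" and d :: "'a \<Rightarrow> 'a \<Rightarrow> real" and \<Gamma> :: "('a \<Rightarrow> 'a) set"
    and P\<^sub>0 r\<^sub>0 \<epsilon>\<^sub>0 l :: real and I\<^sub>0 S\<^sub>0 :: nat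
  assumes "P\<^sub>0 > 0" and "r\<^sub>0 > 0"
    and "BGT_constants TYPE('a) P\<^sub>0 r\<^sub>0 \<epsilon>\<^sub>0 I\<^sub>0 S\<^sub>0"
    and "CAT0_space M d" and "Metric_space.mcomplete M d" and "geodesically_complete M d"
    and "packed M d P\<^sub>0 r\<^sub>0"
    and "subgroup \<Gamma> (isom_group M d)" and "discrete_group M d \<Gamma>" and "almost_cocompact M d \<Gamma>"
    and "0 < l" and "l \<le> \<epsilon>\<^sub>0"
    and "dias M d \<Gamma> < ereal (l / ((2 * real I\<^sub>0 - 1) * (3 * 2 ^ (S\<^sub>0 - 1) - 2)))"
  shows "M = Min_le M d \<Gamma> l"
proof (rule ccontr)
  assume neq: "M \<noteq> Min_le M d \<Gamma> l"
  interpret complete_CAT0 M d using assms(4,5) by (rule complete_CAT0.intro)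
  have IS: "I\<^sub>0 \<ge> 1" "S\<^sub>0 \<ge> 1" using assms(3) by (auto simp: BGT_constants_def)
  have "Min_le M d \<Gamma> l \<subseteq> M" by (auto simp: Min_le_def Min_set_def)
  then obtain x0 where x0: "x0 \<in> M" "x0 \<notin> Min_le M d \<Gamma> l" using neq by blast
  have x0_moved: "tl w < disp w x0" if "w \<in> nontrivial M d \<Gamma>" "tl w \<le> l" for w
    using x0 that tl_le[OF x0(1), of w] by (force simp: Min_le_def Min_set_def disp_def)
  define \<eta> where "\<eta> = l / ((2 * real I\<^sub>0 - 1) * (3 * 2 ^ (S\<^sub>0 - 1) - 2))"
  obtain s\<^sub>1 where s1: "dias M d \<Gamma> < ereal s\<^sub>1" "s\<^sub>1 < \<eta>"
    using ereal_dense2[OF assms(13)] unfolding \<eta>_def by auto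
  have thin: "\<exists>g\<in>nontrivial M d \<Gamma>. disp g x < s\<^sub>1" if x: "x \<in> M" for x
  proof -
    have "sys M d \<Gamma> x \<le> dias M d \<Gamma>" unfolding dias_def by (rule SUP_upper[OF x])
    then have "sys M d \<Gamma> x < ereal s\<^sub>1" using s1(1) by simp
    then show ?thesis by (simp add: sys_def INF_less_iff disp_def)
  qed
  have s1_pos: "s\<^sub>1 > 0" using thin[OF x0(1)] disp_nonneg le_less_trans by blast
  \<comment> \<open>The threshold for the generators of the finite group, strictly above
    \<open>s\<^sub>1\<close> to leave room for moving the critical point and strictly below \<eta>
    to keep \<open>\<mu>\<close> below \<open>l\<close>.\<close>
  define s where "s = (s\<^sub>1 + \<eta>) / 2"
  have s: "s\<^sub>1 < s" "s < \<eta>" "0 < s" using s1 s1_pos by (auto simp: s_def)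
  define \<mu> where "\<mu> = (2 * real I\<^sub>0 - 1) * s"
  have I1: "2 * real I\<^sub>0 - 1 \<ge> 1" using IS(1) by simp
  have "1 * s \<le> \<mu>" unfolding \<mu>_def using I1 s(3) by (intro mult_right_mono) auto
  then have \<mu>: "s\<^sub>1 \<le> \<mu>" using s by linarith
  have "\<mu> < (2 * real I\<^sub>0 - 1) * \<eta>" unfolding \<mu>_def using I1 s(2) by (intro mult_strict_left_mono) auto
  also have "\<dots> = l / (3 * 2 ^ (S\<^sub>0 - 1) - 2)" using I1 by (simp add: \<eta>_def)
  also have "\<dots> \<le> l"
  proof -
    have "(1::real) \<le> 2 ^ (S\<^sub>0 - 1)" by simp
    then have "(1::real) \<le> 3 * 2 ^ (S\<^sub>0 - 1) - 2" by linarith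
    then show ?thesis using assms(11) by (simp add: divide_le_eq mult_le_cancel_left1)
  qed
  finally have \<mu>l: "\<mu> < l" .
  \<comment> \<open>Above \<open>\<mu>\<close> to leave room for pushes, and below \<open>l\<close>,
    hence below \<open>\<epsilon>\<^sub>0\<close>, so that the Breuillard--Green--Tao constants
    apply to the group generated by letters below \<open>\<tau>\<close>.\<close>
  define \<tau> where "\<tau> = (\<mu> + l) / 2"
  have \<tau>: "\<mu> < \<tau>" "\<tau> < l" using \<mu>l by (auto simp: \<tau>_def)
  have iso\<Gamma>: "iso g" if "g \<in> \<Gamma>" for g using subgroup.subset[OF assms(8)] that by blast
  define A where "A = {g \<in> nontrivial M d \<Gamma>. disp g x0 < s\<^sub>1}"
  have A_fin: "finite A"
  proof (rule finite_subset)
    show "A \<subseteq> {g \<in> \<Gamma>. d x0 (g x0) < s\<^sub>1}" by (auto simp: A_def nontrivial_def disp_def)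
    show "finite {g \<in> \<Gamma>. d x0 (g x0) < s\<^sub>1}"
      using assms(9) x0(1) s1_pos by (simp add: discrete_group_def)
  qed
  have A_ne: "A \<noteq> {}" using thin[OF x0(1)] by (auto simp: A_def)
  \<comment> \<open>An element fixing \<open>x0\<close> would have translation length 0 \<le> l and
    \<open>x0\<close> in its minimal set, contrary to the choice of \<open>x0\<close>.\<close>
  have A_pos: "0 < disp g x0" if "g \<in> A" for g
  proof (rule ccontr)
    assume "\<not> ?thesis"
    then have 0: "disp g x0 = 0" using disp_nonneg[of g x0] by linarith
    have g: "g \<in> nontrivial M d \<Gamma>" using that by (simp add: A_def)
    have "tl g \<le> 0" using tl_le[OF x0(1), of g] 0 by simp
    moreover have "0 \<le> tl g" using x0 by (intro tl_nonneg) auto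
    ultimately show False using x0_moved[OF g] 0 assms(11) by simp
  qed
  \<comment> \<open>The least displacement at \<open>x0\<close> among the finitely many nontrivial
    elements below \<open>s\<^sub>1\<close>. It is positive and puts \<open>x0\<close> into the
    thick part, which makes \<open>Z\<close> nonempty.\<close>
  define \<delta> where "\<delta> = Min ((\<lambda>g. disp g x0) ` A)"
  have \<delta>_le: "\<delta> \<le> disp g x0" if "g \<in> A" for g
    unfolding \<delta>_def using A_fin that by (intro Min_le) auto
  have \<delta>: "0 < \<delta>" "\<delta> \<le> s\<^sub>1"
  proof -
    show "0 < \<delta>" unfolding \<delta>_def using A_fin A_ne A_pos by (subst Min_gr_iff) auto
    obtain g where "g \<in> A" using A_ne by blast
    then show "\<delta> \<le> s\<^sub>1" using \<delta>_le[of g] by (simp add: A_def)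
  qed
  interpret thin_group M d \<Gamma> s\<^sub>1 \<mu> \<tau> \<delta>
    by (intro thin_group.intro thin_group_axioms.intro complete_CAT0_axioms assms \<delta> \<mu> \<tau>)
  have nt: "nontrivial M d \<Gamma> = \<Gamma>s" by (simp add: nontrivial_def \<Gamma>s_def)
  have "x0 \<in> U" using x0 x0_moved \<mu>l by (simp add: U_def nt)
  moreover have "x0 \<in> thick \<delta>"
    unfolding thick_def
  proof (intro CollectI conjI ballI x0)
    show "\<delta> \<le> disp g x0" if "g \<in> \<Gamma>s" for g
      using \<delta>_le[of g] \<delta>(2) that by (cases "disp g x0 < s\<^sub>1") (auto simp: A_def nt)
  qed
  ultimately have "x0 \<in> Z" using x0(1) by (auto simp: Z_def intro!: bexI[of _ x0])
  then have "Z \<noteq> {}" by blast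
  then obtain y where y: "crit y" by (rule crit_exists)
  interpret critical_point M d \<Gamma> s\<^sub>1 \<mu> \<tau> \<delta> y
    by (intro critical_point.intro critical_point_axioms.intro thin_group_axioms y)
  define B where "B = {g \<in> \<Gamma>. disp g y < \<tau>}"
  have B_fin: "finite B" unfolding B_def by (rule finite_disp[OF y_M])
  obtain g where g: "g \<in> \<Gamma>s" "disp g y < s\<^sub>1" using thin[OF y_M] by (auto simp: nt)
  have gB: "g \<in> B" using g \<Gamma>s_\<Gamma> \<mu> \<tau> by (auto simp: B_def)
  \<comment> \<open>The letters of \<open>G\<close> obey a strict bound, whereas
    \<open>small_displacement_group\<close> uses a weak one. There are finitely many letters, so
    their largest displacement yields the same generating set.\<close>
  define c where "c = Max ((\<lambda>g. disp g y) ` B)"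
  have c_ge: "disp h y \<le> c" if "h \<in> B" for h unfolding c_def using that B_fin by (intro Max_ge) auto
  have c_less: "c < \<tau>" unfolding c_def using B_fin gB by (subst Max_less_iff) (auto simp: B_def)
  have c_pos: "c > 0" using c_ge[OF gB] crit_disp[OF y g(1)] \<delta>(1) by linarith
  have "almost_nilpotent (small_displacement_group M d \<Gamma> c y) I\<^sub>0 S\<^sub>0"
    using assms c_pos c_less \<tau> y_M unfolding BGT_constants_def by simp
  moreover have "{g \<in> \<Gamma>. d y (g y) \<le> c} = B"
    using c_ge c_less by (auto simp: B_def disp_def)
  ultimately have "almost_nilpotent (IG\<lparr>carrier := G\<rparr>) I\<^sub>0 S\<^sub>0"
    by (simp add: small_displacement_group_def G_def B_def)
  then show False
    by (rule crit_impossible[OF _ IS s(1)]) (use g in \<open>auto simp: \<mu>_def\<close>)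
qed

end
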